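(* For $\alpha\in(0,\infty)$ let $E_\alpha\subset\mathbb{R}^2$ be given in polar coordinates $(r,\varphi)$ by $$E_\alpha := \left\{(r,\varphi): \ \frac1{(\varphi + \pi)^\alpha} \le r < \frac 1{\varphi^\alpha}, \ 2\pi \le \varphi < \infty\right\}.$$ Let $p \in [1,\infty)$, $\tau \in [0,1/p]$, and $s\in(0,1]$. (i) Let $\alpha\in(0, 1)$. Then ${\bf 1}_{E_\alpha} \in B^{s,\tau}_{p, \infty} (\mathbb{R}^2)$ if and only if $s\le \frac{2\alpha}{\alpha+1} \left(\frac 1p - \tau\right)$. (ii) Let $\alpha =1$. Then ${\bf 1}_{E_\alpha} \in B^{s,\tau}_{p, \infty} (\mathbb{R}^2)$ if and only if $s \le \frac1p - \tau$ and $s<\frac1p$. (iii) Let $\alpha\in(1,\infty)$. Then ${\bf 1}_{E_\alpha} \in B^{s,\tau}_{p, \infty} (\mathbb{R}^2)$ if and only if $s\le \frac{2\alpha}{\alpha+1} \left(\frac 1p - \tau\right)$ and $s\le \frac 1p$.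
   Context: $(r,\varphi)$ stands for the point $(r\cos\varphi,r\sin\varphi)$, with $\varphi$ ranging over $[2\pi,\infty)$ (not reduced modulo $2\pi$). ${\bf 1}_{E_\alpha}$ is the characteristic function of $E_\alpha$. Dyadic cubes: for $j\in\mathbb{Z}$, $k\in\mathbb{Z}^n$ let $Q_{j,k}:=2^{-j}([0,1)^n+k)$ (here $n=2$); $\mathcal{Q}$ is the set of all of them; $\ell(P)$ is the edge length of $P$ and $j_P:=-\log_2\ell(P)$. Function spaces: fix $\varphi_0,\varphi\in\mathcal{S}(\mathbb{R}^n)$ with real-valued nonnegative Fourier transforms such that $\mathrm{supp}\,\mathcal{F}\varphi_0\subset\{|\xi|\le 2\}$, $|\mathcal{F}\varphi_0(\xi)|\ge C>0$ for $|\xi|\le 5/3$, $\mathrm{supp}\,\mathcal{F}\varphi\subset\{1/2\le|\xi|\le 2\}$, $|\mathcal{F}\varphi(\xi)|\ge C>0$ for $3/5\le|\xi|\le 5/3$; put $\varphi_j:=2^{jn}\varphi(2^j\cdot)$ for $j\ge 1$. For $s\in\mathbb{R}$, $\tau\in[0,\infty)$, $p,q\in(0,\infty]$, the Besov-type space $B^{s,\tau}_{p,q}(\mathbb{R}^n)$ is the set of all $f\in\mathcal{S}'(\mathbb{R}^n)$ with $$\|f\|_{B^{s,\tau}_{p,q}(\mathbb{R}^n)}:=\sup_{P\in\mathcal{Q}}\frac1{|P|^{\tau}}\Big\{\sum_{j=\max\{j_P,0\}}^\infty 2^{js q}\Big[\int_P|\varphi_j\ast f(x)|^p\,dx\Big]^{q/p}\Big\}^{1/q}<\infty,$$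 with the usual modifications if $p=\infty$ and/or $q=\infty$. *)

theory Defs
  imports "HOL-Analysis.Analysis" "HOL-Probability.Essential_Supremum"
begin

section \<open>Schwartz functions and tempered distributions\<close>

definition partial_deriv :: "'n \<Rightarrow> (real ^ 'n \<Rightarrow> complex) \<Rightarrow> real ^ 'n \<Rightarrow> complex" where
  "partial_deriv i f x = frechet_derivative f (at x) (axis i 1)"

text \<open>Multi-indices are encoded as lists of directions; for smooth functions the order of the
  directions is immaterial.\<close>

definition iterated_deriv :: "'n list \<Rightarrow> (real ^ 'n \<Rightarrow> complex) \<Rightarrow> real ^ 'n \<Rightarrow> complex" where
  "iterated_deriv ds f = foldr partial_deriv ds f"

definition schwartz_space :: "(real ^ 'n \<Rightarrow> complex) set" where
  "schwartz_space =
     {f. (\<forall>ds x. iterated_deriv ds f differentiable (at x)) \<and>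
         (\<forall>N ds. bounded (range (\<lambda>x. (1 + norm x) ^ N *\<^sub>R iterated_deriv ds f x)))}"

definition schwartz_seminorm :: "nat \<Rightarrow> 'n list \<Rightarrow> (real ^ 'n \<Rightarrow> complex) \<Rightarrow> real" where
  "schwartz_seminorm N ds f = (SUP x. (1 + norm x) ^ N * norm (iterated_deriv ds f x))"

definition schwartz_topology :: "(real ^ 'n \<Rightarrow> complex) topology" where
  "schwartz_topology = topology_generated_by
     {{g \<in> schwartz_space. schwartz_seminorm N ds (\<lambda>x. g x - f x) < e} | f N ds e.
        f \<in> schwartz_space \<and> e > 0}"

text \<open>A tempered distribution is a functional on the Schwartz space only; its values elsewhere
  are normalised by \<^const>\<open>extensional\<close>.\<close>

definition tempered_distributions :: "((real ^ 'n \<Rightarrow> complex) \<Rightarrow> complex) set" where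
  "tempered_distributions =
     {T \<in> extensional schwartz_space.
        (\<forall>f \<in> schwartz_space. \<forall>g \<in> schwartz_space. T (\<lambda>x. f x + g x) = T f + T g) \<and>
        (\<forall>c. \<forall>f \<in> schwartz_space. T (\<lambda>x. c * f x) = c * T f) \<and>
        continuous_map schwartz_topology euclidean T}"

definition regular_distribution ::
    "(real ^ 'n \<Rightarrow> complex) \<Rightarrow> (real ^ 'n \<Rightarrow> complex) \<Rightarrow> complex" where
  "regular_distribution g = restrict (\<lambda>\<psi>. LINT x|lebesgue. g x * \<psi> x) schwartz_space"

definition distr_convolution ::
    "(real ^ 'n \<Rightarrow> complex) \<Rightarrow> ((real ^ 'n \<Rightarrow> complex) \<Rightarrow> complex) \<Rightarrow> real ^ 'n \<Rightarrow> complex" where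
  "distr_convolution \<psi> T x = T (\<lambda>y. \<psi> (x - y))"

definition fourier_transform :: "(real ^ 'n \<Rightarrow> complex) \<Rightarrow> real ^ 'n \<Rightarrow> complex" where
  "fourier_transform f \<xi> =
     complex_of_real ((2 * pi) powr (- real CARD('n) / 2)) *
     (LINT x|lebesgue. exp (- (\<i> * complex_of_real (x \<bullet> \<xi>))) * f x)"


section \<open>Littlewood-Paley families and dyadic cubes\<close>

definition admissible_pair :: "(real ^ 'n \<Rightarrow> complex) \<Rightarrow> (real ^ 'n \<Rightarrow> complex) \<Rightarrow> bool" where
  "admissible_pair \<phi>0 \<phi> \<longleftrightarrow>
     \<phi>0 \<in> schwartz_space \<and> \<phi> \<in> schwartz_space \<and>
     (\<forall>\<xi>. fourier_transform \<phi>0 \<xi> \<in> \<real> \<and> 0 \<le> Re (fourier_transform \<phi>0 \<xi>)) \<and>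
     (\<forall>\<xi>. fourier_transform \<phi> \<xi> \<in> \<real> \<and> 0 \<le> Re (fourier_transform \<phi> \<xi>)) \<and>
     closure {\<xi>. fourier_transform \<phi>0 \<xi> \<noteq> 0} \<subseteq> {\<xi>. norm \<xi> \<le> 2} \<and>
     (\<exists>C>0. \<forall>\<xi>. norm \<xi> \<le> 5/3 \<longrightarrow> C \<le> norm (fourier_transform \<phi>0 \<xi>)) \<and>
     closure {\<xi>. fourier_transform \<phi> \<xi> \<noteq> 0} \<subseteq> {\<xi>. 1/2 \<le> norm \<xi> \<and> norm \<xi> \<le> 2} \<and>
     (\<exists>C>0. \<forall>\<xi>. 3/5 \<le> norm \<xi> \<and> norm \<xi> \<le> 5/3 \<longrightarrow> C \<le> norm (fourier_transform \<phi> \<xi>))"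

definition lp_family ::
    "(real ^ 'n \<Rightarrow> complex) \<Rightarrow> (real ^ 'n \<Rightarrow> complex) \<Rightarrow> nat \<Rightarrow> real ^ 'n \<Rightarrow> complex" where
  "lp_family \<phi>0 \<phi> j =
     (if j = 0 then \<phi>0 else (\<lambda>x. 2 ^ (j * CARD('n)) * \<phi> (2 ^ j *\<^sub>R x)))"

definition dyadic_cube :: "int \<Rightarrow> int ^ 'n \<Rightarrow> (real ^ 'n) set" where
  "dyadic_cube j k =
     (\<lambda>x. (2 powi (- j)) *\<^sub>R (x + (\<chi> i. real_of_int (k $ i)))) ` {x. \<forall>i. 0 \<le> x $ i \<and> x $ i < 1}"


section \<open>Besov-type spaces\<close>

text \<open>Only used with exponents \<open>a > 0\<close>.\<close>

definition ennreal_powr :: "ennreal \<Rightarrow> real \<Rightarrow> ennreal" where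
  "ennreal_powr x a = (if x = \<infinity> then \<infinity> else ennreal (enn2real x powr a))"

definition Lp_norm_on :: "ennreal \<Rightarrow> (real ^ 'n) set \<Rightarrow> (real ^ 'n \<Rightarrow> complex) \<Rightarrow> ennreal" where
  "Lp_norm_on p P g =
     (if p = \<infinity> then esssup (lebesgue_on P) (\<lambda>x. ennreal (norm (g x)))
      else ennreal_powr (\<integral>\<^sup>+x\<in>P. ennreal (norm (g x) powr enn2real p) \<partial>lebesgue) (1 / enn2real p))"

definition lq_norm_from :: "ennreal \<Rightarrow> nat \<Rightarrow> (nat \<Rightarrow> ennreal) \<Rightarrow> ennreal" where
  "lq_norm_from q J a =
     (if q = \<infinity> then (SUP j\<in>{J..}. a j)
      else ennreal_powr (\<Sum>i. ennreal_powr (a (J + i)) (enn2real q)) (1 / enn2real q))"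

text \<open>For \<open>P = dyadic_cube j k\<close> the edge length is \<open>2\<^sup>-\<^sup>j\<close>, hence \<open>j\<^sub>P = j\<close> and
  \<open>nat j\<close> is \<open>max {j\<^sub>P, 0}\<close>.\<close>

definition besov_type_norm ::
    "(real ^ 'n \<Rightarrow> complex) \<Rightarrow> (real ^ 'n \<Rightarrow> complex) \<Rightarrow> real \<Rightarrow> real \<Rightarrow> ennreal \<Rightarrow> ennreal \<Rightarrow>
     ((real ^ 'n \<Rightarrow> complex) \<Rightarrow> complex) \<Rightarrow> ennreal" where
  "besov_type_norm \<phi>0 \<phi> s \<tau> p q T =
     (SUP (j, k) \<in> (UNIV :: (int \<times> (int ^ 'n)) set).
        ennreal (1 / measure lebesgue (dyadic_cube j k) powr \<tau>) *
        lq_norm_from q (nat j)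
          (\<lambda>i. ennreal (2 powr (real i * s)) *
               Lp_norm_on p (dyadic_cube j k) (distr_convolution (lp_family \<phi>0 \<phi> i) T)))"

definition besov_type_space ::
    "(real ^ 'n \<Rightarrow> complex) \<Rightarrow> (real ^ 'n \<Rightarrow> complex) \<Rightarrow> real \<Rightarrow> real \<Rightarrow> ennreal \<Rightarrow> ennreal \<Rightarrow>
     ((real ^ 'n \<Rightarrow> complex) \<Rightarrow> complex) set" where
  "besov_type_space \<phi>0 \<phi> s \<tau> p q =
     {T \<in> tempered_distributions. besov_type_norm \<phi>0 \<phi> s \<tau> p q T < \<infinity>}"


section \<open>The spiral domain\<close>

definition spiral :: "real \<Rightarrow> (real ^ 2) set" where
  "spiral \<alpha> =
     {vector [r * cos t, r * sin t] | r t.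
        1 / (t + pi) powr \<alpha> \<le> r \<and> r < 1 / t powr \<alpha> \<and> 2 * pi \<le> t}"

end

theory Submission
  imports Defs
begin

text \<open>
  Let \<open>f\<close> be the indicator of the spiral domain. Since \<open>\<phi>\<close> has mean zero and decays rapidly,
  \<open>\<phi>\<^sub>j * f\<close> is bounded and negligible except within distance about \<open>2 powr (- j)\<close> from the edges
  of the domain; near an isolated edge it looks like \<open>\<phi>\<close> convolved with the indicator of a half
  space, which is not identically zero because \<open>\<phi>\<close> has a non-vanishing Fourier transform on the
  unit sphere. Hence \<open>\<integral>\<^sub>P |\<phi>\<^sub>j * f|\<^sup>p\<close> is comparable, whatever \<open>p\<close> is, to the measure \<open>m(P, \<delta>)\<close>
  of the part of the square \<open>P\<close> within distance \<open>\<delta> = 2 powr (- j)\<close> from the edges. With \<open>l\<close> the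
  side of \<open>P\<close>, membership in the Besov-type space becomes the question whether
  \<open>m(P, \<delta>) \<le> C * l powr (2 * \<tau> * p) * \<delta> powr (s * p)\<close> for all \<open>\<delta> \<le> min 1 l\<close>.

  This measure is read off from the geometry. At distance \<open>r\<close> from the origin consecutive edges
  are about \<open>r powr (1 + 1 / \<alpha>)\<close> apart. So the disc of radius \<open>R = \<delta> powr (\<alpha> / (\<alpha> + 1))\<close> is
  filled up, while in the annulus of radius \<open>r \<ge> R\<close> the edges have length about
  \<open>r powr (1 - 1 / \<alpha>)\<close> and contribute \<open>\<delta>\<close> times that length. A square at the origin of side
  about \<open>R\<close> therefore forces \<open>R\<^sup>2 \<le> C * R powr (2 * \<tau> * p) * \<delta> powr (s * p)\<close>, that is
  \<open>s \<le> 2 * \<alpha> / (\<alpha> + 1) * (1 / p - \<tau>)\<close>; a single edge in the unit square forces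
  \<open>\<delta> \<le> C * \<delta> powr (s * p)\<close>, that is \<open>s \<le> 1 / p\<close>. For \<open>\<alpha> < 1\<close> the second condition follows from
  the first. For \<open>\<alpha> = 1\<close> every dyadic annulus outside \<open>R\<close> contributes the same amount \<open>\<delta>\<close>, and
  the resulting logarithm excludes \<open>s = 1 / p\<close> also for \<open>\<tau> = 0\<close>.

  For sufficiency, the indicator can only jump on the two spiral curves and on a slit that
  absorbs the discontinuity of the angle (\<open>frontier_spiral_subset\<close>). A set of diameter \<open>D\<close> near
  radius \<open>r\<close> meets at most about \<open>1 + D / r powr (1 + 1 / \<alpha>)\<close> turns, each in an arc of length
  about \<open>D\<close>, which bounds the measure of its part of the tube
  (\<open>emeasure_tube_spiral_curve_annulus\<close>). Interpolating this bound with the trivial one turns it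
  into \<open>\<delta> powr s' * r powr (2 - s' * (1 + 1 / \<alpha>))\<close> with \<open>s' = s * p\<close>, and the sum over dyadic
  annuli is geometric (\<open>emeasure_tube_spiral_curve_dyadic_ball\<close>). The tails of \<open>\<phi>\<close> are absorbed
  by summing over tubes of width \<open>2 ^ n * \<delta>\<close> (\<open>integral_dilated_conv_spiral_le\<close>).

  For necessity, at points of the edges near the positive first axis, on turns whose distance to
  the next turn is large compared to \<open>1 / A = 2 powr (- j)\<close>, the domain is a half space at scale
  \<open>1 / A\<close> up to a small error (\<open>spiral_flat_near_edge\<close>), so \<open>|\<phi>\<^sub>j * f|\<close> is bounded below on a
  ball of radius comparable to \<open>1 / A\<close> (\<open>dilated_conv_near_flat_boundary\<close>). Packing such balls
  along the edges bounds the integrals from below by a constant times \<open>1 / A\<close> times the length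
  of the edges (\<open>integral_dilated_conv_spiral_ge\<close>). Evaluating this on all turns from \<open>n\<close> to
  \<open>2 * n\<close>, on one turn, and, for \<open>\<alpha> = 1\<close>, on all turns up to \<open>n\<close> gives the three necessary
  conditions.
\<close>

section \<open>Schwartz functions\<close>

lemma iterated_deriv_Nil [simp]: "iterated_deriv [] f = f"
  by (simp add: iterated_deriv_def)

lemma iterated_deriv_Cons: "iterated_deriv (d # ds) f = partial_deriv d (iterated_deriv ds f)"
  by (simp add: iterated_deriv_def)

lemma has_derivative_affine_comp:
  fixes g :: "real ^ 'n \<Rightarrow> complex"
  assumes "g differentiable (at (b + a *\<^sub>R x))"
  shows "((\<lambda>y. c * g (b + a *\<^sub>R y)) has_derivative
           (\<lambda>h. c * frechet_derivative g (at (b + a *\<^sub>R x)) (a *\<^sub>R h))) (at x)"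
proof -
  have "(g has_derivative frechet_derivative g (at (b + a *\<^sub>R x))) (at (b + a *\<^sub>R x))"
    using assms by (simp add: frechet_derivative_works)
  then have gd: "(g has_derivative frechet_derivative g (at (b + a *\<^sub>R x)))
      (at (b + a *\<^sub>R x) within range (\<lambda>y. b + a *\<^sub>R y))"
    by (rule has_derivative_at_withinI)
  have d: "((\<lambda>y. b + a *\<^sub>R y) has_derivative (\<lambda>h. a *\<^sub>R h)) (at x)"
    by (auto intro!: derivative_eq_intros)
  from has_derivative_in_compose[OF _ gd, of "\<lambda>h. a *\<^sub>R h"]
  have "((\<lambda>y. g (b + a *\<^sub>R y)) has_derivative
           (\<lambda>h. frechet_derivative g (at (b + a *\<^sub>R x)) (a *\<^sub>R h))) (at x)"
    using d by blast
  then show ?thesis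
    by (auto intro!: derivative_eq_intros)
qed

lemma partial_deriv_affine_comp:
  fixes g :: "real ^ 'n \<Rightarrow> complex"
  assumes "\<And>x. g differentiable (at x)"
  shows "partial_deriv i (\<lambda>y. c * g (b + a *\<^sub>R y)) =
         (\<lambda>y. (c * of_real a) * partial_deriv i g (b + a *\<^sub>R y))"
proof
  fix y
  have "frechet_derivative (\<lambda>y. c * g (b + a *\<^sub>R y)) (at y) =
      (\<lambda>h. c * frechet_derivative g (at (b + a *\<^sub>R y)) (a *\<^sub>R h))"
    using frechet_derivative_at[OF has_derivative_affine_comp[OF assms]] by metis
  moreover have "linear (frechet_derivative g (at (b + a *\<^sub>R y)))"
    using assms by (rule linear_frechet_derivative)
  ultimately show "partial_deriv i (\<lambda>y. c * g (b + a *\<^sub>R y)) y =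
         (c * of_real a) * partial_deriv i g (b + a *\<^sub>R y)"
    by (simp add: partial_deriv_def linear_cmul) (simp add: scaleR_conv_of_real)
qed

lemma iterated_deriv_affine_comp:
  fixes g :: "real ^ 'n \<Rightarrow> complex"
  assumes "\<And>ds x. iterated_deriv ds g differentiable (at x)"
  shows "iterated_deriv ds (\<lambda>y. c * g (b + a *\<^sub>R y)) =
         (\<lambda>y. (c * of_real a ^ length ds) * iterated_deriv ds g (b + a *\<^sub>R y))"
proof (induction ds)
  case (Cons d ds)
  show ?case
    unfolding iterated_deriv_Cons Cons.IH partial_deriv_affine_comp[OF assms]
    by (simp add: mult_ac)
qed simp

text \<open>This is what makes the convolution with a tempered distribution an honest integral: the
  reflected, translated and dilated test function is again a test function.\<close>

lemma schwartz_affine_comp: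
  fixes g :: "real ^ 'n \<Rightarrow> complex"
  assumes g: "g \<in> schwartz_space" and a: "a \<noteq> 0"
  shows "(\<lambda>y. c * g (b + a *\<^sub>R y)) \<in> schwartz_space"
proof -
  have diff: "\<And>ds x. iterated_deriv ds g differentiable (at x)"
    using g by (auto simp: schwartz_space_def)
  note eq = iterated_deriv_affine_comp[OF diff]
  have "iterated_deriv ds (\<lambda>y. c * g (b + a *\<^sub>R y)) differentiable (at x)" for ds x
    unfolding eq differentiable_def using has_derivative_affine_comp[OF diff] by blast
  moreover have "bounded (range (\<lambda>x. (1 + norm x) ^ N *\<^sub>R iterated_deriv ds (\<lambda>y. c * g (b + a *\<^sub>R y)) x))"
    for N ds
  proof -
    have "bounded (range (\<lambda>x. (1 + norm x) ^ N *\<^sub>R iterated_deriv ds g x))"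
      using g by (auto simp: schwartz_space_def)
    then obtain M where M: "\<And>x. norm ((1 + norm x) ^ N *\<^sub>R iterated_deriv ds g x) \<le> M"
      by (auto simp: bounded_iff)
    \<comment> \<open>An affine change of variables distorts the weight \<open>1 + norm x\<close> at most by this
      factor.\<close>
    define K where "K = (1 + norm b / \<bar>a\<bar> + 1 / \<bar>a\<bar>)"
    have K: "K \<ge> 0" by (simp add: K_def add_nonneg_nonneg)
    have grow: "1 + norm x \<le> K * (1 + norm (b + a *\<^sub>R x))" for x
    proof -
      have "\<bar>a\<bar> * norm x = norm ((b + a *\<^sub>R x) - b)" by simp
      also have "\<dots> \<le> norm (b + a *\<^sub>R x) + norm b" by (rule norm_triangle_ineq4)
      finally have "norm x \<le> (norm (b + a *\<^sub>R x) + norm b) / \<bar>a\<bar>"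
        using a by (simp add: field_simps)
      moreover have "0 \<le> norm b * norm (b + a *\<^sub>R x) / \<bar>a\<bar>" "0 \<le> 1 / \<bar>a\<bar>"
        by auto
      moreover have "K * (1 + norm (b + a *\<^sub>R x)) = 1 + norm (b + a *\<^sub>R x) + norm b / \<bar>a\<bar>
          + norm b * norm (b + a *\<^sub>R x) / \<bar>a\<bar> + 1 / \<bar>a\<bar> + norm (b + a *\<^sub>R x) / \<bar>a\<bar>"
        by (simp add: K_def algebra_simps)
      ultimately show ?thesis using norm_ge_zero[of "b + a *\<^sub>R x"]
        unfolding add_divide_distrib by linarith
    qed
    have "norm ((1 + norm x) ^ N *\<^sub>R iterated_deriv ds (\<lambda>y. c * g (b + a *\<^sub>R y)) x)
            \<le> norm (c * of_real a ^ length ds) * (K ^ N * M)" for x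
    proof -
      have "(1 + norm x) ^ N * norm (iterated_deriv ds g (b + a *\<^sub>R x))
          \<le> (K * (1 + norm (b + a *\<^sub>R x))) ^ N * norm (iterated_deriv ds g (b + a *\<^sub>R x))"
        using grow[of x] by (intro mult_right_mono power_mono) auto
      also have "\<dots> = K ^ N * ((1 + norm (b + a *\<^sub>R x)) ^ N * norm (iterated_deriv ds g (b + a *\<^sub>R x)))"
        by (simp add: power_mult_distrib)
      also have "\<dots> \<le> K ^ N * M"
        using M[of "b + a *\<^sub>R x"] K by (intro mult_left_mono) auto
      finally have "norm (c * of_real a ^ length ds) *
          ((1 + norm x) ^ N * norm (iterated_deriv ds g (b + a *\<^sub>R x))) \<le>
          norm (c * of_real a ^ length ds) * (K ^ N * M)"
        by (rule mult_left_mono) simp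
      then show ?thesis
        unfolding eq by (simp add: norm_mult mult.left_commute)
    qed
    then show ?thesis by (auto simp: bounded_iff)
  qed
  ultimately show ?thesis by (auto simp: schwartz_space_def)
qed

lemma schwartz_decay:
  fixes g :: "real ^ 'n \<Rightarrow> complex"
  assumes "g \<in> schwartz_space"
  obtains C where "C > 0" "\<And>x. norm (g x) \<le> C / (1 + norm x) ^ N"
proof -
  have "bounded (range (\<lambda>x. (1 + norm x) ^ N *\<^sub>R iterated_deriv [] g x))"
    using assms unfolding schwartz_space_def by blast
  then obtain M where M: "\<And>x. norm ((1 + norm x) ^ N *\<^sub>R g x) \<le> M"
    by (auto simp: bounded_iff)
  have "norm (g x) \<le> max M 1 / (1 + norm x) ^ N" for x
  proof -
    have "(1 + norm x) ^ N * norm (g x) \<le> M" using M[of x] by simp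
    moreover have "0 < (1 + norm x) ^ N" by (simp add: add_pos_nonneg)
    ultimately show ?thesis by (simp add: pos_le_divide_eq mult.commute)
  qed
  then show ?thesis using that[of "max M 1"] by simp
qed

lemma schwartz_continuous:
  fixes g :: "real ^ 'n \<Rightarrow> complex"
  assumes "g \<in> schwartz_space"
  shows "continuous_on UNIV g"
proof -
  have "iterated_deriv [] g differentiable (at x)" for x
    using assms unfolding schwartz_space_def by blast
  then show ?thesis
    by (simp add: continuous_at_imp_continuous_on differentiable_imp_continuous_within)
qed

lemma emeasure_ball_le:
  fixes a :: "real ^ 'n"
  assumes "r \<ge> 0"
  shows "emeasure lebesgue (ball a r) \<le> ennreal ((2 * r) ^ CARD('n))"
proof -
  have "ball a r \<subseteq> cbox (\<chi> i. a $ i - r) (\<chi> i. a $ i + r)"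
  proof
    fix x assume "x \<in> ball a r"
    then have "norm (a - x) < r" by (simp add: dist_norm)
    then have "\<bar>(a - x) $ i\<bar> < r" for i
      using component_le_norm_cart[of "a - x" i] by linarith
    then have "\<bar>a $ i - x $ i\<bar> < r" for i by simp
    then show "x \<in> cbox (\<chi> i. a $ i - r) (\<chi> i. a $ i + r)"
      by (simp add: mem_box_cart abs_less_iff) (smt (verit))
  qed
  then have "emeasure lebesgue (ball a r) \<le> emeasure lebesgue (cbox (\<chi> i. a $ i - r) (\<chi> i. a $ i + r))"
    by (rule emeasure_mono) simp
  also have "\<dots> = ennreal (measure lborel (cbox (\<chi> i. a $ i - r) (\<chi> i. a $ i + r)))"
    using emeasure_eq_ennreal_measure[OF less_imp_neq[OF emeasure_lborel_cbox_finite[unfolded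
        infinity_ennreal_def]]]
    by (simp del: emeasure_lborel_cbox measure_lborel_cbox_eq content_cbox_cart)
  also have "measure lborel (cbox (\<chi> i. a $ i - r) (\<chi> i. a $ i + r)) = (2 * r) ^ CARD('n)"
    using assms by (subst content_cbox_cart) (auto simp: interval_ne_empty_cart)
  finally show ?thesis .
qed

text \<open>The dyadic layers \<open>{norm x < 2^k}\<close> reduce integrals of decaying functions to geometric
  series; the same device serves later to integrate over neighbourhoods of the boundary.\<close>

lemma inverse_power_le_layers:
  fixes t :: real
  assumes "t \<ge> 0"
  shows "ennreal (1 / (1 + t) ^ N) \<le> (\<Sum>k. ennreal ((2 / 2 ^ k) ^ N) * indicator {..<2 ^ k} t)"
proof -
  define k where "k = (LEAST k. t < 2 ^ k)"
  have ex: "\<exists>k. t < (2::real) ^ k" using real_arch_pow[of 2 t] by auto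
  have k: "t < 2 ^ k" unfolding k_def using ex by (rule LeastI_ex)
  have "1 / (1 + t) ^ N \<le> (2 / 2 ^ k) ^ N"
  proof -
    have "2 ^ k \<le> 2 * (1 + t)"
    proof (cases k)
      case (Suc m)
      have "\<not> t < 2 ^ m" using not_less_Least[of m "\<lambda>k. t < 2 ^ k"] Suc k_def by auto
      then show ?thesis using Suc by simp
    qed (use assms in auto)
    then have "1 / (1 + t) \<le> 2 / 2 ^ k" using assms by (simp add: field_simps)
    then have "(1 / (1 + t)) ^ N \<le> (2 / 2 ^ k) ^ N" using assms by (intro power_mono) auto
    then show ?thesis by (simp add: power_one_over)
  qed
  then have "ennreal (1 / (1 + t) ^ N) \<le> ennreal ((2 / 2 ^ k) ^ N) * indicator {..<2 ^ k} t"
    using k by (simp add: ennreal_leI)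
  also have "\<dots> \<le> (\<Sum>k. ennreal ((2 / 2 ^ k) ^ N) * indicator {..<2 ^ k} t)"
    using sum_le_suminf[of "\<lambda>k. ennreal ((2 / 2 ^ k) ^ N) * indicator {..<2 ^ k} t" "{k}"]
    by (simp del: sum_mult_indicator)
  finally show ?thesis .
qed

lemma integrable_inverse_power_norm:
  "integrable lebesgue (\<lambda>x::real ^ 'n. 1 / (1 + norm x) ^ (CARD('n) + 1))"
proof -
  let ?n = "CARD('n)"
  have "(\<integral>\<^sup>+x. ennreal (1 / (1 + norm (x::real^'n)) ^ (?n + 1)) \<partial>lebesgue) \<le>
      (\<integral>\<^sup>+x. (\<Sum>k. ennreal ((2 / 2 ^ k) ^ (?n + 1)) * indicator (ball 0 (2 ^ k)) (x::real^'n)) \<partial>lebesgue)"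
  proof (rule nn_integral_mono)
    fix x :: "real ^ 'n"
    have "indicator {..<2 ^ k} (norm x) = (indicator (ball 0 (2 ^ k)) x :: ennreal)" for k
      by (auto simp: indicator_def)
    then show "ennreal (1 / (1 + norm x) ^ (?n + 1)) \<le>
        (\<Sum>k. ennreal ((2 / 2 ^ k) ^ (?n + 1)) * indicator (ball 0 (2 ^ k)) x)"
      using inverse_power_le_layers[of "norm x" "?n + 1"] by simp
  qed
  also have "\<dots> = (\<Sum>k. \<integral>\<^sup>+x. ennreal ((2 / 2 ^ k) ^ (?n + 1)) * indicator (ball 0 (2 ^ k))
      (x::real^'n) \<partial>lebesgue)"
    by (rule nn_integral_suminf)
      (intro borel_measurable_times_ennreal borel_measurable_const borel_measurable_indicator
          fmeasurableD lmeasurable_ball)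
  also have "\<dots> = (\<Sum>k. ennreal ((2 / 2 ^ k) ^ (?n + 1)) * emeasure lebesgue (ball (0::real^'n) (2 ^ k)))"
    by (simp add: nn_integral_cmult_indicator)
  also have "\<dots> \<le> (\<Sum>k. ennreal (2 ^ (2 * ?n + 1) * (1 / 2) ^ k))"
  proof (rule suminf_le)
    fix k
    have "ennreal ((2 / 2 ^ k) ^ (?n + 1)) * emeasure lebesgue (ball (0::real^'n) (2 ^ k)) \<le>
       ennreal ((2 / 2 ^ k) ^ (?n + 1)) * ennreal ((2 * 2 ^ k) ^ ?n)"
      by (intro mult_left_mono emeasure_ball_le) auto
    also have "\<dots> = ennreal ((2 / 2 ^ k) ^ (?n + 1) * (2 * 2 ^ k) ^ ?n)"
      by (rule ennreal_mult[symmetric]) auto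
    also have "(2 / 2 ^ k) ^ (?n + 1) * (2 * 2 ^ k) ^ ?n = (2::real) ^ (2 * ?n + 1) * (1 / 2) ^ k"
    proof -
      have "(2 / 2 ^ k) ^ (?n + 1) * (2 * 2 ^ k) ^ ?n = ((2 / 2 ^ k) * (2 * 2 ^ k)) ^ ?n * (2 /
          (2::real) ^ k)"
        by (simp only: power_mult_distrib power_add power_one_right mult_ac)
      also have "(2 / 2 ^ k) * (2 * (2::real) ^ k) = 2 ^ 2"
        by simp
      also have "((2::real) ^ 2) ^ ?n * (2 / 2 ^ k) = 2 ^ (2 * ?n + 1) * (1 / 2) ^ k"
        by (simp only: power_mult[symmetric] power_add power_one_right power_one_over)
      finally show ?thesis .
    qed
    finally show "ennreal ((2 / 2 ^ k) ^ (?n + 1)) * emeasure lebesgue (ball (0::real^'n) (2 ^ k))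
        \<le> ennreal (2 ^ (2 * ?n + 1) * (1 / 2) ^ k)" .
  qed auto
  also have "\<dots> < \<infinity>"
    by (subst suminf_ennreal2) (auto intro!: summable_mult summable_geometric)
  finally have fin: "(\<integral>\<^sup>+x. ennreal (1 / (1 + norm (x::real^'n)) ^ (?n + 1)) \<partial>lebesgue) < \<infinity>" .
  have "(\<lambda>x::real^'n. 1 / (1 + norm x) ^ (?n + 1)) \<in> borel_measurable borel"
    by measurable
  then have meas: "(\<lambda>x::real^'n. 1 / (1 + norm x) ^ (?n + 1)) \<in> borel_measurable lebesgue"
    by (simp add: measurable_completion)
  show ?thesis
    unfolding integrable_iff_bounded using fin meas by simp
qed

lemma schwartz_integrable:
  fixes g :: "real ^ 'n \<Rightarrow> complex"
  assumes "g \<in> schwartz_space"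
  shows "integrable lebesgue g"
proof -
  obtain C where C: "C > 0" "\<And>x. norm (g x) \<le> C / (1 + norm x) ^ (CARD('n) + 1)"
    using schwartz_decay[OF assms, of "CARD('n) + 1"] by auto
  have "g \<in> borel_measurable borel"
    using schwartz_continuous[OF assms] by (rule borel_measurable_continuous_onI)
  then have meas: "g \<in> borel_measurable lebesgue" by (simp add: measurable_completion)
  show ?thesis
  proof (rule Bochner_Integration.integrable_bound[OF _ meas])
    show "integrable lebesgue (\<lambda>x::real^'n. C * (1 / (1 + norm x) ^ (CARD('n) + 1)))"
      by (intro integrable_mult_right integrable_inverse_power_norm)
    show "AE x in lebesgue. norm (g x) \<le> norm (C * (1 / (1 + norm x) ^ (CARD('n) + 1)))"
      using C by (simp add: abs_of_nonneg)
  qed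
qed

text \<open>Of the decay of order \<open>N + CARD('n) + 1\<close> the last \<open>CARD('n) + 1\<close> powers keep the integral
  finite; the first \<open>N\<close> are at most \<open>1 / (1 + R) ^ N\<close> outside the ball.\<close>

lemma schwartz_tail:
  fixes g :: "real ^ 'n \<Rightarrow> complex"
  assumes "g \<in> schwartz_space"
  obtains C where "C > 0"
    "\<And>R. R \<ge> 0 \<Longrightarrow> (LINT x|lebesgue. indicator (- ball 0 R) x * norm (g x)) \<le> C / (1 + R) ^ N"
proof -
  let ?n = "CARD('n)"
  obtain C where C: "C > 0" "\<And>x. norm (g x) \<le> C / (1 + norm x) ^ (N + (?n + 1))"
    using schwartz_decay[OF assms] by blast
  define I where "I = (LINT x::real^'n|lebesgue. 1 / (1 + norm x) ^ (?n + 1))"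
  have I: "I \<ge> 0" unfolding I_def by (rule integral_nonneg_AE) auto
  have "(LINT x|lebesgue. indicator (- ball 0 R) x * norm (g x)) \<le> (C * I + 1) / (1 + R) ^ N"
    if R: "R \<ge> 0" for R :: real
  proof -
    have "(LINT x|lebesgue. indicator (- ball 0 R) x * norm (g x)) \<le>
        (LINT x::real^'n|lebesgue. C / (1 + R) ^ N * (1 / (1 + norm x) ^ (?n + 1)))"
    proof (rule integral_mono)
      have sets: "- ball (0::real^'n) R \<in> sets lebesgue" by (simp add: Compl_in_sets_lebesgue)
      show "integrable lebesgue (\<lambda>x. indicator (- ball 0 R) x * norm (g x))"
        using integrable_mult_indicator[OF sets integrable_norm[OF schwartz_integrable[OF assms]]]
        by simp
      show "integrable lebesgue (\<lambda>x::real^'n. C / (1 + R) ^ N * (1 / (1 + norm x) ^ (?n + 1)))"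
        by (intro integrable_mult_right integrable_inverse_power_norm)
      fix x :: "real ^ 'n"
      show "indicator (- ball 0 R) x * norm (g x) \<le> C / (1 + R) ^ N * (1 / (1 + norm x) ^ (?n + 1))"
      proof (cases "x \<in> ball 0 R")
        case False
        have "norm (g x) \<le> C / ((1 + norm x) ^ N * (1 + norm x) ^ (?n + 1))"
          using C(2)[of x] by (simp only: power_add mult.assoc)
        also have "\<dots> \<le> C / ((1 + R) ^ N * (1 + norm x) ^ (?n + 1))"
          using False R C(1)
          by (intro divide_left_mono mult_right_mono power_mono mult_pos_pos zero_less_power)
            (auto simp: add_pos_nonneg)
        finally show ?thesis using False by simp
      qed (use C R in auto)
    qed
    also have "\<dots> = C * I / (1 + R) ^ N"
      by (subst integral_mult_right_zero) (simp add: I_def)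
    also have "\<dots> \<le> (C * I + 1) / (1 + R) ^ N"
      using R by (intro divide_right_mono) auto
    finally show ?thesis .
  qed
  then show ?thesis using that[of "C * I + 1"] C(1) I by (simp add: add_nonneg_pos)
qed

section \<open>Convolution with the indicator of a set\<close>

lemma lebesgue_integral_affine:
  fixes f :: "real ^ 'n \<Rightarrow> complex"
  assumes c: "c \<noteq> 0" and f: "f \<in> borel_measurable lebesgue"
  shows "(LINT y|lebesgue. f y) = of_real (\<bar>c\<bar> ^ CARD('n)) * (LINT z|lebesgue. f (t + c *\<^sub>R z))"
proof -
  let ?T = "\<lambda>x::real^'n. t + (\<Sum>j\<in>Basis. (c * (x \<bullet> j)) *\<^sub>R j)"
  have T: "?T = (\<lambda>x. t + c *\<^sub>R x)"
    by (simp add: scaleR_scaleR[symmetric] scaleR_sum_right[symmetric] euclidean_representation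
        del: scaleR_scaleR)
  have meas: "?T \<in> lebesgue \<rightarrow>\<^sub>M lebesgue"
    using c by (intro lebesgue_affine_measurable) auto
  have "lebesgue = density (distr lebesgue lebesgue ?T) (\<lambda>x. ennreal (\<Prod>j\<in>(Basis :: (real^'n) set). \<bar>c\<bar>))"
    using c by (intro lebesgue_affine_euclidean) auto
  then have "(LINT y|lebesgue. f y) =
      (LINT y|density (distr lebesgue lebesgue ?T) (\<lambda>x. ennreal (\<Prod>j\<in>(Basis :: (real^'n) set). \<bar>c\<bar>)). f y)"
    by simp
  also have "\<dots> = (LINT y|distr lebesgue lebesgue ?T. (\<Prod>j\<in>(Basis :: (real^'n) set). \<bar>c\<bar>) *\<^sub>R f y)"
    by (rule integral_density) (use f in auto)
  also have "\<dots> = (LINT z|lebesgue. (\<Prod>j\<in>(Basis :: (real^'n) set). \<bar>c\<bar>) *\<^sub>R f (?T z))"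
    by (rule integral_distr[OF meas]) (use f in auto)
  finally have "(LINT y|lebesgue. f y) = (LINT z|lebesgue. \<bar>c\<bar> ^ CARD('n) *\<^sub>R f (t + c *\<^sub>R z))"
    by (simp add: fun_cong[OF T, simplified])
  also have "\<dots> = \<bar>c\<bar> ^ CARD('n) *\<^sub>R (LINT z|lebesgue. f (t + c *\<^sub>R z))"
    by (rule integral_scaleR_right)
  also have "\<dots> = of_real (\<bar>c\<bar> ^ CARD('n)) * (LINT z|lebesgue. f (t + c *\<^sub>R z))"
    by (rule scaleR_conv_of_real)
  finally show ?thesis .
qed

text \<open>The convolution of the indicator with the kernel \<open>A ^ CARD('n) * \<phi> (A * x)\<close>, after the
  substitution that moves the dilation from the kernel to the set.\<close>

definition dilated_conv :: "(real ^ 'n) set \<Rightarrow> (real ^ 'n \<Rightarrow> complex) \<Rightarrow> real \<Rightarrow> real ^ 'n \<Rightarrow> complex" where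
  "dilated_conv E \<phi> A x = (LINT z|lebesgue. indicator E (x - (1 / A) *\<^sub>R z) * \<phi> z)"

lemma measurable_indicator_affine:
  fixes E :: "(real ^ 'n) set"
  assumes E: "E \<in> sets lebesgue" and c: "c \<noteq> 0"
  shows "(\<lambda>z. indicator E (t + c *\<^sub>R z) :: 'b::real_normed_algebra_1) \<in> borel_measurable lebesgue"
proof -
  have T: "(\<lambda>x::real^'n. t + (\<Sum>j\<in>Basis. (c * (x \<bullet> j)) *\<^sub>R j)) = (\<lambda>x. t + c *\<^sub>R x)"
    by (simp add: scaleR_scaleR[symmetric] scaleR_sum_right[symmetric] euclidean_representation
        del: scaleR_scaleR)
  have meas: "(\<lambda>x::real^'n. t + c *\<^sub>R x) \<in> lebesgue \<rightarrow>\<^sub>M lebesgue"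
    using lebesgue_affine_measurable[of "\<lambda>_. c" t] c unfolding T by simp
  have "(indicator E :: real^'n \<Rightarrow> 'b) \<in> borel_measurable lebesgue"
    using E by (rule borel_measurable_indicator)
  from measurable_compose[OF meas this] show ?thesis .
qed

lemma dilated_conv_integrable:
  fixes E :: "(real ^ 'n) set"
  assumes E: "E \<in> sets lebesgue" and A: "A > 0" and \<phi>: "integrable lebesgue \<phi>"
  shows "integrable lebesgue (\<lambda>z. indicator E (x - (1 / A) *\<^sub>R z) * (\<phi> z :: complex))"
proof (rule Bochner_Integration.integrable_bound[OF \<phi>])
  have "(\<lambda>z. indicator E (x + (- (1 / A)) *\<^sub>R z) :: complex) \<in> borel_measurable lebesgue"
    using A by (intro measurable_indicator_affine E) auto
  then show "(\<lambda>z. indicator E (x - (1 / A) *\<^sub>R z) * (\<phi> z :: complex)) \<in> borel_measurable lebesgue"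
    using borel_measurable_integrable[OF \<phi>] by (intro borel_measurable_times) auto
  show "AE z in lebesgue. norm (indicator E (x - (1 / A) *\<^sub>R z) * \<phi> z) \<le> norm (\<phi> z)"
    by (simp add: indicator_def)
qed

lemma distr_convolution_lp_family:
  fixes \<phi> :: "real ^ 'n \<Rightarrow> complex"
  assumes E: "E \<in> sets lebesgue" and \<phi>: "\<phi> \<in> schwartz_space" and \<phi>0: "\<phi>0 \<in> schwartz_space"
  shows "distr_convolution (lp_family \<phi>0 \<phi> j) (regular_distribution (indicator E)) x =
     (if j = 0 then dilated_conv E \<phi>0 1 x else dilated_conv E \<phi> (2 ^ j) x)"
proof -
  have *: "distr_convolution (\<lambda>x. of_real (A ^ CARD('n)) * \<psi> (A *\<^sub>R x)) (regular_distribution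
      (indicator E)) x =
      dilated_conv E \<psi> A x" if A: "A > 0" and \<psi>: "\<psi> \<in> schwartz_space" for A :: real
          and \<psi> :: "real ^ 'n \<Rightarrow> complex"
  proof -
    let ?g = "\<lambda>y. of_real (A ^ CARD('n)) * \<psi> (A *\<^sub>R (x - y))"
    have eq: "?g = (\<lambda>y. of_real (A ^ CARD('n)) * \<psi> (A *\<^sub>R x + (- A) *\<^sub>R y))"
      by (simp add: algebra_simps)
    have g: "?g \<in> schwartz_space"
      unfolding eq using A \<psi> by (intro schwartz_affine_comp) auto
    have meas: "(\<lambda>y. indicator E y * ?g y) \<in> borel_measurable lebesgue"
      by (rule borel_measurable_times[OF borel_measurable_indicator[OF E]
          borel_measurable_integrable[OF schwartz_integrable[OF g]]])
    have "distr_convolution (\<lambda>x. of_real (A ^ CARD('n)) * \<psi> (A *\<^sub>R x)) (regular_distribution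
        (indicator E)) x =
        (LINT y|lebesgue. indicator E y * ?g y)"
      using g by (simp add: distr_convolution_def regular_distribution_def)
    also have "\<dots> = of_real (\<bar>- (1 / A)\<bar> ^ CARD('n)) *
        (LINT z|lebesgue. indicator E (x + (- (1 / A)) *\<^sub>R z) * ?g (x + (- (1 / A)) *\<^sub>R z))"
      using A by (intro lebesgue_integral_affine meas) auto
    also have "\<dots> = of_real ((1 / A) ^ CARD('n)) *
        (LINT z|lebesgue. of_real (A ^ CARD('n)) * (indicator E (x - (1 / A) *\<^sub>R z) * \<psi> z))"
      using A by (simp add: algebra_simps)
    also have "\<dots> = dilated_conv E \<psi> A x"
      using A unfolding dilated_conv_def
      by (subst integral_mult_right_zero) (simp add: mult.assoc[symmetric] power_one_over field_simps)
    finally show ?thesis .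
  qed
  show ?thesis
  proof (cases "j = 0")
    case True
    then show ?thesis using *[of 1 \<phi>0] \<phi>0 by (simp add: lp_family_def)
  next
    case False
    then show ?thesis using *[of "2 ^ j" \<phi>] \<phi> by (simp add: lp_family_def power_mult)
  qed
qed

lemma dilated_conv_away_from_set:
  fixes \<phi> :: "real ^ 'n \<Rightarrow> complex"
  assumes \<phi>: "\<phi> \<in> schwartz_space" and E: "E \<in> sets lebesgue" 
  obtains C where "C > 0" "\<And>x d. 0 \<le> d \<Longrightarrow> ball x d \<inter> E = {} \<Longrightarrow> norm (dilated_conv E \<phi> 1 x) \<le> C / (1 + d) ^ N"
proof -
  obtain C where C: "C > 0"
    "\<And>R. R \<ge> 0 \<Longrightarrow> (LINT x|lebesgue. indicator (- ball 0 R) x * norm (\<phi> x)) \<le> C / (1 + R) ^ N"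
    using schwartz_tail[OF \<phi>, of N] by blast
  have "norm (dilated_conv E \<phi> 1 x) \<le> C / (1 + d) ^ N" if d: "0 \<le> d" and disj: "ball x d \<inter> E = {}" for x d
  proof -
    have "norm (dilated_conv E \<phi> 1 x) \<le> (LINT z|lebesgue. norm (indicator E (x - (1 / 1) *\<^sub>R z) * \<phi> z))"
      unfolding dilated_conv_def by (rule integral_norm_bound)
    also have "\<dots> \<le> (LINT z|lebesgue. indicator (- ball 0 d) z * norm (\<phi> z))"
    proof (rule integral_mono)
      show "integrable lebesgue (\<lambda>z. norm (indicator E (x - (1 / 1) *\<^sub>R z) * \<phi> z))"
        by (intro integrable_norm dilated_conv_integrable E schwartz_integrable \<phi>) auto
      show "integrable lebesgue (\<lambda>z. indicator (- ball 0 d) z * norm (\<phi> z))"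
        using integrable_mult_indicator[OF _ integrable_norm[OF schwartz_integrable[OF \<phi>]], of "- ball 0 d"]
        by (simp add: Compl_in_sets_lebesgue)
      show "norm (indicator E (x - (1 / 1) *\<^sub>R z) * \<phi> z) \<le> indicator (- ball 0 d) z * norm (\<phi> z)" for z
      proof (cases "z \<in> ball 0 d")
        case True
        then have "x - z \<in> ball x d" by (simp add: dist_norm)
        then have "x - z \<notin> E" using disj by blast
        then show ?thesis by simp
      qed (simp add: indicator_def)
    qed
    also have "\<dots> \<le> C / (1 + d) ^ N" using C(2)[OF d] .
    finally show ?thesis .
  qed
  then show ?thesis using that C(1) by blast
qed

text \<open>A kernel of mean zero does not see the constant value of the indicator on the ball of radius
  \<open>d\<close>, so only the tail of \<open>\<phi>\<close> outside the dilated ball of radius \<open>A * d\<close> contributes.\<close>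

lemma dilated_conv_away_from_frontier:
  fixes \<phi> :: "real ^ 'n \<Rightarrow> complex"
  assumes \<phi>: "\<phi> \<in> schwartz_space" and mean: "(LINT z|lebesgue. \<phi> z) = 0" and E: "E \<in> sets lebesgue"
  obtains C where "C > 0"
    "\<And>A x d. 0 < A \<Longrightarrow> 0 \<le> d \<Longrightarrow> ball x d \<inter> frontier E = {} \<Longrightarrow>
       norm (dilated_conv E \<phi> A x) \<le> C / (1 + A * d) ^ N"
proof -
  obtain C where C: "C > 0"
    "\<And>R. R \<ge> 0 \<Longrightarrow> (LINT x|lebesgue. indicator (- ball 0 R) x * norm (\<phi> x)) \<le> C / (1 + R) ^ N"
    using schwartz_tail[OF \<phi>, of N] by blast
  note int = schwartz_integrable[OF \<phi>]
  have "norm (dilated_conv E \<phi> A x) \<le> C / (1 + A * d) ^ N"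
    if A: "0 < A" and d: "0 \<le> d" and disj: "ball x d \<inter> frontier E = {}" for A x d
  proof -
    have "ball x d \<inter> E = {} \<or> ball x d - E = {}"
      using connected_Int_frontier[of "ball x d" E] disj convex_connected[OF convex_ball] by blast
    then obtain c :: complex where c: "\<And>y. y \<in> ball x d \<Longrightarrow> indicator E y = c" and c01: "c = 0 \<or> c = 1"
    proof
      assume "ball x d \<inter> E = {}"
      then have "indicator E y = (0::complex)" if "y \<in> ball x d" for y
        using that by (auto simp: indicator_def simp del: mem_ball)
      then show ?thesis using that by blast
    next
      assume "ball x d - E = {}"
      then have "indicator E y = (1::complex)" if "y \<in> ball x d" for y
        using that by (auto simp: indicator_def simp del: mem_ball)
      then show ?thesis using that by blast
    qed
    have "dilated_conv E \<phi> A x = (LINT z|lebesgue. indicator E (x - (1 / A) *\<^sub>R z) * \<phi> z) - (LINT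
        z|lebesgue. c * \<phi> z)"
      using mean by (simp add: dilated_conv_def)
    also have "\<dots> = (LINT z|lebesgue. indicator E (x - (1 / A) *\<^sub>R z) * \<phi> z - c * \<phi> z)"
      by (intro Bochner_Integration.integral_diff[symmetric] dilated_conv_integrable E int A
          integrable_mult_right)
    finally have "norm (dilated_conv E \<phi> A x) \<le>
        (LINT z|lebesgue. norm (indicator E (x - (1 / A) *\<^sub>R z) * \<phi> z - c * \<phi> z))"
      using integral_norm_bound[of lebesgue "\<lambda>z. indicator E (x - (1 / A) *\<^sub>R z) * \<phi> z - c * \<phi> z"]
      by simp
    also have "\<dots> \<le> (LINT z|lebesgue. indicator (- ball 0 (A * d)) z * norm (\<phi> z))"
    proof (rule integral_mono)
      show "integrable lebesgue (\<lambda>z. norm (indicator E (x - (1 / A) *\<^sub>R z) * \<phi> z - c * \<phi> z))"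
        by (intro integrable_norm Bochner_Integration.integrable_diff dilated_conv_integrable E int
            A integrable_mult_right)
      show "integrable lebesgue (\<lambda>z. indicator (- ball 0 (A * d)) z * norm (\<phi> z))"
        using integrable_mult_indicator[OF _ integrable_norm[OF int], of "- ball 0 (A * d)"]
        by (simp add: Compl_in_sets_lebesgue)
      fix z :: "real ^ 'n"
      show "norm (indicator E (x - (1 / A) *\<^sub>R z) * \<phi> z - c * \<phi> z)
          \<le> indicator (- ball 0 (A * d)) z * norm (\<phi> z)"
      proof (cases "z \<in> ball 0 (A * d)")
        case True
        then have "x - (1 / A) *\<^sub>R z \<in> ball x d"
          using A by (simp add: dist_norm field_simps)
        from c[OF this] show ?thesis using True by simp
      next
        case False
        have "norm (indicator E (x - (1 / A) *\<^sub>R z) - c) \<le> 1"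
          using c01 by (cases "x - (1 / A) *\<^sub>R z \<in> E") auto
        then have "norm (indicator E (x - (1 / A) *\<^sub>R z) - c) * norm (\<phi> z) \<le> 1 * norm (\<phi> z)"
          by (intro mult_right_mono) auto
        moreover have "norm (indicator E (x - (1 / A) *\<^sub>R z) * \<phi> z - c * \<phi> z) =
            norm (indicator E (x - (1 / A) *\<^sub>R z) - c) * norm (\<phi> z)"
          unfolding left_diff_distrib[symmetric] by (rule norm_mult)
        ultimately show ?thesis using False by simp
      qed
    qed
    also have "\<dots> \<le> C / (1 + A * d) ^ N" using C(2)[of "A * d"] A d by simp
    finally show ?thesis .
  qed
  then show ?thesis using that C(1) by blast
qed

lemma emeasure_slab_ball_le:
  fixes i :: "'n::finite"
  assumes "r \<ge> 0" "R \<ge> 0"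
  shows "emeasure lebesgue ({x::real^'n. \<bar>x $ i - v\<bar> \<le> r} \<inter> ball 0 R)
      \<le> ennreal (2 * r * (2 * R) ^ (CARD('n) - 1))"
proof -
  let ?a = "\<chi> j. if j = i then v - r else - R" and ?b = "\<chi> j. if j = i then v + r else R"
  have "{x::real^'n. \<bar>x $ i - v\<bar> \<le> r} \<inter> ball 0 R \<subseteq> cbox ?a ?b"
  proof
    fix x assume x: "x \<in> {x::real^'n. \<bar>x $ i - v\<bar> \<le> r} \<inter> ball 0 R"
    then have "\<bar>x $ j\<bar> \<le> R" for j
      using component_le_norm_cart[of x j] by simp
    then show "x \<in> cbox ?a ?b"
      using x by (auto simp: mem_box_cart abs_le_iff) (smt (verit))+
  qed
  then have "emeasure lebesgue ({x::real^'n. \<bar>x $ i - v\<bar> \<le> r} \<inter> ball 0 R) \<le> emeasure lebesgue (cbox ?a ?b)"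
    by (rule emeasure_mono) simp
  also have "\<dots> = ennreal (measure lborel (cbox ?a ?b))"
    using emeasure_eq_ennreal_measure[OF less_imp_neq[OF emeasure_lborel_cbox_finite[unfolded
        infinity_ennreal_def]]]
    by (simp del: emeasure_lborel_cbox measure_lborel_cbox_eq content_cbox_cart)
  also have "measure lborel (cbox ?a ?b) = (\<Prod>j\<in>UNIV. if j = i then 2 * r else 2 * R)"
    using assms by (subst content_cbox_cart) (auto simp: interval_ne_empty_cart intro!: prod.cong)
  also have "\<dots> = 2 * r * (2 * R) ^ (CARD('n) - 1)"
    by (subst prod.remove[of _ i]) (auto simp: card_Diff_singleton)
  finally show ?thesis .
qed

lemma sets_lebesgue_component:
  "{x::real^'n. \<bar>x $ i - v\<bar> \<le> r} \<in> sets lebesgue" "{x::real^'n. v < x $ i} \<in> sets lebesgue"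
proof -
  have "closed {x::real^'n. \<bar>x $ i - v\<bar> \<le> r}"
    by (intro closed_Collect_le continuous_intros)
  then show "{x::real^'n. \<bar>x $ i - v\<bar> \<le> r} \<in> sets lebesgue" by (simp add: borel_closed)
  have "open {x::real^'n. v < x $ i}"
    by (intro open_Collect_less continuous_intros)
  then show "{x::real^'n. v < x $ i} \<in> sets lebesgue" by (simp add: borel_open)
qed

text \<open>Thin slabs carry little mass, uniformly in their position: the tail outside a large ball is
  small, and inside it the measure of the slab is.\<close>

lemma schwartz_slab_small:
  fixes \<phi> :: "real ^ 'n \<Rightarrow> complex"
  assumes \<phi>: "\<phi> \<in> schwartz_space" and e: "e > 0"
  obtains r where "r > 0"
    "\<And>v. (LINT x|lebesgue. indicator {x. \<bar>x $ i - v\<bar> \<le> r} x * norm (\<phi> x)) \<le> e"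
proof -
  obtain C where C: "C > 0"
    "\<And>R. R \<ge> 0 \<Longrightarrow> (LINT x|lebesgue. indicator (- ball 0 R) x * norm (\<phi> x)) \<le> C / (1 + R) ^ 1"
    using schwartz_tail[OF \<phi>, of 1] by blast
  obtain K where K: "K > 0" "\<And>x. norm (\<phi> x) \<le> K / (1 + norm x) ^ 0"
    using schwartz_decay[OF \<phi>, of 0] by blast
  define R where "R = 2 * C / e"
  have R: "R > 0" using C(1) e by (simp add: R_def)
  define M where "M = K * (2 * (2 * R) ^ (CARD('n) - 1))"
  have M: "M > 0" using K R by (simp add: M_def)
  define r where "r = e / (2 * M)"
  have r: "r > 0" using e M by (simp add: r_def)
  note int = integrable_norm[OF schwartz_integrable[OF \<phi>]]
  have "(LINT x|lebesgue. indicator {x. \<bar>x $ i - v\<bar> \<le> r} x * norm (\<phi> x)) \<le> e" for v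
  proof -
    let ?S = "{x::real^'n. \<bar>x $ i - v\<bar> \<le> r}"
    have SB: "?S \<inter> ball 0 R \<in> sets lebesgue"
      using sets_lebesgue_component(1) by (intro sets.Int) auto
    have emS: "emeasure lebesgue (?S \<inter> ball 0 R) \<le> ennreal (2 * r * (2 * R) ^ (CARD('n) - 1))"
      using r R by (intro emeasure_slab_ball_le) auto
    then have fin: "emeasure lebesgue (?S \<inter> ball 0 R) < \<infinity>"
      using ennreal_less_top le_less_trans by fastforce
    have mS: "measure lebesgue (?S \<inter> ball 0 R) \<le> 2 * r * (2 * R) ^ (CARD('n) - 1)"
      using emS r R by (simp add: measure_def enn2real_leI)
    have int1: "integrable lebesgue (\<lambda>x. indicator (- ball 0 R) x * norm (\<phi> x))"
      using integrable_mult_indicator[OF _ int, of "- ball 0 R"] by (simp add: Compl_in_sets_lebesgue)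
    have int2: "integrable lebesgue (\<lambda>x. indicator (?S \<inter> ball 0 R) x * K)"
      using SB fin by (intro integrable_mult_left integrable_real_indicator)
    have "(LINT x|lebesgue. indicator ?S x * norm (\<phi> x)) \<le>
      (LINT x|lebesgue. indicator (- ball 0 R) x * norm (\<phi> x) + indicator (?S \<inter> ball 0 R) x * K)"
    proof (rule integral_mono)
      show "integrable lebesgue (\<lambda>x. indicator ?S x * norm (\<phi> x))"
        using integrable_mult_indicator[OF sets_lebesgue_component(1) int] by simp
      show "indicator ?S x * norm (\<phi> x) \<le> indicator (- ball 0 R) x * norm (\<phi> x) + indicator (?S \<inter>
          ball 0 R) x * K" for x
        using K(2)[of x] K(1) by (auto simp: indicator_def)
    qed (intro Bochner_Integration.integrable_add int1 int2)
    also have "\<dots> = (LINT x|lebesgue. indicator (- ball 0 R) x * norm (\<phi> x)) + (LINT x|lebesgue.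
        indicator (?S \<inter> ball 0 R) x * K)"
      by (intro Bochner_Integration.integral_add int1 int2)
    also have "(LINT x|lebesgue. indicator (?S \<inter> ball 0 R) x * K) = measure lebesgue (?S \<inter> ball 0 R) * K"
      using fin SB by (simp add: top.not_eq_extremum)
    also have "\<dots> \<le> r * M"
      using mult_right_mono[OF mS, of K] K(1) by (simp add: M_def mult_ac)
    also have "r * M = e / 2" using M by (simp add: r_def)
    also have "(LINT x|lebesgue. indicator (- ball 0 R) x * norm (\<phi> x)) \<le> e / 2"
    proof -
      have "C / (1 + R) ^ 1 \<le> C / R" using C R by (intro divide_left_mono) auto
      also have "C / R = e / 2" using C e by (simp add: R_def)
      finally have "C / (1 + R) ^ 1 \<le> e / 2" .
      with C(2)[OF less_imp_le[OF R]] show ?thesis by (rule order_trans)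
    qed
    finally show ?thesis by simp
  qed
  then show ?thesis using that r by blast
qed

text \<open>If all integrals over half spaces vanished, then \<open>\<phi>\<close> would integrate to zero against every
  step function of the coordinate \<open>x $ i\<close>, hence also against the plane wave
  \<open>exp (- \<i> * x $ i)\<close>, which is a bounded pointwise limit of such step functions.\<close>

lemma half_space_integral_nonzero:
  fixes \<phi> :: "real ^ 'n \<Rightarrow> complex"
  assumes int: "integrable lebesgue \<phi>" and ft: "fourier_transform \<phi> (axis i 1) \<noteq> 0"
  shows "\<exists>v. (LINT x|lebesgue. indicator {x. v < x $ i} x * \<phi> x) \<noteq> 0"
proof (rule ccontr)
  let ?H = "\<lambda>v. {x::real^'n. v < x $ i}"
  assume "\<not> ?thesis"
  then have zero: "(LINT x|lebesgue. indicator (?H v) x * \<phi> x) = 0" for v by blast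
  have intH: "integrable lebesgue (\<lambda>x. indicator (?H v) x * \<phi> x)" for v
    using integrable_mult_indicator[OF sets_lebesgue_component(2) int, of v i]
    by (rule Bochner_Integration.integrable_cong[THEN iffD1, rotated -1]) (auto simp: indicator_def)
  define w where "w = (\<lambda>t::real. exp (- (\<i> * complex_of_real t)))"
  have w1: "norm (w t) = 1" for t
    unfolding w_def using norm_exp_i_times[of "- t"] by simp
  \<comment> \<open>\<open>g n\<close> takes the value of the wave at the left end of the strip of width \<open>1 / (n + 1)\<close>
    that contains \<open>x\<close>; \<open>a n x\<close> is the index of this strip, and \<open>K n\<close> eventually contains
    it.\<close>
  define a where "a = (\<lambda>n::nat. \<lambda>x::real^'n. \<lceil>real (Suc n) * (x $ i)\<rceil> - 1)"
  define K where "K = (\<lambda>n::nat. {- (int (Suc n))\<^sup>2 ..< (int (Suc n))\<^sup>2})"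
  define g where "g = (\<lambda>n x. \<Sum>k\<in>K n. w (of_int k / real (Suc n)) *
      (indicator (?H (of_int k / real (Suc n))) x - indicator (?H (of_int (k + 1) / real (Suc n))) x))"
  have g_eq: "g n x = (if a n x \<in> K n then w (of_int (a n x) / real (Suc n)) else 0)" for n x
  proof -
    have "(indicator (?H (of_int k / real (Suc n))) x - indicator (?H (of_int (k + 1) / real (Suc
        n))) x :: complex)
        = (if k = a n x then 1 else 0)" for k
    proof -
      have "k = a n x \<longleftrightarrow> \<lceil>real (Suc n) * (x $ i)\<rceil> = k + 1" by (auto simp: a_def)
      also have "\<dots> \<longleftrightarrow> of_int k < real (Suc n) * (x $ i) \<and> real (Suc n) * (x $ i) \<le> of_int (k + 1)"
        by (subst ceiling_eq_iff) auto
      also have "\<dots> \<longleftrightarrow> of_int k / real (Suc n) < x $ i \<and> \<not> of_int (k + 1) / real (Suc n) < x $ i"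
        by (simp add: divide_less_eq less_divide_eq not_less mult.commute le_divide_eq pos_divide_less_eq)
      moreover have "of_int k / real (Suc n) < of_int (k + 1) / real (Suc n)"
        by (intro divide_strict_right_mono) auto
      ultimately show ?thesis by (auto simp: indicator_def)
    qed
    then have "g n x = (\<Sum>k\<in>K n. w (of_int k / real (Suc n)) * (if k = a n x then 1 else 0))"
      by (simp add: g_def)
    also have "\<dots> = (\<Sum>k\<in>K n. if k = a n x then w (of_int (a n x) / real (Suc n)) else 0)"
      by (intro sum.cong) auto
    also have "\<dots> = (if a n x \<in> K n then w (of_int (a n x) / real (Suc n)) else 0)"
      by (subst sum.delta) (auto simp: K_def)
    finally show ?thesis .
  qed
  have gexp: "g n x * \<phi> x = (\<Sum>k\<in>K n. w (of_int k / real (Suc n)) *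
      (indicator (?H (of_int k / real (Suc n))) x * \<phi> x - indicator (?H (of_int (k + 1) / real (Suc
          n))) x * \<phi> x))" for n x
    by (simp only: g_def sum_distrib_right left_diff_distrib right_diff_distrib mult.assoc)
  have int0: "(LINT x|lebesgue. g n x * \<phi> x) = 0" for n
    unfolding gexp
    by (subst Bochner_Integration.integral_sum)
      (auto intro!: integrable_mult_right Bochner_Integration.integrable_diff intH simp: zero intH
        Bochner_Integration.integral_diff)
  have intg: "integrable lebesgue (\<lambda>x. g n x * \<phi> x)" for n
    unfolding gexp
    by (intro Bochner_Integration.integrable_sum integrable_mult_right
        Bochner_Integration.integrable_diff intH)
  have lim: "(\<lambda>n. g n x) \<longlonglongrightarrow> w (x $ i)" for x
  proof -
    have "(\<lambda>n. of_int (a n x) / real (Suc n)) \<longlonglongrightarrow> x $ i"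
    proof (rule tendsto_sandwich[of "\<lambda>n. x $ i - 1 / real (Suc n)" _ _ "\<lambda>n. x $ i"])
      show "\<forall>\<^sub>F n in sequentially. x $ i - 1 / real (Suc n) \<le> of_int (a n x) / real (Suc n)"
      proof (rule always_eventually, rule allI)
        fix n
        have "x $ i - 1 / real (Suc n) = (real (Suc n) * (x $ i) - 1) / real (Suc n)"
          by (simp add: diff_divide_distrib)
        also have "\<dots> \<le> of_int (a n x) / real (Suc n)"
          unfolding a_def using le_of_int_ceiling[of "real (Suc n) * (x $ i)"]
          by (intro divide_right_mono) auto
        finally show "x $ i - 1 / real (Suc n) \<le> of_int (a n x) / real (Suc n)" .
      qed
      show "\<forall>\<^sub>F n in sequentially. of_int (a n x) / real (Suc n) \<le> x $ i"
      proof (rule always_eventually, rule allI)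
        fix n
        have "of_int (a n x) \<le> real (Suc n) * (x $ i)"
          unfolding a_def using of_int_ceiling_le_add_one[of "real (Suc n) * (x $ i)"] by linarith
        then show "of_int (a n x) / real (Suc n) \<le> x $ i" by (simp add: field_simps)
      qed
      show "(\<lambda>n. x $ i - 1 / real (Suc n)) \<longlonglongrightarrow> x $ i"
        using tendsto_diff[OF tendsto_const LIMSEQ_inverse_real_of_nat, of "x $ i"]
        by (simp add: inverse_eq_divide)
    qed auto
    then have 1: "(\<lambda>n. w (of_int (a n x) / real (Suc n))) \<longlonglongrightarrow> w (x $ i)"
      unfolding w_def by (intro tendsto_intros)
    obtain m :: nat where m: "\<bar>x $ i\<bar> + 1 < real m" using reals_Archimedean2 by blast
    have "\<forall>\<^sub>F n in sequentially. w (of_int (a n x) / real (Suc n)) = g n x"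
      unfolding eventually_sequentially
    proof (intro exI allI impI)
      fix n assume n: "m \<le> n"
      let ?N = "real (Suc n)"
      have xN: "\<bar>x $ i\<bar> + 1 < ?N" using m n by linarith
      have "?N * \<bar>x $ i\<bar> + ?N \<le> ?N * ?N"
        using mult_left_mono[of "\<bar>x $ i\<bar> + 1" ?N ?N] xN by (simp add: algebra_simps)
      moreover have "\<bar>?N * (x $ i)\<bar> = ?N * \<bar>x $ i\<bar>" by (simp add: abs_mult)
      moreover have "?N \<ge> 1" by simp
      ultimately have "- (?N * ?N) \<le> ?N * (x $ i) - 1" "?N * (x $ i) < ?N * ?N"
        by linarith+
      then have "- (?N * ?N) \<le> real_of_int (a n x)" "real_of_int (a n x) < ?N * ?N"
      proof -
        have "real_of_int (a n x) = of_int \<lceil>?N * (x $ i)\<rceil> - 1" by (simp add: a_def)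
        then show "- (?N * ?N) \<le> real_of_int (a n x)" "real_of_int (a n x) < ?N * ?N"
          using ceiling_correct[of "?N * (x $ i)"] \<open>- (?N * ?N) \<le> _\<close> \<open>_ < ?N * ?N\<close> by linarith+
      qed
      then have "real_of_int (- (int (Suc n))\<^sup>2) \<le> real_of_int (a n x)" "real_of_int (a n x) <
          real_of_int ((int (Suc n))\<^sup>2)"
        by (simp_all add: power2_eq_square)
      then have "a n x \<in> K n" unfolding K_def by (simp only: of_int_le_iff of_int_less_iff) simp
      then show "w (of_int (a n x) / real (Suc n)) = g n x" by (simp add: g_eq)
    qed
    then show ?thesis using 1 by (rule Lim_transform_eventually[rotated])
  qed
  have "(\<lambda>n. LINT x|lebesgue. g n x * \<phi> x) \<longlonglongrightarrow> (LINT x|lebesgue. w (x $ i) * \<phi> x)"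
  proof (rule integral_dominated_convergence[where w = "\<lambda>x. norm (\<phi> x)"])
    have "(\<lambda>x. w (x $ i)) \<in> borel_measurable borel"
      unfolding w_def by (intro borel_measurable_continuous_onI continuous_intros)
    then have "(\<lambda>x. w (x $ i)) \<in> borel_measurable lebesgue" by (simp add: measurable_completion)
    then show "(\<lambda>x. w (x $ i) * \<phi> x) \<in> borel_measurable lebesgue"
      using borel_measurable_integrable[OF int] by (intro borel_measurable_times)
    show "AE x in lebesgue. (\<lambda>n. g n x * \<phi> x) \<longlonglongrightarrow> w (x $ i) * \<phi> x"
      using lim by (intro AE_I2 tendsto_mult) auto
    show "AE x in lebesgue. norm (g n x * \<phi> x) \<le> norm (\<phi> x)" for n
      by (rule AE_I2) (auto simp: g_eq norm_mult w1)
  qed (use intg int in auto)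
  then have "(LINT x|lebesgue. w (x $ i) * \<phi> x) = 0"
    unfolding int0 using LIMSEQ_unique tendsto_const by blast
  then have "fourier_transform \<phi> (axis i 1) = 0"
    by (simp add: fourier_transform_def w_def inner_axis)
  then show False using ft by contradiction
qed

text \<open>Suppose that \<open>E\<close>, seen from \<open>b\<close> at scale \<open>1 / A\<close>, is the half space \<open>{y. y $ i < 0}\<close> up to a
  slab of width \<open>e\<close> and up to what happens outside the ball of radius \<open>B\<close>. Then the
  convolution is close to that of \<open>\<phi>\<close> with the half space, which is bounded away from zero at
  points whose signed distance to the edge is close to \<open>v / A\<close>. The constants depend on \<open>\<phi>\<close>
  alone.\<close>

lemma dilated_conv_near_flat_boundary:
  fixes \<phi> :: "real ^ 'n \<Rightarrow> complex"
  assumes \<phi>: "\<phi> \<in> schwartz_space" and ft: "fourier_transform \<phi> (axis i 1) \<noteq> 0"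
  obtains v c r B e where "c > 0" "r > 0" "B > 0" "e > 0" "e < B"
    "\<And>E A b x. E \<in> sets lebesgue \<Longrightarrow> A > 0 \<Longrightarrow>
       (\<And>y. norm y < B \<Longrightarrow> y $ i < - e \<Longrightarrow> b + (1 / A) *\<^sub>R y \<in> E) \<Longrightarrow>
       (\<And>y. norm y < B \<Longrightarrow> y $ i > e \<Longrightarrow> b + (1 / A) *\<^sub>R y \<notin> E) \<Longrightarrow>
       x \<in> ball (b + (v / A) *\<^sub>R axis i 1) (r / A) \<Longrightarrow> c \<le> norm (dilated_conv E \<phi> A x)"
proof -
  let ?H = "\<lambda>v. {x::real^'n. v < x $ i}"
  define U where "U = (\<lambda>v. LINT x|lebesgue. indicator (?H v) x * \<phi> x)"
  note int = schwartz_integrable[OF \<phi>]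
  have intH: "integrable lebesgue (\<lambda>x. indicator (?H v) x * \<phi> x)" for v
    using integrable_mult_indicator[OF sets_lebesgue_component(2) int, of v i]
    by (rule Bochner_Integration.integrable_cong[THEN iffD1, rotated -1]) (auto simp: indicator_def)
  have intS: "integrable lebesgue (\<lambda>x. indicator {x. \<bar>x $ i - v\<bar> \<le> r} x * norm (\<phi> x))" for v r
    using integrable_mult_indicator[OF sets_lebesgue_component(1) integrable_norm[OF int]] by simp
  obtain v where v: "U v \<noteq> 0"
    using half_space_integral_nonzero[OF int ft] by (auto simp: U_def)
  define c where "c = norm (U v) / 4"
  have c: "c > 0" using v by (simp add: c_def)
  obtain r where r: "r > 0"
    "\<And>v. (LINT x|lebesgue. indicator {x. \<bar>x $ i - v\<bar> \<le> r} x * norm (\<phi> x)) \<le> c"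
    using schwartz_slab_small[OF \<phi> c] by blast
  obtain C where C: "C > 0"
    "\<And>R. R \<ge> 0 \<Longrightarrow> (LINT x|lebesgue. indicator (- ball 0 R) x * norm (\<phi> x)) \<le> C / (1 + R) ^ 1"
    using schwartz_tail[OF \<phi>, of 1] by blast
  define R where "R = C / c"
  have R: "R > 0" using C c by (simp add: R_def)
  have tail: "(LINT x|lebesgue. indicator (- ball 0 R) x * norm (\<phi> x)) \<le> c"
  proof -
    have "C / (1 + R) ^ 1 \<le> C / R" using C R by (intro divide_left_mono) auto
    also have "C / R = c" using C c by (simp add: R_def)
    finally have "C / (1 + R) ^ 1 \<le> c" .
    with C(2)[OF less_imp_le[OF R]] show ?thesis by (rule order_trans)
  qed
  \<comment> \<open>Points \<open>x\<close> of the ball are at distance less than \<open>(\<bar>v\<bar> + r) / A\<close> from \<open>b\<close>, so the ball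
    of radius \<open>B\<close> around \<open>b\<close> contains the relevant ball of radius \<open>R\<close> around \<open>x\<close> (at scale
    \<open>1 / A\<close>).\<close>
  define B where "B = R + \<bar>v\<bar> + 2 * r"
  have U_close: "norm (U u) \<ge> 3 * c" if u: "\<bar>u - v\<bar> \<le> r" for u
  proof -
    have "U u - U v = (LINT x|lebesgue. indicator (?H u) x * \<phi> x - indicator (?H v) x * \<phi> x)"
      unfolding U_def by (intro Bochner_Integration.integral_diff[symmetric] intH)
    then have "norm (U u - U v) \<le> (LINT x|lebesgue. norm (indicator (?H u) x * \<phi> x - indicator (?H
        v) x * \<phi> x))"
      using integral_norm_bound[of lebesgue "\<lambda>x. indicator (?H u) x * \<phi> x - indicator (?H v) x * \<phi>
          x"] by simp
    also have "\<dots> \<le> (LINT x|lebesgue. indicator {x. \<bar>x $ i - v\<bar> \<le> r} x * norm (\<phi> x))"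
    proof (rule integral_mono)
      show "norm (indicator (?H u) x * \<phi> x - indicator (?H v) x * \<phi> x) \<le>
          indicator {x. \<bar>x $ i - v\<bar> \<le> r} x * norm (\<phi> x)" for x
        using u by (auto simp: indicator_def)
    qed (intro integrable_norm Bochner_Integration.integrable_diff intH intS)+
    also have "\<dots> \<le> c" by (rule r)
    finally have "norm (U u - U v) \<le> c" .
    moreover have "norm (U v) \<le> norm (U u) + norm (U u - U v)"
      using norm_triangle_sub[of "U v" "U u"] by (simp add: norm_minus_commute)
    ultimately show ?thesis by (simp add: c_def)
  qed
  have "c \<le> norm (dilated_conv E \<phi> A x)"
    if E: "E \<in> sets lebesgue" and A: "A > 0"
      and inside: "\<And>y. norm y < B \<Longrightarrow> y $ i < - r \<Longrightarrow> b + (1 / A) *\<^sub>R y \<in> E"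
      and outside: "\<And>y. norm y < B \<Longrightarrow> y $ i > r \<Longrightarrow> b + (1 / A) *\<^sub>R y \<notin> E"
      and x: "x \<in> ball (b + (v / A) *\<^sub>R axis i 1) (r / A)" for E A b x
  proof -
    define u where "u = A *\<^sub>R (x - b)"
    have x_eq: "x = b + (1 / A) *\<^sub>R u" using A by (simp add: u_def)
    have "u - v *\<^sub>R axis i 1 = A *\<^sub>R (x - (b + (v / A) *\<^sub>R axis i 1))"
      using A by (simp add: u_def algebra_simps)
    then have "norm (u - v *\<^sub>R axis i 1) = A * norm (x - (b + (v / A) *\<^sub>R axis i 1))"
      using A by simp
    also have "\<dots> < A * (r / A)"
      using x A by (intro mult_strict_left_mono) (auto simp: dist_norm norm_minus_commute)
    finally have ur: "norm (u - v *\<^sub>R axis i 1) < r" using A by simp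
    have ui: "\<bar>u $ i - v\<bar> \<le> r"
      using component_le_norm_cart[of "u - v *\<^sub>R axis i 1" i] ur by simp
    have "norm u \<le> norm (u - v *\<^sub>R axis i 1) + norm (v *\<^sub>R (axis i 1 :: real^'n))"
      using norm_triangle_sub[of u "v *\<^sub>R axis i 1"] by simp
    then have un: "norm u < r + \<bar>v\<bar>" using ur by (simp add: norm_axis_1)
    let ?f = "\<lambda>z. indicator E (x - (1 / A) *\<^sub>R z) * \<phi> z - indicator (?H (u $ i)) z * \<phi> z"
    have intf: "integrable lebesgue ?f"
      by (intro Bochner_Integration.integrable_diff dilated_conv_integrable E A int intH)
    have "dilated_conv E \<phi> A x - U (u $ i) = (LINT z|lebesgue. ?f z)"
      unfolding dilated_conv_def U_def
      by (intro Bochner_Integration.integral_diff[symmetric] dilated_conv_integrable E A int intH)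
    then have "norm (dilated_conv E \<phi> A x - U (u $ i)) \<le> (LINT z|lebesgue. norm (?f z))"
      using integral_norm_bound[of lebesgue ?f] by simp
    also have "\<dots> \<le> (LINT z|lebesgue. indicator (- ball 0 R) z * norm (\<phi> z) +
        indicator {z. \<bar>z $ i - u $ i\<bar> \<le> r} z * norm (\<phi> z))"
    proof (rule integral_mono)
      show "integrable lebesgue (\<lambda>z. indicator (- ball 0 R) z * norm (\<phi> z) +
        indicator {z. \<bar>z $ i - u $ i\<bar> \<le> r} z * norm (\<phi> z))"
        using integrable_mult_indicator[OF _ integrable_norm[OF int], of "- ball 0 R"]
        by (intro Bochner_Integration.integrable_add intS) (simp add: Compl_in_sets_lebesgue)
      fix z
      have x_z: "x - (1 / A) *\<^sub>R z = b + (1 / A) *\<^sub>R (u - z)"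
        unfolding x_eq by (simp add: algebra_simps)
      show "norm (?f z) \<le> indicator (- ball 0 R) z * norm (\<phi> z) +
          indicator {z. \<bar>z $ i - u $ i\<bar> \<le> r} z * norm (\<phi> z)"
      proof (cases "norm z < R \<and> \<not> \<bar>z $ i - u $ i\<bar> \<le> r")
        case True
        have "norm (u - z) < B"
          using norm_triangle_ineq4[of u z] un True r(1) unfolding B_def by linarith
        then have "indicator E (x - (1 / A) *\<^sub>R z) = (indicator (?H (u $ i)) z :: complex)"
          unfolding x_z using inside[of "u - z"] outside[of "u - z"] True by (auto simp: indicator_def)
        then show ?thesis by simp
      next
        case False
        have "norm (?f z) \<le> norm (\<phi> z)" by (simp add: indicator_def)
        then show ?thesis using False by (auto simp: indicator_def)
      qed
    qed (intro integrable_norm intf)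
    also have "\<dots> = (LINT z|lebesgue. indicator (- ball 0 R) z * norm (\<phi> z)) +
        (LINT z|lebesgue. indicator {z. \<bar>z $ i - u $ i\<bar> \<le> r} z * norm (\<phi> z))"
      using integrable_mult_indicator[OF _ integrable_norm[OF int], of "- ball 0 R"]
      by (intro Bochner_Integration.integral_add intS) (simp add: Compl_in_sets_lebesgue)
    also have "\<dots> \<le> c + c" using tail r(2) by (rule add_mono)
    finally have "norm (dilated_conv E \<phi> A x - U (u $ i)) \<le> 2 * c" by simp
    moreover have "norm (U (u $ i)) \<le> norm (dilated_conv E \<phi> A x) + norm (dilated_conv E \<phi> A x - U (u $ i))"
      using norm_triangle_sub[of "U (u $ i)" "dilated_conv E \<phi> A x"] by (simp add: norm_minus_commute)
    ultimately show ?thesis using U_close[OF ui] by linarith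
  qed
  moreover have "B > 0" "r < B" using R r by (auto simp: B_def)
  ultimately show ?thesis using that[of c r B r v] c r(1) by blast
qed

lemma schwartz_add:
  fixes f g :: "real ^ 'n \<Rightarrow> complex"
  assumes f: "f \<in> schwartz_space" and g: "g \<in> schwartz_space"
  shows "(\<lambda>x. f x + g x) \<in> schwartz_space"
proof -
  have df: "\<And>ds x. iterated_deriv ds f differentiable (at x)"
    and dg: "\<And>ds x. iterated_deriv ds g differentiable (at x)"
    using f g by (auto simp: schwartz_space_def)
  have eq: "iterated_deriv ds (\<lambda>x. f x + g x) = (\<lambda>x. iterated_deriv ds f x + iterated_deriv ds g x)" for ds
  proof (induction ds)
    case (Cons d ds)
    have "frechet_derivative (\<lambda>x. iterated_deriv ds f x + iterated_deriv ds g x) (at x) =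
      (\<lambda>h. frechet_derivative (iterated_deriv ds f) (at x) h + frechet_derivative (iterated_deriv ds
          g) (at x) h)" for x
      using df dg by (intro frechet_derivative_at[symmetric] has_derivative_add)
        (simp_all add: frechet_derivative_works)
    then show ?case
      by (simp add: iterated_deriv_Cons Cons.IH partial_deriv_def fun_eq_iff)
  qed simp
  have "bounded (range (\<lambda>x. (1 + norm x) ^ N *\<^sub>R iterated_deriv ds (\<lambda>x. f x + g x) x))" for N ds
  proof -
    have "bounded (range (\<lambda>x. (1 + norm x) ^ N *\<^sub>R iterated_deriv ds f x))"
      "bounded (range (\<lambda>x. (1 + norm x) ^ N *\<^sub>R iterated_deriv ds g x))"
      using f g by (auto simp: schwartz_space_def)
    from bounded_plus_comp[OF this] show ?thesis
      by (simp add: eq scaleR_add_right)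
  qed
  then show ?thesis
    using differentiable_add[OF df dg] by (auto simp: schwartz_space_def eq)
qed

text \<open>The seminorm without weight and derivatives controls the integral over a set of finite
  measure.\<close>

lemma regular_distribution_tempered:
  fixes E :: "(real ^ 'n) set"
  assumes E: "E \<in> lmeasurable"
  shows "regular_distribution (indicator E) \<in> tempered_distributions"
proof -
  let ?T = "regular_distribution (indicator E) :: (real ^ 'n \<Rightarrow> complex) \<Rightarrow> complex"
  let ?S = "schwartz_space :: (real ^ 'n \<Rightarrow> complex) set"
  define M where "M = measure lebesgue E + 1"
  have M: "M > 0" by (simp add: M_def add_nonneg_pos)
  have Es: "E \<in> sets lebesgue" using E by (rule fmeasurableD)
  have T: "?T f = (LINT x|lebesgue. indicator E x * f x)" if "f \<in> ?S" for f
    using that by (simp add: regular_distribution_def)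
  have int: "integrable lebesgue (\<lambda>x. indicator E x * f x)" if "f \<in> ?S" for f
    using integrable_mult_indicator[OF Es schwartz_integrable[OF that]]
    by (rule Bochner_Integration.integrable_cong[THEN iffD1, rotated -1]) (auto simp: indicator_def)
  have bdd: "bdd_above (range (\<lambda>x. norm (g x - f x)))" if fg: "f \<in> ?S" "g \<in> ?S" for f g
  proof -
    obtain C1 where C1: "\<And>x. norm (f x) \<le> C1 / (1 + norm x) ^ 0" using schwartz_decay[OF fg(1)] by blast
    obtain C2 where C2: "\<And>x. norm (g x) \<le> C2 / (1 + norm x) ^ 0" using schwartz_decay[OF fg(2)] by blast
    have "norm (g x - f x) \<le> C1 + C2" for x
      using norm_triangle_ineq4[of "g x" "f x"] C1[of x] C2[of x] by simp
    then show ?thesis by (auto simp: bdd_above_def)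
  qed
  have T_close: "dist (?T g) (?T f) \<le> M * schwartz_seminorm 0 [] (\<lambda>x. g x - f x)"
    if fg: "f \<in> ?S" "g \<in> ?S" for f g
  proof -
    let ?s = "schwartz_seminorm 0 [] (\<lambda>x. g x - f x)"
    have s: "norm (g x - f x) \<le> ?s" for x
      using cSUP_upper[OF UNIV_I bdd[OF fg]] by (simp add: schwartz_seminorm_def)
    have s0: "0 \<le> ?s" using s norm_ge_zero order_trans by blast
    have "dist (?T g) (?T f) = norm (LINT x|lebesgue. indicator E x * g x - indicator E x * f x)"
      using fg by (simp add: T dist_norm Bochner_Integration.integral_diff int)
    also have "\<dots> \<le> (LINT x|lebesgue. norm (indicator E x * g x - indicator E x * f x))"
      by (rule integral_norm_bound)
    also have "\<dots> \<le> (LINT x|lebesgue. indicator E x * ?s)"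
    proof (rule integral_mono)
      show "integrable lebesgue (\<lambda>x. indicator E x * ?s)"
        using E by (intro integrable_mult_left integrable_real_indicator) (auto simp: fmeasurable_def)
      show "norm (indicator E x * g x - indicator E x * f x) \<le> indicator E x * ?s" for x
        using s[of x] by (auto simp: indicator_def)
    qed (intro integrable_norm Bochner_Integration.integrable_diff int fg)
    also have "\<dots> = measure lebesgue E * ?s"
      using E by (simp add: fmeasurable_def top.not_eq_extremum)
    also have "\<dots> \<le> M * ?s" using s0 by (intro mult_right_mono) (auto simp: M_def)
    finally show ?thesis .
  qed
  define \<B> where "\<B> = {{g \<in> ?S. schwartz_seminorm N ds (\<lambda>x. g x - f x) < e} | f N ds e. f \<in> ?S \<and> e > 0}"
  have top: "schwartz_topology = topology_generated_by \<B>"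
    by (simp add: schwartz_topology_def \<B>_def)
  have self: "schwartz_seminorm N ds (\<lambda>x. f x - f x) = 0" if "f \<in> ?S"
      for f :: "real ^ 'n \<Rightarrow> complex" and N ds
  proof -
    have "iterated_deriv ds (\<lambda>x. 0 * f (0 + 1 *\<^sub>R x)) = (\<lambda>x. (0 * of_real 1 ^ length ds) *
        iterated_deriv ds f (0 + 1 *\<^sub>R x))"
      using that by (intro iterated_deriv_affine_comp) (auto simp: schwartz_space_def)
    then show ?thesis by (simp add: schwartz_seminorm_def)
  qed
  have "continuous_map schwartz_topology euclidean ?T"
    unfolding continuous_map_def
  proof (intro conjI allI impI)
    fix U :: "complex set" assume "openin euclidean U"
    then have U: "open U" by simp
    show "openin schwartz_topology {f \<in> topspace schwartz_topology. ?T f \<in> U}"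
    proof (subst openin_subopen, intro ballI)
      fix f assume "f \<in> {f \<in> topspace schwartz_topology. ?T f \<in> U}"
      then have f: "f \<in> ?S" "?T f \<in> U"
        by (auto simp: top topology_generated_by_topspace \<B>_def)
      obtain e where e: "e > 0" "ball (?T f) e \<subseteq> U"
        using U f(2) by (auto simp: open_contains_ball)
      let ?V = "{g \<in> ?S. schwartz_seminorm 0 [] (\<lambda>x. g x - f x) < e / M}"
      have V: "?V \<in> \<B>" using f e M unfolding \<B>_def by (intro CollectI exI[of _ f]) (auto intro!: exI)
      have "openin schwartz_topology ?V" unfolding top using V by (rule topology_generated_by_Basis)
      moreover have "f \<in> ?V" using f e M self[of f 0 "[]"] by simp
      moreover have "?V \<subseteq> {f \<in> topspace schwartz_topology. ?T f \<in> U}"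
      proof
        fix g assume g: "g \<in> ?V"
        have "M * schwartz_seminorm 0 [] (\<lambda>x. g x - f x) < M * (e / M)"
          using g M by (intro mult_strict_left_mono) auto
        then have "dist (?T g) (?T f) < e" using T_close[of f g] f g M by simp
        then have "?T g \<in> U" using e by (auto simp: dist_commute)
        then show "g \<in> {f \<in> topspace schwartz_topology. ?T f \<in> U}"
          using g V unfolding top topology_generated_by_topspace by blast
      qed
      ultimately show "\<exists>V. openin schwartz_topology V \<and> f \<in> V \<and> V \<subseteq> {f \<in> topspace schwartz_topology.
          ?T f \<in> U}"
        by blast
    qed
  qed auto
  moreover have "?T (\<lambda>x. f x + g x) = ?T f + ?T g" if fg: "f \<in> ?S" "g \<in> ?S" for f g
    using fg by (simp add: T schwartz_add distrib_left Bochner_Integration.integral_add int)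
  moreover have "?T (\<lambda>x. c * f x) = c * ?T f" if f: "f \<in> ?S" for c f
  proof -
    have "(\<lambda>x. c * f x) \<in> ?S" using schwartz_affine_comp[OF f, of 1 c 0] by simp
    then show ?thesis using f by (simp add: T mult.left_commute)
  qed
  moreover have "?T \<in> extensional ?S" by (simp add: regular_distribution_def)
  ultimately show ?thesis by (simp add: tempered_distributions_def)
qed

section \<open>The spiral domain and its boundary\<close>

definition vec_of_complex :: "complex \<Rightarrow> real ^ 2" where
  "vec_of_complex z = vector [Re z, Im z]"

definition complex_of_vec :: "real ^ 2 \<Rightarrow> complex" where
  "complex_of_vec x = Complex (x $ 1) (x $ 2)"

lemma vec_of_complex_of_vec [simp]: "vec_of_complex (complex_of_vec x) = x"
  by (simp add: complex_of_vec_def vec_of_complex_def vec_eq_iff forall_2)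

lemma vec_of_complex_diff: "vec_of_complex (z - w) = vec_of_complex z - vec_of_complex w"
  by (simp add: vec_of_complex_def vec_eq_iff forall_2)

lemma norm_vec_of_complex [simp]: "norm (vec_of_complex z) = norm z"
  by (simp add: vec_of_complex_def norm_vec_def L2_set_def UNIV_2 cmod_def)

lemma norm_complex_of_vec [simp]: "norm (complex_of_vec x) = norm x"
  using norm_vec_of_complex[of "complex_of_vec x"] by simp

lemma complex_of_vec_eq_0_iff [simp]: "complex_of_vec x = 0 \<longleftrightarrow> x = 0"
  by (metis norm_complex_of_vec norm_eq_zero)

lemma complex_of_vec_0 [simp]: "complex_of_vec 0 = 0"
  by simp

lemma continuous_complex_of_vec: "isCont complex_of_vec x"
proof -
  have eq: "complex_of_vec = (\<lambda>x. of_real (x $ 1) + \<i> * of_real (x $ 2))"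
    by (simp add: complex_of_vec_def fun_eq_iff complex_eq_iff)
  show ?thesis unfolding eq by (intro continuous_intros)
qed

lemma less_powr_inverse_iff:
  fixes r t \<alpha> :: real
  assumes "r > 0" "t > 0" "\<alpha> > 0"
  shows "r < t powr (- \<alpha>) \<longleftrightarrow> t < r powr (- 1 / \<alpha>)"
proof
  have eq: "(t powr (- \<alpha>)) powr (- 1 / \<alpha>) = t" "(r powr (- 1 / \<alpha>)) powr (- \<alpha>) = r"
    using assms by (simp_all add: powr_powr)
  show "t < r powr (- 1 / \<alpha>)" if "r < t powr (- \<alpha>)"
    using powr_less_mono2_neg[of "- 1 / \<alpha>" r "t powr (- \<alpha>)"] that assms eq by simp
  show "r < t powr (- \<alpha>)" if "t < r powr (- 1 / \<alpha>)"
    using powr_less_mono2_neg[of "- \<alpha>" t "r powr (- 1 / \<alpha>)"] that assms eq by simp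
qed

lemma powr_inverse_le_iff:
  fixes r t \<alpha> :: real
  assumes "r > 0" "t > 0" "\<alpha> > 0"
  shows "t powr (- \<alpha>) \<le> r \<longleftrightarrow> r powr (- 1 / \<alpha>) \<le> t"
  using less_powr_inverse_iff[OF assms] by linarith

text \<open>The parameter at which the curve \<open>r = t powr (- \<alpha>)\<close> has the radius of \<open>x\<close>, measured from the
  angle of \<open>x\<close>. The domain consists of the points whose phase lies in the first half of a
  period, apart from the period \<open>k = 0\<close>.\<close>

definition spiral_phase :: "real \<Rightarrow> real ^ 2 \<Rightarrow> real" where
  "spiral_phase \<alpha> x = norm x powr (- 1 / \<alpha>) - Arg2pi (complex_of_vec x)"

lemma zero_notin_spiral: "0 \<notin> spiral \<alpha>"
proof
  assume "0 \<in> spiral \<alpha>"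
  then obtain r t where *: "(0::real^2) = vector [r * cos t, r * sin t]"
    "1 / (t + pi) powr \<alpha> \<le> r" "2 * pi \<le> t"
    by (auto simp: spiral_def)
  have "0 < t + pi" using *(3) pi_gt_zero by linarith
  then have r: "r > 0" using *(2) by (smt (verit) divide_pos_pos powr_gt_zero)
  have "(0::real^2) $ 1 = (vector [r * cos t, r * sin t] :: real^2) $ 1"
    "(0::real^2) $ 2 = (vector [r * cos t, r * sin t] :: real^2) $ 2"
    unfolding *(1)[symmetric] by simp_all
  then have "cos t = 0" "sin t = 0" using r by simp_all
  then show False using sin_cos_squared_add[of t] by simp
qed

lemma spiral_iff_phase:
  assumes x: "x \<noteq> 0" and \<alpha>: "\<alpha> > 0"
  shows "x \<in> spiral \<alpha> \<longleftrightarrow>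
    (\<exists>k::nat. 1 \<le> k \<and> 2 * pi * real k < spiral_phase \<alpha> x \<and> spiral_phase \<alpha> x \<le> 2 * pi * real k + pi)"
proof
  assume "x \<in> spiral \<alpha>"
  then obtain r t where rt: "x = vector [r * cos t, r * sin t]" "1 / (t + pi) powr \<alpha> \<le> r"
    "r < 1 / t powr \<alpha>" "2 * pi \<le> t"
    by (auto simp: spiral_def)
  have t: "t > 0" "t + pi > 0" using rt(4) pi_gt_zero by linarith+
  then have r: "r > 0" using rt(2) by (smt (verit) divide_pos_pos powr_gt_zero)
  have xc: "complex_of_vec x = of_real r * cis t"
    by (simp add: rt(1) complex_of_vec_def complex_eq_iff)
  have nx: "norm x = r"
    using arg_cong[OF xc, of norm] r by (simp add: norm_mult)
  define k where "k = nat \<lfloor>t / (2 * pi)\<rfloor>"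
  have tk: "1 \<le> t / (2 * pi)" using rt(4) pi_gt_zero by (simp add: field_simps)
  then have fl: "1 \<le> \<lfloor>t / (2 * pi)\<rfloor>" by linarith
  then have ik: "int k = \<lfloor>t / (2 * pi)\<rfloor>" unfolding k_def by (intro nat_0_le) linarith
  have k: "1 \<le> k" "real k = of_int \<lfloor>t / (2 * pi)\<rfloor>"
    using fl ik by (linarith, metis ik of_int_of_nat_eq)
  have "real k \<le> t / (2 * pi)" "t / (2 * pi) < real k + 1"
    unfolding k(2) by linarith+
  then have kt: "0 \<le> t - 2 * pi * real k" "t - 2 * pi * real k < 2 * pi"
    using pi_gt_zero by (simp_all add: field_simps)
  have "cis (t - 2 * pi * real k) = cis t"
    using cis_divide[of t "2 * pi * real k"] cis_multiple_2pi[of "real k"] by simp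
  then have "of_real r * exp (\<i> * of_real (t - 2 * pi * real k)) = complex_of_vec x"
    unfolding xc by (simp only: cis_conv_exp[symmetric])
  then have arg: "Arg2pi (complex_of_vec x) = t - 2 * pi * real k"
    using Arg2pi_unique[of r "t - 2 * pi * real k"] r kt by blast
  have "t < r powr (- 1 / \<alpha>)"
  proof -
    have "r < t powr (- \<alpha>)" using rt(3) by (simp add: powr_minus_divide)
    then show ?thesis using less_powr_inverse_iff[OF r t(1) \<alpha>] by simp
  qed
  moreover have "r powr (- 1 / \<alpha>) \<le> t + pi"
    using rt(2) r t \<alpha> powr_inverse_le_iff[of r "t + pi" \<alpha>] by (simp add: powr_minus_divide)
  ultimately show "\<exists>k::nat. 1 \<le> k \<and> 2 * pi * real k < spiral_phase \<alpha> x \<and> spiral_phase \<alpha> x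
      \<le> 2 * pi * real k + pi"
    using k by (intro exI[of _ k]) (simp add: spiral_phase_def arg nx)
next
  assume "\<exists>k::nat. 1 \<le> k \<and> 2 * pi * real k < spiral_phase \<alpha> x \<and> spiral_phase \<alpha> x \<le> 2 * pi * real k + pi"
  then obtain k :: nat where k: "1 \<le> k" "2 * pi * real k < spiral_phase \<alpha> x" "spiral_phase \<alpha> x
      \<le> 2 * pi * real k + pi"
    by blast
  define t where "t = Arg2pi (complex_of_vec x) + 2 * pi * real k"
  define r where "r = norm x"
  have r: "r > 0" using x by (simp add: r_def)
  have t2: "2 * pi \<le> t"
  proof -
    have "2 * pi * 1 \<le> 2 * pi * real k" using k(1) by (intro mult_left_mono) auto
    then show ?thesis using Arg2pi_ge_0[of "complex_of_vec x"] unfolding t_def by linarith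
  qed
  then have t: "t > 0" "t + pi > 0" using pi_gt_zero by linarith+
  have "cis t = cis (Arg2pi (complex_of_vec x))"
    using cis_mult[of "Arg2pi (complex_of_vec x)" "2 * pi * real k"] cis_multiple_2pi[of "real k"]
        by (simp add: t_def)
  then have "complex_of_vec x = of_real r * cis t"
    using Arg2pi_eq[of "complex_of_vec x"] by (simp add: r_def cis_conv_exp)
  then have "x = vector [r * cos t, r * sin t]"
    using vec_of_complex_of_vec[of x] by (simp add: vec_of_complex_def)
  moreover have "r < t powr (- \<alpha>)"
    using less_powr_inverse_iff[OF r t(1) \<alpha>] k(2) by (simp add: spiral_phase_def r_def t_def)
  moreover have "(t + pi) powr (- \<alpha>) \<le> r"
    using powr_inverse_le_iff[OF r t(2) \<alpha>] k(3) by (simp add: spiral_phase_def r_def t_def)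
  ultimately show "x \<in> spiral \<alpha>"
    using t2 by (auto simp: spiral_def powr_minus_divide)
qed

text \<open>The outer edges of the domain form the curve with \<open>\<sigma> = 1\<close>. The inner edges
  \<open>r = (t + pi) powr (- \<alpha>)\<close> at angle \<open>t\<close> form the curve with \<open>\<sigma> = -1\<close>, reparametrised by
  \<open>t + pi\<close>.\<close>

definition spiral_curve :: "real \<Rightarrow> real \<Rightarrow> real \<Rightarrow> real ^ 2" where
  "spiral_curve \<alpha> \<sigma> t = vec_of_complex (of_real (\<sigma> * t powr (- \<alpha>)) * cis t)"

text \<open>The half-line on which the angle jumps, as far as the domain reaches. It contains the origin
  and the straight end of the first turn.\<close>

definition unit_slit :: "(real ^ 2) set" where
  "unit_slit = {x. x $ 2 = 0 \<and> 0 \<le> x $ 1 \<and> x $ 1 \<le> 1}"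

definition spiral_edges :: "real \<Rightarrow> (real ^ 2) set" where
  "spiral_edges \<alpha> = spiral_curve \<alpha> 1 ` {2 * pi..} \<union> spiral_curve \<alpha> (- 1) ` {2 * pi..} \<union> unit_slit"

lemma norm_spiral_curve: "\<bar>\<sigma>\<bar> = 1 \<Longrightarrow> norm (spiral_curve \<alpha> \<sigma> t) = t powr (- \<alpha>)"
  by (simp add: spiral_curve_def norm_mult abs_mult)

lemma norm_spiral_less_1:
  assumes "\<alpha> > 0"
  shows "spiral \<alpha> \<subseteq> cball 0 ((2 * pi) powr (- \<alpha>))" "(2 * pi) powr (- \<alpha>) < 1"
proof
  fix x assume "x \<in> spiral \<alpha>"
  then obtain r t where rt: "x = vector [r * cos t, r * sin t]" "1 / (t + pi) powr \<alpha> \<le> r"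
    "r < 1 / t powr \<alpha>" "2 * pi \<le> t"
    by (auto simp: spiral_def)
  have t: "t > 0" "t + pi > 0" using rt(4) pi_gt_zero by linarith+
  then have r: "r > 0" using rt(2) by (smt (verit) divide_pos_pos powr_gt_zero)
  have "complex_of_vec x = of_real r * cis t"
    by (simp add: rt(1) complex_of_vec_def complex_eq_iff)
  from arg_cong[OF this, of norm] have "norm x = r" using r by (simp add: norm_mult)
  also have "r \<le> t powr (- \<alpha>)" using rt(3) by (simp add: powr_minus_divide)
  also have "\<dots> \<le> (2 * pi) powr (- \<alpha>)"
    using powr_mono2'[of "- \<alpha>" "2 * pi" t] rt(4) assms pi_gt_zero by simp
  finally show "x \<in> cball 0 ((2 * pi) powr (- \<alpha>))" by simp
next
  have "1 < (2 * pi) powr \<alpha>"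
    using assms pi_gt3 by (intro gr_one_powr) auto
  then show "(2 * pi) powr (- \<alpha>) < 1" by (simp add: powr_minus_divide)
qed

text \<open>Even multiples of \<open>pi\<close> are attained on the outer edges, odd ones on the inner edges.\<close>

lemma on_curve_if_phase_multiple:
  assumes x: "x \<noteq> 0" and \<alpha>: "\<alpha> > 0" and p: "spiral_phase \<alpha> x = of_int m * pi" and m: "m \<ge> 2"
  shows "x \<in> spiral_edges \<alpha>"
proof -
  let ?\<theta> = "Arg2pi (complex_of_vec x)"
  define t where "t = ?\<theta> + of_int m * pi"
  have t2: "2 * pi \<le> t"
  proof -
    have "2 * pi \<le> of_int m * pi" using m by (intro mult_right_mono) auto
    then show ?thesis using Arg2pi_ge_0[of "complex_of_vec x"] unfolding t_def by linarith
  qed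
  then have t: "t > 0" using pi_gt_zero by linarith
  have "norm x powr (- 1 / \<alpha>) = t" using p by (simp add: spiral_phase_def t_def)
  then have nx: "norm x = t powr (- \<alpha>)"
    using x \<alpha> by (simp add: powr_powr flip: \<open>norm x powr _ = t\<close>)
  have xc: "complex_of_vec x = of_real (norm x) * cis ?\<theta>"
    using Arg2pi_eq[of "complex_of_vec x"] by (simp add: cis_conv_exp)
  have "\<exists>\<sigma>\<in>{1, -1}. cis ?\<theta> = of_real \<sigma> * cis t"
  proof (cases "even m")
    case True
    then obtain k where "m = 2 * k" by blast
    then have "t = ?\<theta> + 2 * pi * of_int k" by (simp add: t_def)
    then have "cis t = cis ?\<theta>"
      using cis_mult[of ?\<theta> "2 * pi * of_int k"] cis_multiple_2pi[of "of_int k"] by simp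
    then show ?thesis by auto
  next
    case False
    then obtain k where "m = 2 * k + 1" using oddE by blast
    then have "t = ?\<theta> + 2 * pi * of_int k + pi" by (simp add: t_def algebra_simps)
    then have "cis t = - cis ?\<theta>"
      using cis_mult[of ?\<theta> "2 * pi * of_int k"] cis_multiple_2pi[of "of_int k"] cis_mult[of "?\<theta> + 2
          * pi * of_int k" pi] by simp
    then show ?thesis by auto
  qed
  then obtain \<sigma> where \<sigma>: "\<sigma> \<in> {1, -1}" "cis ?\<theta> = of_real \<sigma> * cis t" by blast
  have "complex_of_vec x = of_real (\<sigma> * t powr (- \<alpha>)) * cis t"
    using xc \<sigma>(2) nx by simp
  then have "x = spiral_curve \<alpha> \<sigma> t"
    unfolding spiral_curve_def by (metis vec_of_complex_of_vec)
  then show ?thesis using \<sigma>(1) t2 by (auto simp: spiral_edges_def)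
qed

lemma continuous_spiral_phase:
  assumes "complex_of_vec x \<notin> \<real>\<^sub>\<ge>\<^sub>0"
  shows "isCont (spiral_phase \<alpha>) x"
proof -
  have "isCont (\<lambda>x. Arg2pi (complex_of_vec x)) x"
    by (intro isCont_o2[OF continuous_complex_of_vec continuous_at_Arg2pi] assms)
  moreover have "x \<noteq> 0" using assms by auto
  ultimately show ?thesis
    unfolding spiral_phase_def by (intro continuous_intros) auto
qed

text \<open>The slit is where the angle jumps; elsewhere the phase is continuous, so the indicator can
  only jump where the phase is a multiple of \<open>pi\<close>, that is on the two spiral curves.\<close>

lemma frontier_spiral_subset:
  assumes \<alpha>: "\<alpha> > 0"
  shows "frontier (spiral \<alpha>) \<subseteq> spiral_edges \<alpha>"
proof
  fix x assume fr: "x \<in> frontier (spiral \<alpha>)"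
  show "x \<in> spiral_edges \<alpha>"
  proof (rule ccontr)
    assume nx: "x \<notin> spiral_edges \<alpha>"
    have "closure (spiral \<alpha>) \<subseteq> cball 0 ((2 * pi) powr (- \<alpha>))"
      using norm_spiral_less_1(1)[OF \<alpha>] by (rule closure_minimal) simp
    then have "norm x < 1" using fr norm_spiral_less_1(2)[OF \<alpha>] by (auto simp: frontier_def)
    then have x1: "x $ 1 \<le> 1" using component_le_norm_cart[of x 1] by linarith
    have nr: "complex_of_vec x \<notin> \<real>\<^sub>\<ge>\<^sub>0"
      using nx x1 by (auto simp: spiral_edges_def unit_slit_def complex_nonneg_Reals_iff complex_of_vec_def)
    then have x0: "x \<noteq> 0" by auto
    let ?p = "spiral_phase \<alpha>"
    have cont: "isCont ?p x" by (rule continuous_spiral_phase[OF nr])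
    have "\<exists>e>0. (\<forall>y. dist x y < e \<longrightarrow> y \<in> spiral \<alpha>) \<or> (\<forall>y. dist x y < e \<longrightarrow> y \<notin> spiral \<alpha>)"
    proof (cases "?p x < 2 * pi")
      case True
      then have "\<forall>\<^sub>F y in nhds x. ?p y < 2 * pi"
        using cont by (auto simp: isCont_def tendsto_at_iff_tendsto_nhds intro: order_tendstoD)
      then obtain e where e: "e > 0" "\<And>y. dist y x < e \<Longrightarrow> ?p y < 2 * pi"
        by (auto simp: eventually_nhds_metric)
      have "y \<notin> spiral \<alpha>" if "dist x y < e" for y
      proof (cases "y = 0")
        case False
        have py: "?p y < 2 * pi" using e that by (simp add: dist_commute)
        have "\<not> 2 * pi * real k < ?p y" if "1 \<le> k" for k
        proof -
          have "2 * pi * 1 \<le> 2 * pi * real k" using that by (intro mult_left_mono) auto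
          then show ?thesis using py by linarith
        qed
        then show ?thesis using spiral_iff_phase[OF False \<alpha>] by blast
      qed (simp add: zero_notin_spiral)
      then show ?thesis using e(1) by blast
    next
      case False
      define m where "m = \<lfloor>?p x / pi\<rfloor>"
      have "2 \<le> ?p x / pi" using False by (simp add: field_simps)
      then have m2: "m \<ge> 2" unfolding m_def by linarith
      have "of_int m * pi \<le> ?p x" "?p x < of_int (m + 1) * pi"
        using of_int_floor_le[of "?p x / pi"] floor_correct[of "?p x / pi"] unfolding m_def[symmetric]
        by (simp_all add: field_simps)
      moreover have "?p x \<noteq> of_int m * pi"
        using on_curve_if_phase_multiple[OF x0 \<alpha> _ m2] nx by blast
      ultimately have "of_int m * pi < ?p x" "?p x < of_int (m + 1) * pi" by auto
      then have "\<forall>\<^sub>F y in nhds x. of_int m * pi < ?p y" "\<forall>\<^sub>F y in nhds x. ?p y < of_int (m + 1) * pi"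
        using cont by (auto simp: isCont_def tendsto_at_iff_tendsto_nhds intro: order_tendstoD)
      then have "\<forall>\<^sub>F y in nhds x. of_int m * pi < ?p y \<and> ?p y < of_int (m + 1) * pi \<and> y \<noteq> 0"
        using t1_space_nhds[OF x0] by eventually_elim auto
      then obtain e where e: "e > 0" "\<And>y. dist y x < e \<Longrightarrow> of_int m * pi < ?p y \<and> ?p y < of_int (m +
          1) * pi \<and> y \<noteq> 0"
        by (auto simp: eventually_nhds_metric)
      have "y \<in> spiral \<alpha> \<longleftrightarrow> even m" if "dist x y < e" for y
      proof -
        have y: "of_int m * pi < ?p y" "?p y < of_int (m + 1) * pi" "y \<noteq> 0"
          using e that by (simp_all add: dist_commute)
        have "(\<exists>k::nat. 1 \<le> k \<and> 2 * pi * real k < ?p y \<and> ?p y \<le> 2 * pi * real k + pi) \<longleftrightarrow> even m"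
        proof
          assume "\<exists>k::nat. 1 \<le> k \<and> 2 * pi * real k < ?p y \<and> ?p y \<le> 2 * pi * real k + pi"
          then obtain k :: nat where k: "2 * pi * real k < ?p y" "?p y \<le> 2 * pi * real k + pi" by blast
          have "2 * pi * real k < of_int (m + 1) * pi" using k y by linarith
          then have "pi * (2 * real k) < pi * of_int (m + 1)" by (simp add: mult_ac)
          then have "of_int (2 * int k) < real_of_int (m + 1)" by simp
          then have 1: "2 * int k < m + 1" by linarith
          have "of_int m * pi < 2 * pi * real k + pi" using k y by linarith
          then have "pi * of_int m < pi * (2 * real k + 1)" by (simp add: algebra_simps)
          then have "real_of_int m < of_int (2 * int k + 1)" by simp
          then have "m < 2 * int k + 1" by linarith
          then have "m = 2 * int k" using 1 by linarith
          then show "even m" by simp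
        next
          assume "even m"
          then obtain j where j: "m = 2 * j" by blast
          then have "real (nat j) = of_int j" using m2 by simp
          then show "\<exists>k::nat. 1 \<le> k \<and> 2 * pi * real k < ?p y \<and> ?p y \<le> 2 * pi * real k + pi"
            using y j m2 by (intro exI[of _ "nat j"]) (auto simp: algebra_simps)
        qed
        then show ?thesis using spiral_iff_phase[OF y(3) \<alpha>] by simp
      qed
      then show ?thesis using e(1) by (intro exI[of _ e]) auto
    qed
    then show False using fr unfolding frontier_straddle by blast
  qed
qed

section \<open>Measure of tubes around the spiral\<close>

lemma emeasure_ball_plane_le:
  fixes a :: "real ^ 2"
  assumes "r \<ge> 0"
  shows "emeasure lebesgue (ball a r) \<le> ennreal (4 * r\<^sup>2)"
  using emeasure_ball_le[OF assms, of a] by (simp add: power_mult_distrib)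

definition tube :: "real \<Rightarrow> (real ^ 2) set \<Rightarrow> (real ^ 2) set" where
  "tube \<delta> Z = (\<Union>z\<in>Z. ball z \<delta>)"

lemma tube_Un: "tube \<delta> (Z \<union> W) = tube \<delta> Z \<union> tube \<delta> W"
  by (auto simp: tube_def)

lemma open_tube: "open (tube \<delta> Z)"
  by (auto simp: tube_def)

lemma tube_lebesgue [simp]: "tube \<delta> Z \<in> sets lebesgue"
  using borel_open[OF open_tube] by simp

text \<open>A Lipschitz curve of length \<open>l\<close> is covered by about \<open>l / \<delta> + 1\<close> balls of radius \<open>2 * \<delta>\<close>. The
  Lipschitz bound is only required on the parameters in \<open>T\<close>, because the spiral may have
  larger radius, hence larger speed, at parameters in between.\<close>

lemma emeasure_tube_lipschitz_curve:
  fixes g :: "real \<Rightarrow> real ^ 2"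
  assumes T: "T \<subseteq> {a..b}" and ab: "a \<le> b" and L: "L \<ge> 0" and \<delta>: "\<delta> > 0"
    and lip: "\<And>s t. s \<in> T \<Longrightarrow> t \<in> T \<Longrightarrow> dist (g s) (g t) \<le> L * \<bar>s - t\<bar>"
  shows "emeasure lebesgue (tube \<delta> (g ` T)) \<le> ennreal (16 * \<delta> * (2 * \<delta> + L * (b - a)))"
proof -
  define n where "n = nat \<lceil>L * (b - a) / \<delta>\<rceil> + 1"
  define h where "h = (b - a) / real n"
  have n1: "n \<ge> 1" by (simp add: n_def)
  have n_ge: "L * (b - a) / \<delta> \<le> real n"
    unfolding n_def using real_nat_ceiling_ge[of "L * (b - a) / \<delta>"] by linarith
  have "0 \<le> L * (b - a) / \<delta>" using L ab \<delta> by simp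
  then have n_le: "real n \<le> L * (b - a) / \<delta> + 2"
    unfolding n_def using ceiling_correct[of "L * (b - a) / \<delta>"] by (simp add: of_nat_nat)
  have Lh: "L * h \<le> \<delta>"
    using n_ge n1 \<delta> by (simp add: h_def field_simps)
  \<comment> \<open>The parameters are divided into \<open>n\<close> intervals on each of which the curve moves by at
    most \<open>\<delta>\<close>, and one parameter of \<open>T\<close> is chosen in each interval that meets \<open>T\<close>.\<close>
  define J where "J = (\<lambda>k. T \<inter> {a + real k * h .. a + real (k + 1) * h})"
  define node where "node = (\<lambda>k. SOME t. t \<in> J k)"
  have "tube \<delta> (g ` T) \<subseteq> (\<Union>k\<in>{..<n}. ball (g (node k)) (2 * \<delta>))"
  proof
    fix x assume "x \<in> tube \<delta> (g ` T)"
    then obtain t where t: "t \<in> T" "dist (g t) x < \<delta>" by (auto simp: tube_def)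
    have tab: "a \<le> t" "t \<le> b" using t T by auto
    have "\<exists>k<n. t \<in> J k"
    proof (cases "t = b")
      case True
      have "b = a + real n * h" using n1 by (simp add: h_def)
      moreover have "h \<ge> 0" using ab by (simp add: h_def)
      moreover have "real (n - 1 + 1) = real n" "real (n - 1) * h \<le> real n * h"
        using n1 \<open>h \<ge> 0\<close> by (auto intro: mult_right_mono)
      ultimately have "b \<in> {a + real (n - 1) * h .. a + real (n - 1 + 1) * h}"
        by simp
      then show ?thesis using t True n1 by (intro exI[of _ "n - 1"]) (auto simp: J_def)
    next
      case False
      then have h0: "h > 0" using tab n1 by (simp add: h_def)
      define k where "k = nat \<lfloor>(t - a) / h\<rfloor>"
      have "0 \<le> (t - a) / h" using tab h0 by simp
      then have k: "real k \<le> (t - a) / h" "(t - a) / h < real k + 1"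
        by (simp_all add: k_def of_nat_nat)
      have "(t - a) / h < (b - a) / h" using False tab h0 by (intro divide_strict_right_mono) auto
      also have "(b - a) / h = real n" using False tab n1 by (simp add: h_def)
      finally have "real k < real n" using k by linarith
      moreover have "t \<in> J k" using k t h0 by (auto simp: J_def field_simps)
      ultimately show ?thesis by auto
    qed
    then obtain k where k: "k < n" "t \<in> J k" by blast
    then have nk: "node k \<in> J k" unfolding node_def by (metis someI)
    have "\<bar>node k - t\<bar> \<le> h" using nk k by (auto simp: J_def algebra_simps abs_le_iff)
    then have "L * \<bar>node k - t\<bar> \<le> \<delta>" using mult_left_mono[of "\<bar>node k - t\<bar>" h L] L Lh by linarith
    moreover have "dist (g (node k)) (g t) \<le> L * \<bar>node k - t\<bar>" using nk k by (intro lip) (auto simp: J_def)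
    ultimately have "dist (g (node k)) x < 2 * \<delta>"
      using dist_triangle[of "g (node k)" x "g t"] t by linarith
    then show "x \<in> (\<Union>k\<in>{..<n}. ball (g (node k)) (2 * \<delta>))" using k by auto
  qed
  then have "emeasure lebesgue (tube \<delta> (g ` T)) \<le> emeasure lebesgue (\<Union>k\<in>{..<n}. ball (g (node k)) (2 * \<delta>))"
    by (rule emeasure_mono) (intro fmeasurableD fmeasurable.finite_UN, auto)
  also have "\<dots> \<le> (\<Sum>k\<in>{..<n}. emeasure lebesgue (ball (g (node k)) (2 * \<delta>)))"
    by (rule emeasure_subadditive_finite) auto
  also have "\<dots> \<le> (\<Sum>k\<in>{..<n}. ennreal (4 * (2 * \<delta>)\<^sup>2))"
    by (intro sum_mono emeasure_ball_plane_le) (use \<delta> in auto)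
  also have "\<dots> = ennreal (real n * (16 * \<delta>\<^sup>2))"
    by (simp add: power_mult_distrib ennreal_mult ennreal_of_nat_eq_real_of_nat)
  also have "\<dots> \<le> ennreal (16 * \<delta> * (2 * \<delta> + L * (b - a)))"
  proof (rule ennreal_leI)
    have "real n * (16 * \<delta>\<^sup>2) \<le> (L * (b - a) / \<delta> + 2) * (16 * \<delta>\<^sup>2)"
      using n_le by (intro mult_right_mono) auto
    also have "\<dots> = 16 * \<delta> * (2 * \<delta> + L * (b - a))"
      using \<delta> by (simp add: field_simps power2_eq_square)
    finally show "real n * (16 * \<delta>\<^sup>2) \<le> 16 * \<delta> * (2 * \<delta> + L * (b - a))" .
  qed
  finally show ?thesis .
qed

lemma sin_ge_two_over_pi:
  assumes "0 \<le> x" "x \<le> pi / 2"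
  shows "2 * x / pi \<le> sin x"
proof -
  have "convex_on {0..pi / 2} (\<lambda>x. - sin x)"
  proof (rule convex_on_realI)
    show "((\<lambda>x. - sin x) has_real_derivative (- cos x)) (at x)" for x :: real
      by (auto intro!: derivative_eq_intros)
    show "- cos x \<le> - cos y" if "x \<in> {0..pi / 2}" "y \<in> {0..pi / 2}" "x \<le> y" for x y :: real
      using that cos_monotone_0_pi_le[of x y] by simp
  qed auto
  from convex_onD[OF this, of "2 * x / pi" 0 "pi / 2"] show ?thesis
    using assms by (simp add: field_simps)
qed

text \<open>Points at distance at most \<open>D\<close> from each other, one of which has radius \<open>r\<close>, differ in angle
  by at most a multiple of \<open>D / r\<close>, up to full turns.\<close>

lemma cis_close_imp_angle_close:
  assumes r: "r > 0" "R \<ge> 0" and D: "norm (of_real R * cis s - of_real r * cis t) \<le> D"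
  obtains m :: int where "\<bar>s - t - 2 * pi * of_int m\<bar> \<le> pi * D / r" "\<bar>s - t - 2 * pi * of_int m\<bar> \<le> pi"
proof -
  have "\<bar>R - r\<bar> \<le> D"
    using norm_triangle_ineq3[of "of_real R * cis s" "of_real r * cis t"] r D by (simp add: norm_mult)
  moreover have "norm (of_real r * cis s - of_real r * cis t) \<le>
      norm (of_real R * cis s - of_real r * cis t) + norm (of_real (R - r) * cis s)"
    using norm_triangle_ineq4[of "of_real R * cis s - of_real r * cis t" "of_real (R - r) * cis s"]
    by (simp add: algebra_simps)
  ultimately have "norm (of_real r * cis s - of_real r * cis t) \<le> 2 * D"
    using D by (simp add: norm_mult flip: of_real_diff)
  then have *: "r * norm (cis s - cis t) \<le> 2 * D"
    using r by (simp add: norm_mult flip: right_diff_distrib)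
  define m where "m = \<lfloor>(s - t + pi) / (2 * pi)\<rfloor>"
  define u where "u = s - t - 2 * pi * of_int m"
  have "of_int m \<le> (s - t + pi) / (2 * pi)" "(s - t + pi) / (2 * pi) < of_int m + 1"
    unfolding m_def by linarith+
  then have u: "- pi \<le> u" "u \<le> pi"
    using pi_gt_zero unfolding u_def by (simp_all add: field_simps)
  have "cis s = cis t * cis u"
    using cis_multiple_2pi[of "of_int m"] cis_mult[of "t + u" "2 * pi * of_int m"]
    by (simp add: u_def cis_mult)
  then have "cis s - cis t = cis t * (cis u - 1)" by (simp add: algebra_simps)
  then have "norm (cis s - cis t) = norm (cis u - 1)" by (simp add: norm_mult)
  also have "\<dots> = 2 * \<bar>sin (u / 2)\<bar>"
    using dist_exp_i_1[of u] by (simp add: cis_conv_exp)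
  finally have n: "norm (cis s - cis t) = 2 * \<bar>sin (u / 2)\<bar>" .
  have "\<bar>u\<bar> / pi \<le> \<bar>sin (u / 2)\<bar>"
  proof -
    have "2 * (\<bar>u\<bar> / 2) / pi \<le> sin (\<bar>u\<bar> / 2)"
      using u by (intro sin_ge_two_over_pi) auto
    moreover have "\<bar>sin (u / 2)\<bar> = \<bar>sin (\<bar>u\<bar> / 2)\<bar>" by (cases "u \<ge> 0") auto
    ultimately show ?thesis by simp
  qed
  then have "r * (2 * (\<bar>u\<bar> / pi)) \<le> r * norm (cis s - cis t)"
    unfolding n using r by (intro mult_left_mono) auto
  then have "r * (2 * (\<bar>u\<bar> / pi)) \<le> 2 * D" using * by linarith
  then have "r * \<bar>u\<bar> \<le> pi * D" using pi_gt_zero by (simp add: field_simps)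
  then have "\<bar>u\<bar> \<le> pi * D / r" using r by (simp add: field_simps)
  then show ?thesis using that[of m] u unfolding u_def by (simp add: abs_le_iff)
qed

lemma powr_neg_lipschitz:
  fixes x y a \<beta> :: real
  assumes "a > 0" "\<beta> > 0" "a \<le> x" "a \<le> y"
  shows "\<bar>x powr (- \<beta>) - y powr (- \<beta>)\<bar> \<le> \<beta> * a powr (- \<beta> - 1) * \<bar>x - y\<bar>"
proof -
  have main: "\<bar>x powr (- \<beta>) - y powr (- \<beta>)\<bar> \<le> \<beta> * a powr (- \<beta> - 1) * \<bar>x - y\<bar>"
    if xy: "x < y" "a \<le> x" for x y
  proof -
    have "\<exists>z>x. z < y \<and> y powr (- \<beta>) - x powr (- \<beta>) = (y - x) * (- \<beta> * z powr (- \<beta> - 1))"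
      using xy assms(1) by (intro MVT2) (auto intro!: derivative_eq_intros simp: powr_diff)
    then obtain z where z: "x < z" "z < y"
      "y powr (- \<beta>) - x powr (- \<beta>) = (y - x) * (- \<beta> * z powr (- \<beta> - 1))" by blast
    have "z powr (- \<beta> - 1) \<le> a powr (- \<beta> - 1)"
      using z xy assms by (intro powr_mono2') auto
    then have "\<beta> * z powr (- \<beta> - 1) * \<bar>x - y\<bar> \<le> \<beta> * a powr (- \<beta> - 1) * \<bar>x - y\<bar>"
      using assms by (intro mult_right_mono mult_left_mono) auto
    moreover have "\<bar>x powr (- \<beta>) - y powr (- \<beta>)\<bar> = \<beta> * z powr (- \<beta> - 1) * \<bar>x - y\<bar>"
    proof -
      have "\<bar>x powr (- \<beta>) - y powr (- \<beta>)\<bar> = \<bar>y powr (- \<beta>) - x powr (- \<beta>)\<bar>" by simp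
      also have "\<dots> = \<beta> * z powr (- \<beta> - 1) * \<bar>x - y\<bar>"
        unfolding z(3) using xy assms by (simp add: abs_mult)
      finally show ?thesis .
    qed
    ultimately show ?thesis by simp
  qed
  consider "x < y" | "x = y" | "y < x" by linarith
  then show ?thesis
    using main[of x y] main[of y x] assms by cases (auto simp: abs_minus_commute)
qed

lemma spiral_curve_lipschitz:
  assumes \<alpha>: "\<alpha> > 0" and \<sigma>: "\<bar>\<sigma>\<bar> = 1" and st: "s \<ge> 1" "t \<ge> 1"
    and M: "s powr (- \<alpha>) \<le> M" "t powr (- \<alpha>) \<le> M"
  shows "dist (spiral_curve \<alpha> \<sigma> s) (spiral_curve \<alpha> \<sigma> t) \<le> (1 + \<alpha>) * M * \<bar>s - t\<bar>"
proof -
  define a where "a = min s t"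
  have a: "a \<ge> 1" "a \<le> s" "a \<le> t" using st by (auto simp: a_def)
  have "a powr (- \<alpha> - 1) \<le> a powr (- \<alpha>)" using a by (intro powr_mono) auto
  also have "\<dots> \<le> M" using M by (auto simp: a_def min_def)
  finally have aM: "a powr (- \<alpha> - 1) \<le> M" .
  have "\<bar>s powr (- \<alpha>) - t powr (- \<alpha>)\<bar> \<le> \<alpha> * a powr (- \<alpha> - 1) * \<bar>s - t\<bar>"
    using a \<alpha> by (intro powr_neg_lipschitz) auto
  also have "\<dots> \<le> \<alpha> * M * \<bar>s - t\<bar>" using aM \<alpha> by (intro mult_right_mono mult_left_mono) auto
  finally have 1: "\<bar>s powr (- \<alpha>) - t powr (- \<alpha>)\<bar> \<le> \<alpha> * M * \<bar>s - t\<bar>" .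
  have "cis s = cis t * cis (s - t)" by (simp add: cis_mult)
  then have "norm (cis s - cis t) = norm (cis t * (cis (s - t) - 1))" by (simp add: algebra_simps)
  also have "\<dots> = 2 * \<bar>sin ((s - t) / 2)\<bar>"
    using dist_exp_i_1[of "s - t"] by (simp add: norm_mult cis_conv_exp)
  also have "\<dots> \<le> \<bar>s - t\<bar>" using abs_sin_x_le_abs_x[of "(s - t) / 2"] by simp
  finally have 2: "norm (cis s - cis t) \<le> \<bar>s - t\<bar>" .
  have "dist (spiral_curve \<alpha> \<sigma> s) (spiral_curve \<alpha> \<sigma> t) =
      norm (of_real \<sigma> * (of_real (s powr (- \<alpha>) - t powr (- \<alpha>)) * cis s + of_real (t powr (- \<alpha>)) *
          (cis s - cis t)))"
    by (simp add: dist_norm spiral_curve_def flip: vec_of_complex_diff) (simp add: algebra_simps)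
  also have "\<dots> \<le> \<bar>s powr (- \<alpha>) - t powr (- \<alpha>)\<bar> + t powr (- \<alpha>) * norm (cis s - cis t)"
    using \<sigma> norm_triangle_ineq[of "of_real (s powr (- \<alpha>) - t powr (- \<alpha>)) * cis s" "of_real (t powr
        (- \<alpha>)) * (cis s - cis t)"]
    by (simp add: norm_mult del: of_real_diff)
  also have "\<dots> \<le> \<alpha> * M * \<bar>s - t\<bar> + M * \<bar>s - t\<bar>"
    using 1 2 M by (intro add_mono mult_mono) (auto intro: order_trans[OF powr_ge_zero])
  also have "\<dots> = (1 + \<alpha>) * M * \<bar>s - t\<bar>" by (simp add: algebra_simps)
  finally show ?thesis .
qed

text \<open>The turns of the spiral that meet a set of diameter \<open>D\<close> at distance about \<open>\<rho>\<close> from the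
  origin have radii in an interval of length about \<open>D\<close>, so there are at most about
  \<open>1 + D * \<rho> powr (- 1 / \<alpha> - 1)\<close> of them. Each turn meets the set in an angle of size \<open>D / \<rho>\<close>,
  hence in an arc of length about \<open>D\<close>.\<close>

lemma emeasure_tube_spiral_curve_annulus:
  assumes \<alpha>: "\<alpha> > 0"
  obtains C where "C > 0"
    "\<And>\<rho> D \<delta> S \<sigma>. 0 < \<rho> \<Longrightarrow> 0 < \<delta> \<Longrightarrow> \<delta> \<le> \<rho> \<Longrightarrow> \<delta> \<le> D \<Longrightarrow> \<bar>\<sigma>\<bar> = 1 \<Longrightarrow>
       (\<And>x. x \<in> S \<Longrightarrow> 2 * \<rho> \<le> norm x \<and> norm x \<le> 8 * \<rho>) \<Longrightarrow>
       (\<And>x y. x \<in> S \<Longrightarrow> y \<in> S \<Longrightarrow> dist x y \<le> D) \<Longrightarrow>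
       emeasure lebesgue (S \<inter> tube \<delta> (spiral_curve \<alpha> \<sigma> ` {2 * pi..})) \<le>
         ennreal (C * \<delta> * D * (1 + D * \<rho> powr (- 1 / \<alpha> - 1)))"
proof -
  \<comment> \<open>\<open>C1 * \<delta> * D\<close> is the contribution of one turn, and \<open>5 + 6 / \<alpha>\<close> accounts for the number
    of turns.\<close>
  define C1 where "C1 = 16 * (2 + 216 * (1 + \<alpha>))"
  define C where "C = C1 * (5 + 6 / \<alpha>)"
  have C1: "C1 > 0" using \<alpha> by (simp add: C1_def add_pos_pos)
  have C: "C > 0" using C1 \<alpha> by (simp add: C_def add_pos_pos)
  have "emeasure lebesgue (S \<inter> tube \<delta> (spiral_curve \<alpha> \<sigma> ` {2 * pi..})) \<le>
         ennreal (C * \<delta> * D * (1 + D * \<rho> powr (- 1 / \<alpha> - 1)))"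
    if \<rho>: "0 < \<rho>" and \<delta>: "0 < \<delta>" "\<delta> \<le> \<rho>" "\<delta> \<le> D" and \<sigma>: "\<bar>\<sigma>\<bar> = 1"
      and ann: "\<And>x. x \<in> S \<Longrightarrow> 2 * \<rho> \<le> norm x \<and> norm x \<le> 8 * \<rho>"
      and diam: "\<And>x y. x \<in> S \<Longrightarrow> y \<in> S \<Longrightarrow> dist x y \<le> D" for \<rho> D \<delta> S \<sigma>
  proof -
    let ?g = "spiral_curve \<alpha> \<sigma>"
    define T where "T = {t. 2 * pi \<le> t \<and> (\<exists>x\<in>S. dist (?g t) x < \<delta>)}"
    have sub: "S \<inter> tube \<delta> (?g ` {2 * pi..}) \<subseteq> tube \<delta> (?g ` T)"
      unfolding tube_def T_def by (auto simp: image_iff) blast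
    have D: "D > 0" using \<delta> by linarith
    show ?thesis
    proof (cases "T = {}")
      case True
      then have "S \<inter> tube \<delta> (?g ` {2 * pi..}) = {}" using sub by (auto simp: tube_def)
      then show ?thesis by simp
    next
      case False
      then obtain t0 where t0: "t0 \<in> T" by blast
      have T1: "1 \<le> t" if "t \<in> T" for t using that pi_gt3 by (auto simp: T_def)
      have rad: "\<rho> \<le> t powr (- \<alpha>) \<and> t powr (- \<alpha>) \<le> 9 * \<rho>" if "t \<in> T" for t
      proof -
        obtain x where x: "x \<in> S" "dist (?g t) x < \<delta>" using \<open>t \<in> T\<close> by (auto simp: T_def)
        have "\<bar>norm (?g t) - norm x\<bar> \<le> dist (?g t) x" unfolding dist_norm by (rule norm_triangle_ineq3)
        then show ?thesis using ann[OF x(1)] x(2) \<delta> norm_spiral_curve[OF \<sigma>, of \<alpha> t] by linarith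
      qed
      have dT: "dist (?g t) (?g t0) \<le> 3 * D" if "t \<in> T" for t
      proof -
        obtain x where x: "x \<in> S" "dist (?g t) x < \<delta>" using \<open>t \<in> T\<close> by (auto simp: T_def)
        obtain y where y: "y \<in> S" "dist (?g t0) y < \<delta>" using t0 by (auto simp: T_def)
        have "dist (?g t) (?g t0) \<le> dist (?g t) x + dist x y + dist y (?g t0)"
          using dist_triangle[of "?g t" "?g t0" x] dist_triangle[of x "?g t0" y] by linarith
        then show ?thesis using x y diam[OF x(1) y(1)] \<delta> by (simp add: dist_commute)
      qed
      \<comment> \<open>\<open>T\<close> lies within distance \<open>W\<close> of \<open>t0\<close>, as the radii differ by at most \<open>3 * D\<close>;
        modulo \<open>2 * pi\<close> it lies within distance \<open>w\<close> of \<open>t0\<close>, as the points do.\<close>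
      define W where "W = 1 / \<alpha> * \<rho> powr (- 1 / \<alpha> - 1) * (3 * D)"
      have W0: "W \<ge> 0" using \<alpha> D by (simp add: W_def)
      have width: "\<bar>t - t0\<bar> \<le> W" if t: "t \<in> T" for t
      proof -
        have inv: "(u powr (- \<alpha>)) powr (- (1 / \<alpha>)) = u" if "u \<in> T" for u
          using T1[OF that] \<alpha> by (simp add: powr_powr)
        have "\<bar>(t powr (- \<alpha>)) powr (- (1 / \<alpha>)) - (t0 powr (- \<alpha>)) powr (- (1 / \<alpha>))\<bar>
            \<le> 1 / \<alpha> * \<rho> powr (- (1 / \<alpha>) - 1) * \<bar>t powr (- \<alpha>) - t0 powr (- \<alpha>)\<bar>"
          using \<rho> \<alpha> rad[OF t] rad[OF t0] by (intro powr_neg_lipschitz) auto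
        also have "\<dots> \<le> 1 / \<alpha> * \<rho> powr (- (1 / \<alpha>) - 1) * (3 * D)"
        proof (rule mult_left_mono)
          have "\<bar>t powr (- \<alpha>) - t0 powr (- \<alpha>)\<bar> \<le> dist (?g t) (?g t0)"
            using norm_triangle_ineq3[of "?g t" "?g t0"] norm_spiral_curve[OF \<sigma>, of \<alpha>]
                by (simp add: dist_norm)
          also have "\<dots> \<le> 3 * D" by (rule dT[OF t])
          finally show "\<bar>t powr (- \<alpha>) - t0 powr (- \<alpha>)\<bar> \<le> 3 * D" .
        qed (use \<alpha> in simp)
        finally show ?thesis
          using inv[OF t] inv[OF t0] by (simp add: W_def)
      qed
      define w where "w = pi * (3 * D) / \<rho>"
      have w: "w \<ge> 0" using D \<rho> by (simp add: w_def)
      have turn: "\<exists>m::int. \<bar>t - t0 - 2 * pi * of_int m\<bar> \<le> w \<and> \<bar>t - t0 - 2 * pi * of_int m\<bar>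
          \<le> pi" if t: "t \<in> T" for t
      proof -
        have "norm (of_real (t powr (- \<alpha>)) * cis t - of_real (t0 powr (- \<alpha>)) * cis t0) =
            norm (of_real \<sigma> * (of_real (t powr (- \<alpha>)) * cis t - of_real (t0 powr (- \<alpha>)) * cis t0))"
          using \<sigma> by (simp add: norm_mult)
        also have "\<dots> = dist (?g t) (?g t0)"
          by (simp add: dist_norm spiral_curve_def algebra_simps flip: vec_of_complex_diff)
        finally have n: "norm (of_real (t powr (- \<alpha>)) * cis t - of_real (t0 powr (- \<alpha>)) * cis t0) \<le> 3 * D"
          using dT[OF t] by simp
        have r0: "t0 powr (- \<alpha>) > 0" using rad[OF t0] \<rho> by linarith
        obtain m :: int where m: "\<bar>t - t0 - 2 * pi * of_int m\<bar> \<le> pi * (3 * D) / t0 powr (- \<alpha>)"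
            "\<bar>t - t0 - 2 * pi * of_int m\<bar> \<le> pi"
          using cis_close_imp_angle_close[OF r0 _ n] by auto
        have "pi * (3 * D) / t0 powr (- \<alpha>) \<le> w"
          unfolding w_def using rad[OF t0] D by (intro divide_left_mono mult_pos_pos r0 \<rho>) auto
        then show ?thesis using m by force
      qed
      define N where "N = \<lceil>W\<rceil> + 1"
      define J where "J = (\<lambda>m::int. T \<inter> {t0 + 2 * pi * of_int m - w .. t0 + 2 * pi * of_int m + w})"
      have "T \<subseteq> (\<Union>m\<in>{- N..N}. J m)"
      proof
        fix t assume t: "t \<in> T"
        obtain m :: int where m: "\<bar>t - t0 - 2 * pi * of_int m\<bar> \<le> w" "\<bar>t - t0 - 2 * pi * of_int m\<bar> \<le> pi"
          using turn[OF t] by blast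
        have "\<bar>2 * pi * of_int m\<bar> \<le> W + pi" using m(2) width[OF t] by linarith
        then have mW: "2 * pi * \<bar>real_of_int m\<bar> \<le> W + pi" by (simp add: abs_mult)
        have "\<bar>real_of_int m\<bar> \<le> W + 1"
        proof (rule ccontr)
          assume "\<not> ?thesis"
          then have "2 * pi * (W + 1) < 2 * pi * \<bar>real_of_int m\<bar>" using pi_gt_zero by simp
          moreover have "W * 1 \<le> W * (2 * pi)" using W0 pi_gt3 by (intro mult_left_mono) auto
          ultimately show False using mW pi_gt3 by (simp add: algebra_simps)
        qed
        then have "\<bar>m\<bar> \<le> N" unfolding N_def using ceiling_correct[of W] by linarith
        then show "t \<in> (\<Union>m\<in>{- N..N}. J m)" using t m(1) by (auto simp: J_def abs_le_iff intro!:
            bexI[of _ m])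
      qed
      then have "tube \<delta> (?g ` T) \<subseteq> (\<Union>m\<in>{- N..N}. tube \<delta> (?g ` J m))"
        by (fastforce simp: tube_def)
      then have "emeasure lebesgue (S \<inter> tube \<delta> (?g ` {2 * pi..}))
          \<le> emeasure lebesgue (\<Union>m\<in>{- N..N}. tube \<delta> (?g ` J m))"
        using sub by (intro emeasure_mono) auto
      also have "\<dots> \<le> (\<Sum>m\<in>{- N..N}. emeasure lebesgue (tube \<delta> (?g ` J m)))"
        by (rule emeasure_subadditive_finite) auto
      also have "\<dots> \<le> (\<Sum>m\<in>{- N..N}. ennreal (C1 * \<delta> * D))"
      proof (rule sum_mono)
        fix m
        have "emeasure lebesgue (tube \<delta> (?g ` J m)) \<le> ennreal (16 * \<delta> * (2 * \<delta> + (1 + \<alpha>) * (9 * \<rho>) *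
            ((t0 + 2 * pi * of_int m + w) - (t0 + 2 * pi * of_int m - w))))"
        proof (rule emeasure_tube_lipschitz_curve)
          show "dist (?g s) (?g t) \<le> (1 + \<alpha>) * (9 * \<rho>) * \<bar>s - t\<bar>" if "s \<in> J m" "t \<in> J m" for s t
            using that T1 rad by (intro spiral_curve_lipschitz \<alpha> \<sigma>) (auto simp: J_def)
        qed (use w \<delta> \<alpha> \<rho> in \<open>auto simp: J_def\<close>)
        also have "16 * \<delta> * (2 * \<delta> + (1 + \<alpha>) * (9 * \<rho>) *
            ((t0 + 2 * pi * of_int m + w) - (t0 + 2 * pi * of_int m - w))) =
            16 * \<delta> * (2 * \<delta> + 54 * (1 + \<alpha>) * pi * D)"
          using \<rho> by (simp add: w_def field_simps)
        also have "\<dots> \<le> 16 * \<delta> * (2 * D + 54 * (1 + \<alpha>) * 4 * D)"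
          using \<delta> \<alpha> D pi_less_4 by (intro mult_left_mono add_mono mult_right_mono) auto
        also have "\<dots> = C1 * \<delta> * D" by (simp add: C1_def algebra_simps)
        finally show "emeasure lebesgue (tube \<delta> (?g ` J m)) \<le> ennreal (C1 * \<delta> * D)"
          by (simp add: ennreal_leI)
      qed
      also have "\<dots> = ennreal (real (card {- N..N}) * (C1 * \<delta> * D))"
        using C1 \<delta> D by (simp add: ennreal_mult ennreal_of_nat_eq_real_of_nat)
      also have "\<dots> \<le> ennreal (C * \<delta> * D * (1 + D * \<rho> powr (- 1 / \<alpha> - 1)))"
      proof (rule ennreal_leI)
        have "real (card {- N..N}) \<le> 2 * W + 5"
          using W0 ceiling_correct[of W] by (simp add: N_def)
        also have "\<dots> = 5 + 6 / \<alpha> * (D * \<rho> powr (- 1 / \<alpha> - 1))" by (simp add: W_def)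
        also have "\<dots> \<le> (5 + 6 / \<alpha>) * (1 + D * \<rho> powr (- 1 / \<alpha> - 1))"
          using \<alpha> D by (simp add: algebra_simps)
        finally have "real (card {- N..N}) * (C1 * \<delta> * D) \<le>
            (5 + 6 / \<alpha>) * (1 + D * \<rho> powr (- 1 / \<alpha> - 1)) * (C1 * \<delta> * D)"
          using C1 \<delta> D by (intro mult_right_mono) auto
        also have "\<dots> = C * \<delta> * D * (1 + D * \<rho> powr (- 1 / \<alpha> - 1))"
          by (simp add: C_def mult_ac)
        finally show "real (card {- N..N}) * (C1 * \<delta> * D) \<le> C * \<delta> * D * (1 + D * \<rho> powr (- 1 / \<alpha> - 1))" .
      qed
      finally show ?thesis .
    qed
  qed
  then show ?thesis using that C by blast
qed

lemma tube_spiral_curve_bounded: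
  assumes \<alpha>: "\<alpha> > 0" and \<sigma>: "\<bar>\<sigma>\<bar> = 1" and \<delta>: "\<delta> \<le> 1"
  shows "tube \<delta> (spiral_curve \<alpha> \<sigma> ` {2 * pi..}) \<subseteq> ball 0 2"
proof
  fix x assume "x \<in> tube \<delta> (spiral_curve \<alpha> \<sigma> ` {2 * pi..})"
  then obtain t where t: "2 * pi \<le> t" "dist (spiral_curve \<alpha> \<sigma> t) x < \<delta>" by (auto simp: tube_def)
  have "norm (spiral_curve \<alpha> \<sigma> t) = t powr (- \<alpha>)" by (rule norm_spiral_curve[OF \<sigma>])
  also have "\<dots> \<le> (2 * pi) powr (- \<alpha>)" using t \<alpha> by (intro powr_mono2') auto
  also have "\<dots> < 1" by (rule norm_spiral_less_1(2)[OF \<alpha>])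
  finally have "norm (spiral_curve \<alpha> \<sigma> t) < 1" .
  moreover have "norm x \<le> norm (spiral_curve \<alpha> \<sigma> t) + dist (spiral_curve \<alpha> \<sigma> t) x"
    using norm_triangle_sub[of x "spiral_curve \<alpha> \<sigma> t"] by (simp add: dist_norm norm_minus_commute)
  ultimately show "x \<in> ball 0 2" using t \<delta> by simp
qed

lemma emeasure_subset_ball_le:
  fixes a :: "real ^ 2"
  assumes "r \<ge> 0" "X \<subseteq> ball a r"
  shows "emeasure lebesgue X \<le> ennreal (4 * r\<^sup>2)"
  using emeasure_mono[OF assms(2), of lebesgue] emeasure_ball_plane_le[OF assms(1), of a]
  by (simp add: order_trans)

text \<open>Up to constants, the measure of the tube in the annulus of radius \<open>\<rho>\<close> is at most that of the
  annulus, and at most \<open>\<delta>\<close> times the length of the curve there. Interpolating between these two bounds with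
  weight \<open>s\<close> gives a single power law for all \<open>\<rho>\<close>.\<close>

lemma emeasure_tube_spiral_curve_dyadic_annulus:
  assumes \<alpha>: "\<alpha> > 0"
  obtains C where "C > 0"
    "\<And>\<rho> \<delta> \<sigma> s. 0 < \<rho> \<Longrightarrow> 0 < \<delta> \<Longrightarrow> \<delta> \<le> 1 \<Longrightarrow> \<bar>\<sigma>\<bar> = 1 \<Longrightarrow> 0 \<le> s \<Longrightarrow> s \<le> 1 \<Longrightarrow>
       emeasure lebesgue ({x. 2 * \<rho> \<le> norm x \<and> norm x \<le> 4 * \<rho>} \<inter> tube \<delta> (spiral_curve \<alpha> \<sigma> ` {2 * pi..})) \<le>
         ennreal (C * \<delta> powr s * \<rho> powr (2 - s * (1 + 1 / \<alpha>)))"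
proof (rule emeasure_tube_spiral_curve_annulus[OF \<alpha>])
  fix C0 :: real assume C0: "C0 > 0"
    "\<And>\<rho> D \<delta> S \<sigma>. 0 < \<rho> \<Longrightarrow> 0 < \<delta> \<Longrightarrow> \<delta> \<le> \<rho> \<Longrightarrow> \<delta> \<le> D \<Longrightarrow> \<bar>\<sigma>\<bar> = 1 \<Longrightarrow>
       (\<And>x. x \<in> S \<Longrightarrow> 2 * \<rho> \<le> norm x \<and> norm x \<le> 8 * \<rho>) \<Longrightarrow>
       (\<And>x y. x \<in> S \<Longrightarrow> y \<in> S \<Longrightarrow> dist x y \<le> D) \<Longrightarrow>
       emeasure lebesgue (S \<inter> tube \<delta> (spiral_curve \<alpha> \<sigma> ` {2 * pi..})) \<le>
         ennreal (C0 * \<delta> * D * (1 + D * \<rho> powr (- 1 / \<alpha> - 1)))"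
  define C where "C = 100 + 72 * C0"
  have C: "C > 0" using C0 by (simp add: C_def)
  have "emeasure lebesgue ({x. 2 * \<rho> \<le> norm x \<and> norm x \<le> 4 * \<rho>} \<inter> tube \<delta> (spiral_curve \<alpha> \<sigma> ` {2 * pi..})) \<le>
         ennreal (C * \<delta> powr s * \<rho> powr (2 - s * (1 + 1 / \<alpha>)))"
    if \<rho>: "0 < \<rho>" and \<delta>: "0 < \<delta>" "\<delta> \<le> 1" and \<sigma>: "\<bar>\<sigma>\<bar> = 1" and s: "0 \<le> s" "s \<le> 1" for \<rho> \<delta> \<sigma> s
  proof -
    let ?X = "{x. 2 * \<rho> \<le> norm x \<and> norm x \<le> 4 * \<rho>} \<inter> tube \<delta> (spiral_curve \<alpha> \<sigma> ` {2 * pi..})"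
    show ?thesis
    proof (cases "\<rho> \<le> 1")
      case False
      then have "?X = {}" using tube_spiral_curve_bounded[OF \<alpha> \<sigma> \<delta>(2)] by fastforce
      then show ?thesis by simp
    next
      case True
      \<comment> \<open>\<open>Y\<close> is the width of the tube times the length of the curve.\<close>
      define Y where "Y = \<delta> * \<rho> powr (1 - 1 / \<alpha>)"
      have Y: "Y > 0" using \<rho> \<delta> by (simp add: Y_def)
      have \<rho>Y: "\<rho> * \<delta> \<le> Y"
      proof -
        have "\<rho> powr 1 \<le> \<rho> powr (1 - 1 / \<alpha>)"
          using \<rho> True \<alpha> by (intro powr_mono') auto
        then show ?thesis using \<rho> \<delta> by (simp add: Y_def mult.commute)
      qed
      have triv: "emeasure lebesgue ?X \<le> ennreal (C * \<rho>\<^sup>2)"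
      proof -
        have "emeasure lebesgue ?X \<le> ennreal (4 * (5 * \<rho>)\<^sup>2)"
          using \<rho> by (intro emeasure_subset_ball_le[of _ _ 0]) auto
        also have "\<dots> \<le> ennreal (C * \<rho>\<^sup>2)"
          using C0(1) by (intro ennreal_leI) (auto simp: C_def power_mult_distrib intro!: mult_right_mono)
        finally show ?thesis .
      qed
      have len: "emeasure lebesgue ?X \<le> ennreal (C * Y)"
      proof (cases "\<delta> \<le> \<rho>")
        case False
        then have "\<rho>\<^sup>2 \<le> \<rho> * \<delta>" using \<rho> by (simp add: power2_eq_square)
        then have "C * \<rho>\<^sup>2 \<le> C * Y" using \<rho>Y C by (intro mult_left_mono) auto
        from order_trans[OF triv ennreal_leI[OF this]] show ?thesis .
      next
        case True
        have *: "emeasure lebesgue ?X \<le> ennreal (C0 * \<delta> * (8 * \<rho>) * (1 + (8 * \<rho>) * \<rho> powr (- 1 / \<alpha> - 1)))"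
        proof (rule C0(2)[OF \<rho> \<delta>(1) True _ \<sigma>])
          show "dist x y \<le> 8 * \<rho>" if "x \<in> {x. 2 * \<rho> \<le> norm x \<and> norm x \<le> 4 * \<rho>}" "y \<in> {x. 2 * \<rho>
              \<le> norm x \<and> norm x \<le> 4 * \<rho>}" for x y :: "real ^ 2"
            using that norm_triangle_ineq4[of x y] by (simp add: dist_norm)
        qed (use \<rho> True in auto)
        have "C0 * \<delta> * (8 * \<rho>) * (1 + (8 * \<rho>) * \<rho> powr (- 1 / \<alpha> - 1)) =
            8 * C0 * (\<rho> * \<delta>) + 64 * C0 * (\<delta> * (\<rho> powr 2 * \<rho> powr (- 1 / \<alpha> - 1)))"
          using \<rho> by (simp add: algebra_simps power2_eq_square)
        also have "\<rho> powr 2 * \<rho> powr (- 1 / \<alpha> - 1) = \<rho> powr (1 - 1 / \<alpha>)"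
          by (subst powr_add[symmetric]) simp
        also have "8 * C0 * (\<rho> * \<delta>) + 64 * C0 * (\<delta> * \<rho> powr (1 - 1 / \<alpha>)) \<le> 8 * C0 * Y + 64 * C0 * Y"
          using \<rho>Y C0(1) by (intro add_mono mult_left_mono) (auto simp: Y_def)
        also have "\<dots> \<le> C * Y" using Y by (simp add: C_def distrib_right)
        finally have "C0 * \<delta> * (8 * \<rho>) * (1 + (8 * \<rho>) * \<rho> powr (- 1 / \<alpha> - 1)) \<le> C * Y" .
        from order_trans[OF * ennreal_leI[OF this]] show ?thesis .
      qed
      have "min (\<rho>\<^sup>2) Y \<le> (\<rho>\<^sup>2) powr (1 - s) * Y powr s"
      proof -
        have m: "min (\<rho>\<^sup>2) Y > 0" using \<rho> Y by auto
        then have "min (\<rho>\<^sup>2) Y = min (\<rho>\<^sup>2) Y powr (1 - s) * min (\<rho>\<^sup>2) Y powr s"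
          by (simp flip: powr_add)
        also have "\<dots> \<le> (\<rho>\<^sup>2) powr (1 - s) * Y powr s"
          using m s by (intro mult_mono powr_mono2) auto
        finally show ?thesis .
      qed
      also have "\<dots> = \<delta> powr s * \<rho> powr (2 - s * (1 + 1 / \<alpha>))"
      proof -
        have "(\<rho>\<^sup>2) powr (1 - s) = \<rho> powr (2 * (1 - s))"
          using \<rho> by (simp add: powr_powr flip: powr_numeral)
        moreover have "Y powr s = \<delta> powr s * \<rho> powr ((1 - 1 / \<alpha>) * s)"
          using \<rho> \<delta> by (simp add: Y_def powr_mult powr_powr)
        moreover have "2 * (1 - s) + (1 - 1 / \<alpha>) * s = 2 - s * (1 + 1 / \<alpha>)"
          by (simp add: algebra_simps)
        moreover have "\<rho> powr (2 * (1 - s)) * \<rho> powr ((1 - 1 / \<alpha>) * s) = \<rho> powr (2 * (1 - s) + (1 -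
            1 / \<alpha>) * s)"
          by (simp only: powr_add)
        ultimately show ?thesis by (simp only: mult.left_commute)
      qed
      finally have f1: "C * min (\<rho>\<^sup>2) Y \<le> C * \<delta> powr s * \<rho> powr (2 - s * (1 + 1 / \<alpha>))"
        using C by (simp add: mult.assoc)
      have f2: "emeasure lebesgue ?X \<le> ennreal (C * min (\<rho>\<^sup>2) Y)"
        by (cases "\<rho>\<^sup>2 \<le> Y") (use triv len in \<open>simp_all only: min_def if_True if_False\<close>)
      show ?thesis by (rule order_trans[OF f2 ennreal_leI[OF f1]])
    qed
  qed
  then show ?thesis using that C by blast
qed

text \<open>The radius \<open>R\<close> with \<open>R powr (1 + 1 / \<alpha>) = \<delta>\<close> is where the gap between consecutive turns has
  size \<open>\<delta>\<close>. The disc of radius \<open>R\<close> is filled by the tube and has area \<open>R\<^sup>2\<close>; the annuli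
  outside it are summed as a geometric series, which grows outwards if the exponent \<open>\<kappa>\<close> is
  positive. For \<open>\<kappa> = 0\<close> the assumptions force \<open>\<alpha> < 1\<close>, and the estimate with \<open>s = 1\<close> makes the
  series decay outwards.\<close>

lemma emeasure_tube_spiral_curve_dyadic_ball:
  assumes \<alpha>: "\<alpha> > 0" and s: "0 < s" "s \<le> 1" and \<alpha>1: "\<alpha> = 1 \<Longrightarrow> s < 1"
    and \<kappa>: "\<kappa> = 2 - s * (1 + 1 / \<alpha>)" "\<kappa> \<ge> 0"
  obtains K where "K > 0"
    "\<And>\<delta> \<sigma> R n. 0 < \<delta> \<Longrightarrow> \<delta> \<le> 1 \<Longrightarrow> \<bar>\<sigma>\<bar> = 1 \<Longrightarrow> R > 0 \<Longrightarrow> R powr (1 + 1 / \<alpha>) = \<delta> \<Longrightarrow>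
       emeasure lebesgue (ball 0 (2 ^ n * R) \<inter> tube \<delta> (spiral_curve \<alpha> \<sigma> ` {2 * pi..})) \<le>
         ennreal (K * \<delta> powr s * (2 ^ n * R) powr \<kappa>)"
proof (rule emeasure_tube_spiral_curve_dyadic_annulus[OF \<alpha>])
  fix C :: real assume C: "C > 0"
    "\<And>\<rho> \<delta> \<sigma> s. 0 < \<rho> \<Longrightarrow> 0 < \<delta> \<Longrightarrow> \<delta> \<le> 1 \<Longrightarrow> \<bar>\<sigma>\<bar> = 1 \<Longrightarrow> 0 \<le> s \<Longrightarrow> s \<le> 1 \<Longrightarrow>
       emeasure lebesgue ({x. 2 * \<rho> \<le> norm x \<and> norm x \<le> 4 * \<rho>} \<inter> tube \<delta> (spiral_curve \<alpha> \<sigma> ` {2 * pi..})) \<le>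
         ennreal (C * \<delta> powr s * \<rho> powr (2 - s * (1 + 1 / \<alpha>)))"
  have base: "emeasure lebesgue (ball 0 R \<inter> tube \<delta> (spiral_curve \<alpha> \<sigma> ` {2 * pi..}))
      \<le> ennreal (4 * \<delta> powr s * R powr \<kappa>)"
    if "R > 0" "R powr (1 + 1 / \<alpha>) = \<delta>" for R \<delta> \<sigma>
  proof -
    have "\<delta> powr s * R powr \<kappa> = R powr 2"
    proof -
      have "(1 + 1 / \<alpha>) * s + \<kappa> = 2" by (simp add: \<kappa>(1) mult.commute)
      then show ?thesis unfolding that(2)[symmetric] powr_powr by (simp flip: powr_add)
    qed
    then show ?thesis
      using emeasure_subset_ball_le[of R "ball 0 R \<inter> tube \<delta> (spiral_curve \<alpha> \<sigma> ` {2 * pi..})" 0] that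
      by (simp add: mult.assoc)
  qed
  have step: "emeasure lebesgue (ball 0 (2 ^ Suc n * R) \<inter> Z) \<le>
      emeasure lebesgue (ball 0 (2 ^ n * R) \<inter> Z) +
      emeasure lebesgue ({x. 2 * (2 ^ n * R / 2) \<le> norm x \<and> norm x \<le> 4 * (2 ^ n * R / 2)} \<inter> Z)"
    if "Z \<in> sets lebesgue" for n R and Z :: "(real ^ 2) set"
  proof -
    have "closed {x :: real ^ 2. 2 * (2 ^ n * R / 2) \<le> norm x \<and> norm x \<le> 4 * (2 ^ n * R / 2)}"
      by (intro closed_Collect_conj closed_Collect_le continuous_intros)
    then have "{x :: real ^ 2. 2 * (2 ^ n * R / 2) \<le> norm x \<and> norm x \<le> 4 * (2 ^ n * R / 2)} \<in> sets lebesgue"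
      using borel_closed by simp
    then show ?thesis
      using that by (intro order_trans[OF emeasure_mono emeasure_subadditive] sets.Int sets.Un)
        (auto simp: mult_ac)
  qed
  show ?thesis
  proof (cases "\<kappa> = 0")
    case False
    then have \<kappa>0: "\<kappa> > 0" using \<kappa>(2) by simp
    then have p: "2 powr \<kappa> > 1" by simp
    \<comment> \<open>The induction over \<open>n\<close> needs \<open>K + C \<le> K * 2 powr \<kappa>\<close>.\<close>
    define K where "K = 4 + C / (2 powr \<kappa> - 1)"
    have K: "K \<ge> 4" "K > 0" using p C(1) by (auto simp: K_def intro: add_pos_nonneg)
    have "K * (2 powr \<kappa> - 1) = 4 * (2 powr \<kappa> - 1) + C"
      using p \<kappa>0 by (simp add: K_def distrib_right)
    then have KC: "K + C \<le> K * 2 powr \<kappa>" using p by (simp add: right_diff_distrib)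
    have "emeasure lebesgue (ball 0 (2 ^ n * R) \<inter> tube \<delta> (spiral_curve \<alpha> \<sigma> ` {2 * pi..})) \<le>
         ennreal (K * \<delta> powr s * (2 ^ n * R) powr \<kappa>)"
      if \<delta>: "0 < \<delta>" "\<delta> \<le> 1" and \<sigma>: "\<bar>\<sigma>\<bar> = 1" and R: "R > 0" "R powr (1 + 1 / \<alpha>) = \<delta>" for \<delta> \<sigma> R n
    proof (induction n)
      case 0
      have "4 * \<delta> powr s * R powr \<kappa> \<le> K * \<delta> powr s * R powr \<kappa>"
        using K by (intro mult_right_mono) auto
      from order_trans[OF base[OF R] ennreal_leI[OF this]] show ?case by simp
    next
      case (Suc n)
      let ?Z = "tube \<delta> (spiral_curve \<alpha> \<sigma> ` {2 * pi..})" and ?r = "2 ^ n * R"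
      have r: "?r > 0" using R by simp
      have "emeasure lebesgue ({x. 2 * (?r / 2) \<le> norm x \<and> norm x \<le> 4 * (?r / 2)} \<inter> ?Z) \<le>
          ennreal (C * \<delta> powr s * (?r / 2) powr \<kappa>)"
        unfolding \<kappa>(1) by (rule C(2)[OF _ \<delta> \<sigma>]) (use r s in auto)
      also have "\<dots> \<le> ennreal (C * \<delta> powr s * ?r powr \<kappa>)"
        using r R \<kappa>0 C(1) by (intro ennreal_leI mult_left_mono powr_mono2) auto
      finally have "emeasure lebesgue (ball 0 (2 ^ Suc n * R) \<inter> ?Z) \<le>
          ennreal (K * \<delta> powr s * ?r powr \<kappa>) + ennreal (C * \<delta> powr s * ?r powr \<kappa>)"
        by (rule order_trans[OF step[OF tube_lebesgue] add_mono[OF Suc.IH]])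
      also have "\<dots> = ennreal ((K + C) * (\<delta> powr s * ?r powr \<kappa>))"
        using K C(1) by (subst ennreal_plus[symmetric]) (auto simp: algebra_simps)
      also have "\<dots> \<le> ennreal (K * 2 powr \<kappa> * (\<delta> powr s * ?r powr \<kappa>))"
        using KC by (intro ennreal_leI mult_right_mono) auto
      also have "K * 2 powr \<kappa> * (\<delta> powr s * ?r powr \<kappa>) = K * \<delta> powr s * (2 ^ Suc n * R) powr \<kappa>"
        using R by (simp add: powr_mult mult_ac)
      finally show ?case .
    qed
    then show ?thesis using that K by blast
  next
    case True
    have q: "1 / \<alpha> > 1"
    proof -
      have "2 = s * (1 + 1 / \<alpha>)" using True \<kappa>(1) by simp
      also have "\<dots> \<le> 1 * (1 + 1 / \<alpha>)" using s \<alpha> by (intro mult_right_mono) (auto simp: add_nonneg_nonneg)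
      finally have "1 \<le> 1 / \<alpha>" by simp
      moreover have "\<alpha> \<noteq> 1" using \<alpha>1 True \<kappa>(1) by auto
      ultimately show ?thesis using \<alpha> by (simp add: field_simps)
    qed
    define \<mu> where "\<mu> = 1 / \<alpha> - 1"
    have \<mu>: "\<mu> > 0" using q by (simp add: \<mu>_def)
    define y where "y = 2 powr (- \<mu>)"
    have y: "0 < y" "y < 1"
      using \<mu> powr_less_mono[of "- \<mu>" 0 2] by (auto simp: y_def)
    \<comment> \<open>The annulus \<open>n\<close> contributes \<open>C / y * y ^ n = K * (y ^ n - y ^ Suc n)\<close>, so the sum
      telescopes.\<close>
    define K where "K = C / y / (1 - y)"
    have K: "K > 0" using C(1) y by (simp add: K_def)
    have "emeasure lebesgue (ball 0 (2 ^ n * R) \<inter> tube \<delta> (spiral_curve \<alpha> \<sigma> ` {2 * pi..})) \<le>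
         ennreal ((4 + K * (1 - y ^ n)) * \<delta> powr s)"
      if \<delta>: "0 < \<delta>" "\<delta> \<le> 1" and \<sigma>: "\<bar>\<sigma>\<bar> = 1" and R: "R > 0" "R powr (1 + 1 / \<alpha>) = \<delta>" for \<delta> \<sigma> R n
    proof (induction n)
      case 0
      then show ?case using base[OF R, of \<sigma>] R(1) True by simp
    next
      case (Suc n)
      let ?Z = "tube \<delta> (spiral_curve \<alpha> \<sigma> ` {2 * pi..})" and ?r = "2 ^ n * R"
      have r: "?r > 0" using R by simp
      have "emeasure lebesgue ({x. 2 * (?r / 2) \<le> norm x \<and> norm x \<le> 4 * (?r / 2)} \<inter> ?Z) \<le>
          ennreal (C * \<delta> powr 1 * (?r / 2) powr (2 - 1 * (1 + 1 / \<alpha>)))"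
        by (rule C(2)[OF _ \<delta> \<sigma>]) (use r in auto)
      also have "C * \<delta> powr 1 * (?r / 2) powr (2 - 1 * (1 + 1 / \<alpha>)) = C / y * y ^ n * \<delta> powr s"
      proof -
        have "(?r / 2) powr (- \<mu>) = (2 ^ n) powr (- \<mu>) * R powr (- \<mu>) / y"
          using R by (simp add: powr_mult powr_divide y_def)
        moreover have "((2::real) ^ n) powr (- \<mu>) = y ^ n"
          by (simp add: y_def powr_powr mult.commute flip: powr_realpow)
        moreover have "\<delta> * R powr (- \<mu>) = \<delta> powr s"
        proof -
          have "s * (1 + 1 / \<alpha>) = 2" using True \<kappa>(1) by simp
          then have "\<delta> powr s = R powr 2"
            unfolding R(2)[symmetric] powr_powr by (simp add: mult.commute)
          moreover have "\<delta> * R powr (- \<mu>) = R powr 2"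
            unfolding R(2)[symmetric] \<mu>_def by (simp flip: powr_add)
          ultimately show ?thesis by simp
        qed
        moreover have "2 - 1 * (1 + 1 / \<alpha>) = - \<mu>" by (simp add: \<mu>_def)
        ultimately show ?thesis using \<delta> by (simp add: mult_ac)
      qed
      finally have "emeasure lebesgue (ball 0 (2 ^ Suc n * R) \<inter> ?Z) \<le>
          ennreal ((4 + K * (1 - y ^ n)) * \<delta> powr s) + ennreal (C / y * y ^ n * \<delta> powr s)"
        by (rule order_trans[OF step[OF tube_lebesgue] add_mono[OF Suc.IH]])
      also have "\<dots> = ennreal ((4 + K * (1 - y ^ n)) * \<delta> powr s + C / y * y ^ n * \<delta> powr s)"
        using K C(1) y by (intro ennreal_plus[symmetric] mult_nonneg_nonneg add_nonneg_nonneg) (auto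
            simp: power_le_one)
      also have "(4 + K * (1 - y ^ n)) * \<delta> powr s + C / y * y ^ n * \<delta> powr s = (4 + K * (1 - y ^ Suc
          n)) * \<delta> powr s"
      proof -
        have cy: "C / y = K * (1 - y)" using y by (simp add: K_def)
        show ?thesis unfolding cy by (simp add: algebra_simps)
      qed
      finally show ?case .
    qed
    note ind = this
    have le: "(4 + K * (1 - y ^ n)) * \<delta> powr s \<le> (4 + K) * \<delta> powr s" for n \<delta>
      using K y by (intro mult_right_mono) auto
    have fin: "emeasure lebesgue (ball 0 (2 ^ n * R) \<inter> tube \<delta> (spiral_curve \<alpha> \<sigma> ` {2 * pi..})) \<le>
         ennreal ((4 + K) * \<delta> powr s * (2 ^ n * R) powr \<kappa>)"
      if "0 < \<delta>" "\<delta> \<le> 1" "\<bar>\<sigma>\<bar> = 1" "R > 0" "R powr (1 + 1 / \<alpha>) = \<delta>" for \<delta> \<sigma> R n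
    proof -
      have "(2 ^ n * R) powr \<kappa> = 1" using that(4) True by simp
      then show ?thesis using order_trans[OF ind[OF that] ennreal_leI[OF le]] by (simp only: mult_1_right)
    qed
    have "4 + K > 0" using K by simp
    then show ?thesis using fin by (rule that)
  qed
qed

text \<open>For balls of bounded radius the exponent \<open>2 - s * (1 + 1 / \<alpha>)\<close> may be lowered to \<open>h\<close>.\<close>

lemma emeasure_tube_spiral_curve_ball:
  assumes \<alpha>: "\<alpha> > 0" and s: "0 < s" "s \<le> 1" and \<alpha>1: "\<alpha> = 1 \<Longrightarrow> s < 1"
    and h: "0 \<le> h" "s * (1 + 1 / \<alpha>) \<le> 2 - h"
  obtains K where "K > 0"
    "\<And>\<rho> \<delta> \<sigma>. 0 < \<delta> \<Longrightarrow> \<delta> \<le> 1 \<Longrightarrow> \<bar>\<sigma>\<bar> = 1 \<Longrightarrow> 0 < \<rho> \<Longrightarrow> \<rho> \<le> 16 \<Longrightarrow>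
       emeasure lebesgue (ball 0 \<rho> \<inter> tube \<delta> (spiral_curve \<alpha> \<sigma> ` {2 * pi..})) \<le>
         ennreal (K * \<delta> powr s * \<rho> powr h)"
proof -
  define \<kappa> where "\<kappa> = 2 - s * (1 + 1 / \<alpha>)"
  have \<kappa>h: "h \<le> \<kappa>" "\<kappa> \<ge> 0" using h by (auto simp: \<kappa>_def)
  have \<kappa>2: "\<kappa> \<le> 2" using s \<alpha> by (simp add: \<kappa>_def)
  show thesis
  proof (rule emeasure_tube_spiral_curve_dyadic_ball[OF \<alpha> s \<alpha>1 \<kappa>_def \<kappa>h(2)])
    fix K0 :: real assume K0: "K0 > 0"
    "\<And>\<delta> \<sigma> R n. 0 < \<delta> \<Longrightarrow> \<delta> \<le> 1 \<Longrightarrow> \<bar>\<sigma>\<bar> = 1 \<Longrightarrow> R > 0 \<Longrightarrow> R powr (1 + 1 / \<alpha>) = \<delta> \<Longrightarrow>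
       emeasure lebesgue (ball 0 (2 ^ n * R) \<inter> tube \<delta> (spiral_curve \<alpha> \<sigma> ` {2 * pi..})) \<le>
         ennreal (K0 * \<delta> powr s * (2 ^ n * R) powr \<kappa>)"
    define K where "K = (4 * K0 + 4) * 16 powr (\<kappa> - h)"
    have "emeasure lebesgue (ball 0 \<rho> \<inter> tube \<delta> (spiral_curve \<alpha> \<sigma> ` {2 * pi..})) \<le>
         ennreal (K * \<delta> powr s * \<rho> powr h)"
      if \<delta>: "0 < \<delta>" "\<delta> \<le> 1" and \<sigma>: "\<bar>\<sigma>\<bar> = 1" and \<rho>: "0 < \<rho>" "\<rho> \<le> 16" for \<rho> \<delta> \<sigma>
    proof -
      let ?Z = "tube \<delta> (spiral_curve \<alpha> \<sigma> ` {2 * pi..})"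
      define q where "q = 1 + 1 / \<alpha>"
      have q: "q > 0" using \<alpha> by (simp add: q_def add_pos_pos)
      define R where "R = \<delta> powr (1 / q)"
      have R: "R > 0" "R powr (1 + 1 / \<alpha>) = \<delta>"
        using \<delta> q by (simp_all add: R_def powr_powr flip: q_def)
      have "emeasure lebesgue (ball 0 \<rho> \<inter> ?Z) \<le> ennreal ((4 * K0 + 4) * \<delta> powr s * \<rho> powr \<kappa>)"
      proof (cases "\<rho> \<le> R")
        case True
        have "\<rho>\<^sup>2 = \<rho> powr (q * s) * \<rho> powr \<kappa>"
        proof -
          have "q * s + \<kappa> = 2" by (simp add: \<kappa>_def q_def mult.commute)
          then show ?thesis using \<rho> by (simp flip: powr_add)
        qed
        also have "\<rho> powr (q * s) \<le> R powr (q * s)"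
          using True \<rho> q s by (intro powr_mono2) auto
        also have "R powr (q * s) = \<delta> powr s" using R(2) by (simp add: q_def flip: powr_powr)
        finally have "4 * \<rho>\<^sup>2 \<le> 4 * (\<delta> powr s * \<rho> powr \<kappa>)" by (simp add: mult_right_mono)
        also have "\<dots> \<le> (4 * K0 + 4) * (\<delta> powr s * \<rho> powr \<kappa>)"
          using K0(1) by (intro mult_right_mono) auto
        finally have "4 * \<rho>\<^sup>2 \<le> (4 * K0 + 4) * \<delta> powr s * \<rho> powr \<kappa>" by (simp add: mult.assoc)
        from order_trans[OF emeasure_subset_ball_le[OF less_imp_le[OF \<rho>(1)] inf_le1] ennreal_leI[OF this]]
        show ?thesis .
      next
        case False
        define n where "n = (LEAST n. \<rho> \<le> 2 ^ n * R)"
        obtain n0 where "\<rho> / R < 2 ^ n0" using real_arch_pow[of 2 "\<rho> / R"] by auto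
        then have "\<rho> \<le> 2 ^ n0 * R" using R by (simp add: field_simps)
        then have n: "\<rho> \<le> 2 ^ n * R" unfolding n_def by (rule LeastI)
        have "n \<noteq> 0" using n False by (metis mult_1 power_0)
        then obtain m where m: "n = Suc m" using not0_implies_Suc by blast
        then have "\<not> \<rho> \<le> 2 ^ m * R" using not_less_Least[of m "\<lambda>n. \<rho> \<le> 2 ^ n * R"] by (simp add: n_def)
        then have n2: "2 ^ n * R \<le> 2 * \<rho>" by (simp add: m)
        have "emeasure lebesgue (ball 0 \<rho> \<inter> ?Z) \<le> emeasure lebesgue (ball 0 (2 ^ n * R) \<inter> ?Z)"
          using n by (intro emeasure_mono sets.Int) auto
        also have "\<dots> \<le> ennreal (K0 * \<delta> powr s * (2 ^ n * R) powr \<kappa>)"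
          by (rule K0(2)[OF \<delta> \<sigma> R])
        also have "\<dots> \<le> ennreal (K0 * \<delta> powr s * (4 * \<rho> powr \<kappa>))"
        proof (intro ennreal_leI mult_left_mono)
          have "(2 ^ n * R) powr \<kappa> \<le> (2 * \<rho>) powr \<kappa>" using n2 R \<kappa>h by (intro powr_mono2) auto
          also have "\<dots> = 2 powr \<kappa> * \<rho> powr \<kappa>" using \<rho> by (simp add: powr_mult)
          also have "\<dots> \<le> 2 powr 2 * \<rho> powr \<kappa>" using \<kappa>2 by (intro mult_right_mono powr_mono) auto
          finally show "(2 ^ n * R) powr \<kappa> \<le> 4 * \<rho> powr \<kappa>" by simp
        qed (use K0 in auto)
        also have "\<dots> \<le> ennreal ((4 * K0 + 4) * \<delta> powr s * \<rho> powr \<kappa>)"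
          by (intro ennreal_leI) (simp add: algebra_simps)
        finally show ?thesis .
      qed
      also have "\<dots> \<le> ennreal (K * \<delta> powr s * \<rho> powr h)"
      proof (intro ennreal_leI)
        have "\<rho> powr \<kappa> = \<rho> powr (\<kappa> - h) * \<rho> powr h" by (simp flip: powr_add)
        also have "\<dots> \<le> 16 powr (\<kappa> - h) * \<rho> powr h"
          using \<rho> \<kappa>h by (intro mult_right_mono powr_mono2) auto
        finally have "(4 * K0 + 4) * \<delta> powr s * \<rho> powr \<kappa> \<le> (4 * K0 + 4) * \<delta> powr s * (16 powr (\<kappa> -
            h) * \<rho> powr h)"
          using K0 by (intro mult_left_mono) auto
        then show "(4 * K0 + 4) * \<delta> powr s * \<rho> powr \<kappa> \<le> K * \<delta> powr s * \<rho> powr h"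
          by (simp add: K_def mult_ac)
      qed
      finally show ?thesis .
    qed
    moreover have "K > 0" using K0 by (simp add: K_def add_pos_pos)
    ultimately show thesis using that by blast
  qed
qed

lemma emeasure_box_plane:
  assumes "a \<ge> 0" "b \<ge> 0" "X \<subseteq> {x :: real ^ 2. \<bar>x $ 1 - c\<bar> \<le> a \<and> \<bar>x $ 2 - d\<bar> \<le> b}"
  shows "emeasure lebesgue X \<le> ennreal (4 * a * b)"
proof -
  let ?l = "vector [c - a, d - b] :: real ^ 2" and ?u = "vector [c + a, d + b] :: real ^ 2"
  have "X \<subseteq> cbox ?l ?u"
    using assms(3) by (fastforce simp: mem_box_cart forall_2 abs_le_iff)
  then have "emeasure lebesgue X \<le> emeasure lebesgue (cbox ?l ?u)"
    by (rule emeasure_mono) simp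
  also have "\<dots> = ennreal (measure lborel (cbox ?l ?u))"
    using emeasure_eq_ennreal_measure[OF less_imp_neq[OF emeasure_lborel_cbox_finite[unfolded
        infinity_ennreal_def]]]
    by (simp del: emeasure_lborel_cbox measure_lborel_cbox_eq content_cbox_cart)
  also have "measure lborel (cbox ?l ?u) = (2 * a) * (2 * b)"
    using assms by (subst content_cbox_cart) (auto simp: interval_ne_empty_cart forall_2 UNIV_2)
  finally show ?thesis by (simp add: mult.assoc mult.left_commute)
qed

lemma emeasure_tube_slit_square:
  assumes s: "0 < s" "s \<le> 1" and h: "0 \<le> h" "s + h \<le> 2"
    and \<delta>: "0 < \<delta>" "\<delta> \<le> 1" "\<delta> \<le> l" and diam: "\<And>x y. x \<in> P \<Longrightarrow> y \<in> P \<Longrightarrow> dist x y \<le> 2 * l"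
  shows "emeasure lebesgue (P \<inter> tube \<delta> unit_slit) \<le> ennreal (8 * \<delta> powr s * l powr h)"
proof (cases "P \<inter> tube \<delta> unit_slit = {}")
  case False
  then obtain a where a: "a \<in> P" by blast
  have coord: "\<bar>x $ 2 - 0\<bar> \<le> \<delta> \<and> \<bar>x $ 1 - 0\<bar> \<le> 2" if x: "x \<in> tube \<delta> unit_slit" for x
  proof -
    obtain z where z: "z $ 2 = 0" "0 \<le> z $ 1" "z $ 1 \<le> 1" "dist z x < \<delta>"
      using x by (auto simp: tube_def unit_slit_def)
    have "\<bar>(z - x) $ i\<bar> < \<delta>" for i
      using component_le_norm_cart[of "z - x" i] z(4) by (simp add: dist_norm)
    from this[of 1] this[of 2] show ?thesis using z \<delta> by auto
  qed
  show ?thesis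
  proof (cases "l \<le> 1")
    case True
    have "P \<inter> tube \<delta> unit_slit \<subseteq> {x. \<bar>x $ 1 - a $ 1\<bar> \<le> 2 * l \<and> \<bar>x $ 2 - 0\<bar> \<le> \<delta>}"
    proof
      fix x assume x: "x \<in> P \<inter> tube \<delta> unit_slit"
      have "\<bar>(x - a) $ 1\<bar> \<le> 2 * l"
        using component_le_norm_cart[of "x - a" 1] diam[of x a] x a by (simp add: dist_norm)
      then show "x \<in> {x. \<bar>x $ 1 - a $ 1\<bar> \<le> 2 * l \<and> \<bar>x $ 2 - 0\<bar> \<le> \<delta>}" using coord[of x] x by simp
    qed
    then have "emeasure lebesgue (P \<inter> tube \<delta> unit_slit) \<le> ennreal (4 * (2 * l) * \<delta>)"
      using \<delta> by (intro emeasure_box_plane[of _ _ _ "a $ 1" 0]) auto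
    also have "\<dots> \<le> ennreal (8 * \<delta> powr s * l powr h)"
    proof (intro ennreal_leI)
      have "\<delta> * l = \<delta> powr s * (\<delta> powr (1 - s) * l)"
        using \<delta> by (simp flip: powr_add mult.assoc)
      also have "\<dots> \<le> \<delta> powr s * (l powr (1 - s) * l)"
        using \<delta> s by (intro mult_left_mono mult_right_mono powr_mono2) auto
      also have "l powr (1 - s) * l = l powr (2 - s)"
        using \<delta> by (simp add: powr_diff powr_add power2_eq_square)
      also have "\<delta> powr s * l powr (2 - s) \<le> \<delta> powr s * l powr h"
        using \<delta> True h by (intro mult_left_mono powr_mono') auto
      finally have "\<delta> * l \<le> \<delta> powr s * l powr h" .
      then show "4 * (2 * l) * \<delta> \<le> 8 * \<delta> powr s * l powr h" by (simp add: mult_ac)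
    qed
    finally show ?thesis .
  next
    case False
    have "emeasure lebesgue (P \<inter> tube \<delta> unit_slit) \<le> ennreal (4 * 2 * \<delta>)"
      using \<delta> coord by (intro emeasure_box_plane[of _ _ _ 0 0]) auto
    also have "\<dots> \<le> ennreal (8 * \<delta> powr s * l powr h)"
    proof (intro ennreal_leI)
      have "\<delta> powr 1 \<le> \<delta> powr s" using \<delta> s by (intro powr_mono') auto
      moreover have "1 \<le> l powr h" using False h by (intro ge_one_powr_ge_zero) auto
      ultimately have "\<delta> * 1 \<le> \<delta> powr s * l powr h" using \<delta> by (intro mult_mono) auto
      then show "4 * 2 * \<delta> \<le> 8 * \<delta> powr s * l powr h" by simp
    qed
    finally show ?thesis .
  qed
qed simp

text \<open>A square of side \<open>l\<close> close to the origin is contained in a comparable ball around it. Any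
  other square lies in an annulus of some radius \<open>\<rho>\<close> larger than \<open>l\<close>. There one edge
  contributes \<open>\<delta> * l\<close>, and the sum \<open>\<delta> * l\<^sup>2 / \<rho> powr (1 + 1 / \<alpha>)\<close> over many edges is compared
  with \<open>l\<^sup>2\<close> as before. Only the diameter and the area of the square enter.\<close>

lemma emeasure_tube_spiral_curve_square:
  assumes \<alpha>: "\<alpha> > 0" and s: "0 < s" "s \<le> 1" and \<alpha>1: "\<alpha> = 1 \<Longrightarrow> s < 1"
    and h: "0 \<le> h" "s * (1 + 1 / \<alpha>) \<le> 2 - h"
  obtains K where "K > 0"
    "\<And>l \<delta> \<sigma> P. 0 < \<delta> \<Longrightarrow> \<delta> \<le> 1 \<Longrightarrow> \<delta> \<le> l \<Longrightarrow> \<bar>\<sigma>\<bar> = 1 \<Longrightarrow> P \<in> sets lebesgue \<Longrightarrow>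
       (\<And>x y. x \<in> P \<Longrightarrow> y \<in> P \<Longrightarrow> dist x y \<le> 2 * l) \<Longrightarrow> emeasure lebesgue P \<le> ennreal (l\<^sup>2) \<Longrightarrow>
       emeasure lebesgue (P \<inter> tube \<delta> (spiral_curve \<alpha> \<sigma> ` {2 * pi..})) \<le>
         ennreal (K * \<delta> powr s * l powr h)"
proof (rule emeasure_tube_spiral_curve_ball[OF \<alpha> s \<alpha>1 h])
  fix K0 :: real assume K0: "K0 > 0" "\<And>\<rho> \<delta> \<sigma>. 0 < \<delta> \<Longrightarrow> \<delta> \<le> 1 \<Longrightarrow> \<bar>\<sigma>\<bar> = 1 \<Longrightarrow> 0 < \<rho> \<Longrightarrow> \<rho> \<le> 16 \<Longrightarrow>
       emeasure lebesgue (ball 0 \<rho> \<inter> tube \<delta> (spiral_curve \<alpha> \<sigma> ` {2 * pi..})) \<le>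
         ennreal (K0 * \<delta> powr s * \<rho> powr h)"
  show thesis
  proof (rule emeasure_tube_spiral_curve_annulus[OF \<alpha>])
    fix C :: real assume C: "C > 0"
    "\<And>\<rho> D \<delta> S \<sigma>. 0 < \<rho> \<Longrightarrow> 0 < \<delta> \<Longrightarrow> \<delta> \<le> \<rho> \<Longrightarrow> \<delta> \<le> D \<Longrightarrow> \<bar>\<sigma>\<bar> = 1 \<Longrightarrow>
       (\<And>x. x \<in> S \<Longrightarrow> 2 * \<rho> \<le> norm x \<and> norm x \<le> 8 * \<rho>) \<Longrightarrow>
       (\<And>x y. x \<in> S \<Longrightarrow> y \<in> S \<Longrightarrow> dist x y \<le> D) \<Longrightarrow>
       emeasure lebesgue (S \<inter> tube \<delta> (spiral_curve \<alpha> \<sigma> ` {2 * pi..})) \<le>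
         ennreal (C * \<delta> * D * (1 + D * \<rho> powr (- 1 / \<alpha> - 1)))"
    define K where "K = K0 * 11 powr 2 + 6 * C + 1"
    have sq: "s \<le> s * (1 + 1 / \<alpha>)" using s \<alpha> by simp
    have h2: "h \<le> 2" "s + h \<le> 2" using h sq s by linarith+
    have main: "emeasure lebesgue (P \<inter> tube \<delta> (spiral_curve \<alpha> \<sigma> ` {2 * pi..})) \<le>
         ennreal (K * \<delta> powr s * l powr h)"
      if \<delta>: "0 < \<delta>" "\<delta> \<le> 1" "\<delta> \<le> l" and \<sigma>: "\<bar>\<sigma>\<bar> = 1" and P: "P \<in> sets lebesgue"
        and diam: "\<And>x y. x \<in> P \<Longrightarrow> y \<in> P \<Longrightarrow> dist x y \<le> 2 * l" and area: "emeasure lebesgue P \<le> ennreal (l\<^sup>2)"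
      for l \<delta> \<sigma> P
    proof -
      let ?Z = "tube \<delta> (spiral_curve \<alpha> \<sigma> ` {2 * pi..})"
      have bd: "?Z \<subseteq> ball 0 2" by (rule tube_spiral_curve_bounded[OF \<alpha> \<sigma> \<delta>(2)])
      have l: "l > 0" using \<delta> by linarith
      have KK: "K0 * 11 powr 2 \<le> K" "6 * C \<le> K" "1 \<le> K" using K0(1) C(1) by (auto simp: K_def)
      have widen: "emeasure lebesgue (P \<inter> ?Z) \<le> ennreal (K * \<delta> powr s * l powr h)"
        if "emeasure lebesgue (P \<inter> ?Z) \<le> ennreal (c * (\<delta> powr s * l powr h))" "c \<le> K" for c
      proof -
        have "c * (\<delta> powr s * l powr h) \<le> K * (\<delta> powr s * l powr h)"
          using that(2) by (intro mult_right_mono) auto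
        from order_trans[OF that(1) ennreal_leI[OF this]] show ?thesis by (simp add: mult.assoc)
      qed
      consider "P \<inter> ball 0 2 = {}" | "l > 1" | a where "l \<le> 1" "a \<in> P" "norm a \<le> 8 * l"
        | a where "l \<le> 1" "a \<in> P" "norm a < 2" "8 * l < norm a"
        by fastforce
      then show ?thesis
      proof cases
        case 1
        then have "P \<inter> ?Z = {}" using bd by blast
        then show ?thesis by simp
      next
        case 2
        have "emeasure lebesgue (P \<inter> ?Z) \<le> emeasure lebesgue (ball 0 2 \<inter> ?Z)"
          using bd by (intro emeasure_mono sets.Int) auto
        also have "\<dots> \<le> ennreal (K0 * \<delta> powr s * 2 powr h)"
          by (rule K0(2)[OF \<delta>(1,2) \<sigma>]) auto
        also have "\<dots> \<le> ennreal (K0 * 11 powr 2 * (\<delta> powr s * l powr h))"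
        proof (intro ennreal_leI)
          have "2 powr h \<le> (2 * l) powr h" using 2 h by (intro powr_mono2) auto
          also have "\<dots> = 2 powr h * l powr h" using l by (simp add: powr_mult)
          also have "\<dots> \<le> 11 powr 2 * l powr h"
          proof (intro mult_right_mono)
            have "2 powr h \<le> (2::real) powr 2" using h2 by (intro powr_mono) auto
            then show "2 powr h \<le> (11::real) powr 2" by simp
          qed simp
          finally have "K0 * \<delta> powr s * 2 powr h \<le> K0 * \<delta> powr s * (11 powr 2 * l powr h)"
            using K0(1) by (intro mult_left_mono) auto
          then show "K0 * \<delta> powr s * 2 powr h \<le> K0 * 11 powr 2 * (\<delta> powr s * l powr h)"
            by (simp add: mult_ac)
        qed
        finally show ?thesis using KK(1) by (rule widen)
      next
        case 3
        have "P \<subseteq> ball 0 (11 * l)"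
        proof
          fix x assume "x \<in> P"
          have "norm x \<le> norm a + dist x a" using norm_triangle_sub[of x a] by (simp add: dist_norm)
          then show "x \<in> ball 0 (11 * l)" using 3 diam[OF \<open>x \<in> P\<close> 3(2)] l by simp
        qed
        then have "emeasure lebesgue (P \<inter> ?Z) \<le> emeasure lebesgue (ball 0 (11 * l) \<inter> ?Z)"
          by (intro emeasure_mono sets.Int) auto
        also have "\<dots> \<le> ennreal (K0 * \<delta> powr s * (11 * l) powr h)"
          by (rule K0(2)[OF \<delta>(1,2) \<sigma>]) (use l 3 in auto)
        also have "\<dots> \<le> ennreal (K0 * 11 powr 2 * (\<delta> powr s * l powr h))"
        proof (intro ennreal_leI)
          have "(11 * l) powr h = 11 powr h * l powr h" using l by (simp add: powr_mult)
          also have "\<dots> \<le> 11 powr 2 * l powr h"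
            using h2 by (intro mult_right_mono powr_mono) auto
          finally have "K0 * \<delta> powr s * (11 * l) powr h \<le> K0 * \<delta> powr s * (11 powr 2 * l powr h)"
            using K0(1) by (intro mult_left_mono) auto
          then show "K0 * \<delta> powr s * (11 * l) powr h \<le> K0 * 11 powr 2 * (\<delta> powr s * l powr h)"
            by (simp add: mult_ac)
        qed
        finally show ?thesis using KK(1) by (rule widen)
      next
        case 4
        define \<rho> where "\<rho> = norm a / 4"
        have \<rho>: "\<rho> > 0" "2 * l < \<rho>" "\<rho> < 1" using 4 l by (auto simp: \<rho>_def)
        define q where "q = 1 + 1 / \<alpha>"
        have q: "q > 0" using \<alpha> by (simp add: q_def add_pos_pos)
        have first: "\<delta> * l \<le> \<delta> powr s * l powr h"
        proof -
          have "\<delta> * l = \<delta> powr s * (\<delta> powr (1 - s) * l)"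
            using \<delta> by (simp flip: powr_add mult.assoc)
          also have "\<dots> \<le> \<delta> powr s * (l powr (1 - s) * l)"
            using \<delta> s by (intro mult_left_mono mult_right_mono powr_mono2) auto
          also have "l powr (1 - s) * l = l powr (2 - s)"
            using l by (simp add: powr_diff powr_add power2_eq_square)
          also have "\<delta> powr s * l powr (2 - s) \<le> \<delta> powr s * l powr h"
            using l 4(1) h2 by (intro mult_left_mono powr_mono') auto
          finally show ?thesis .
        qed
        have lq: "l powr (2 - h) \<le> \<rho> powr (q * s)"
        proof -
          have "l powr (2 - h) \<le> \<rho> powr (2 - h)" using l \<rho> h2 by (intro powr_mono2) auto
          also have "\<dots> \<le> \<rho> powr (q * s)" using \<rho> h by (intro powr_mono') (auto simp: q_def mult.commute)
          finally show ?thesis .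
        qed
        have l2: "l\<^sup>2 = l powr (2 - h) * l powr h"
          using l by (simp flip: powr_add)
        show ?thesis
        proof (cases "\<delta> \<le> \<rho> powr q")
          case False
          have "l\<^sup>2 \<le> \<rho> powr (q * s) * l powr h" unfolding l2 using lq by (intro mult_right_mono) auto
          also have "\<rho> powr (q * s) = (\<rho> powr q) powr s" by (simp add: powr_powr)
          also have "(\<rho> powr q) powr s * l powr h \<le> \<delta> powr s * l powr h"
            using False s by (intro mult_right_mono powr_mono2) auto
          finally have "l\<^sup>2 \<le> 1 * (\<delta> powr s * l powr h)" by simp
          moreover have "emeasure lebesgue (P \<inter> ?Z) \<le> ennreal (l\<^sup>2)"
            by (rule order_trans[OF emeasure_mono area]) (use P in auto)
          ultimately have "emeasure lebesgue (P \<inter> ?Z) \<le> ennreal (1 * (\<delta> powr s * l powr h))"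
            using order_trans[OF _ ennreal_leI] by blast
          then show ?thesis using KK(3) by (rule widen)
        next
          case True
          have "\<delta> * \<rho> powr (- q) = \<delta> powr s * (\<delta> powr (1 - s) * \<rho> powr (- q))"
            using \<delta> by (simp flip: powr_add mult.assoc)
          also have "\<dots> \<le> \<delta> powr s * ((\<rho> powr q) powr (1 - s) * \<rho> powr (- q))"
            using \<delta> s True by (intro mult_left_mono mult_right_mono powr_mono2) auto
          also have "(\<rho> powr q) powr (1 - s) * \<rho> powr (- q) = \<rho> powr (- (q * s))"
            by (simp add: powr_powr algebra_simps flip: powr_add)
          finally have dq: "\<delta> * \<rho> powr (- q) \<le> \<delta> powr s * \<rho> powr (- (q * s))" .
          have hl: "l\<^sup>2 \<le> \<rho> powr (q * s) * l powr h" unfolding l2 using lq by (intro mult_right_mono) auto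
          have "\<delta> * \<rho> powr (- q) * l\<^sup>2 \<le> (\<delta> powr s * \<rho> powr (- (q * s))) * (\<rho> powr (q * s) * l powr h)"
            by (rule mult_mono[OF dq hl]) auto
          also have "\<dots> = \<delta> powr s * l powr h"
            using \<rho> by (simp add: powr_minus)
          finally have second: "\<delta> * \<rho> powr (- q) * l\<^sup>2 \<le> \<delta> powr s * l powr h" .
          have "emeasure lebesgue (P \<inter> ?Z) \<le> ennreal (C * \<delta> * (2 * l) * (1 + 2 * l * \<rho> powr (- 1 / \<alpha> - 1)))"
          proof (rule C(2)[OF \<rho>(1) \<delta>(1) _ _ \<sigma> _ diam])
            fix x assume "x \<in> P"
            have "norm x \<le> norm a + dist x a" "norm a \<le> norm x + dist x a"
              using norm_triangle_sub[of x a] norm_triangle_sub[of a x]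
                  by (simp_all add: dist_norm norm_minus_commute)
            then show "2 * \<rho> \<le> norm x \<and> norm x \<le> 8 * \<rho>"
              using 4 diam[OF \<open>x \<in> P\<close> 4(2)] by (simp add: \<rho>_def)
          qed (use \<delta> \<rho> l in auto)
          also have "\<dots> \<le> ennreal (6 * C * (\<delta> powr s * l powr h))"
          proof (intro ennreal_leI)
            have "- 1 / \<alpha> - 1 = - q" by (simp add: q_def)
            then have "C * \<delta> * (2 * l) * (1 + 2 * l * \<rho> powr (- 1 / \<alpha> - 1)) =
                2 * C * (\<delta> * l) + 4 * C * (\<delta> * \<rho> powr (- q) * l\<^sup>2)"
              by (simp only:) (simp add: algebra_simps power2_eq_square)
            also have "\<dots> \<le> 2 * C * (\<delta> powr s * l powr h) + 4 * C * (\<delta> powr s * l powr h)"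
              using first second C(1) by (intro add_mono mult_left_mono) auto
            finally show "C * \<delta> * (2 * l) * (1 + 2 * l * \<rho> powr (- 1 / \<alpha> - 1))
                \<le> 6 * C * (\<delta> powr s * l powr h)"
              by simp
          qed
          finally show ?thesis using KK(2) by (rule widen)
        qed
      qed
    qed
    have "K > 0" using K0 C by (simp add: K_def add_pos_pos)
    then show thesis using main by (rule that)
  qed
qed

lemma emeasure_tube_spiral_edges_square:
  assumes \<alpha>: "\<alpha> > 0" and s: "0 < s" "s \<le> 1" and \<alpha>1: "\<alpha> = 1 \<Longrightarrow> s < 1"
    and h: "0 \<le> h" "s * (1 + 1 / \<alpha>) \<le> 2 - h"
  obtains K where "K > 0"
    "\<And>l \<delta> P. 0 < \<delta> \<Longrightarrow> \<delta> \<le> 1 \<Longrightarrow> \<delta> \<le> l \<Longrightarrow> P \<in> sets lebesgue \<Longrightarrow>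
       (\<And>x y. x \<in> P \<Longrightarrow> y \<in> P \<Longrightarrow> dist x y \<le> 2 * l) \<Longrightarrow> emeasure lebesgue P \<le> ennreal (l\<^sup>2) \<Longrightarrow>
       emeasure lebesgue (P \<inter> tube \<delta> (spiral_edges \<alpha>)) \<le> ennreal (K * \<delta> powr s * l powr h)"
proof (rule emeasure_tube_spiral_curve_square[OF \<alpha> s \<alpha>1 h])
  fix K :: real assume K: "K > 0"
    "\<And>l \<delta> \<sigma> P. 0 < \<delta> \<Longrightarrow> \<delta> \<le> 1 \<Longrightarrow> \<delta> \<le> l \<Longrightarrow> \<bar>\<sigma>\<bar> = 1 \<Longrightarrow> P \<in> sets lebesgue \<Longrightarrow>
       (\<And>x y. x \<in> P \<Longrightarrow> y \<in> P \<Longrightarrow> dist x y \<le> 2 * l) \<Longrightarrow> emeasure lebesgue P \<le> ennreal (l\<^sup>2) \<Longrightarrow>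
       emeasure lebesgue (P \<inter> tube \<delta> (spiral_curve \<alpha> \<sigma> ` {2 * pi..})) \<le>
         ennreal (K * \<delta> powr s * l powr h)"
  have "s * 1 \<le> s * (1 + 1 / \<alpha>)" using s \<alpha> by (intro mult_left_mono) auto
  then have sh: "s + h \<le> 2" using h by simp
  have main: "emeasure lebesgue (P \<inter> tube \<delta> (spiral_edges \<alpha>)) \<le> ennreal ((2 * K + 8) * \<delta> powr s * l powr h)"
    if \<delta>: "0 < \<delta>" "\<delta> \<le> 1" "\<delta> \<le> l" and P: "P \<in> sets lebesgue"
        and diam: "\<And>x y. x \<in> P \<Longrightarrow> y \<in> P \<Longrightarrow> dist x y \<le> 2 * l" and area: "emeasure lebesgue P \<le> ennreal (l\<^sup>2)"
      for l \<delta> P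
  proof -
    let ?t = "\<lambda>Z. P \<inter> tube \<delta> Z" and ?g = "\<lambda>\<sigma>. spiral_curve \<alpha> \<sigma> ` {2 * pi..}" and ?X = "\<delta> powr s * l powr h"
    have "emeasure lebesgue (?t (spiral_edges \<alpha>)) = emeasure lebesgue (?t (?g 1) \<union> ?t (?g (- 1)) \<union>
        ?t unit_slit)"
      by (simp add: spiral_edges_def tube_Un Int_Un_distrib Un_assoc)
    also have "\<dots> \<le> emeasure lebesgue (?t (?g 1) \<union> ?t (?g (- 1))) + emeasure lebesgue (?t unit_slit)"
      using P by (intro emeasure_subadditive sets.Un sets.Int) auto
    also have "\<dots> \<le> emeasure lebesgue (?t (?g 1)) + emeasure lebesgue (?t (?g (- 1))) + emeasure
        lebesgue (?t unit_slit)"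
      using P by (intro add_right_mono emeasure_subadditive sets.Int) auto
    also have "\<dots> \<le> ennreal (K * \<delta> powr s * l powr h) + ennreal (K * \<delta> powr s * l powr h) + ennreal
        (8 * \<delta> powr s * l powr h)"
      by (intro add_mono K(2) emeasure_tube_slit_square \<delta> P diam area s h sh) auto
    also have "\<dots> = ennreal (K * \<delta> powr s * l powr h + K * \<delta> powr s * l powr h + 8 * \<delta> powr s * l powr h)"
      using K(1) by (simp flip: ennreal_plus)
    also have "K * \<delta> powr s * l powr h + K * \<delta> powr s * l powr h + 8 * \<delta> powr s * l powr h = (2 * K
        + 8) * \<delta> powr s * l powr h"
      by (simp add: algebra_simps)
    finally show ?thesis .
  qed
  have "2 * K + 8 > 0" using K(1) by simp
  then show thesis using main by (rule that)
qed

text \<open>The tubes shrink to a null set, so the boundary is negligible.\<close>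

lemma spiral_lmeasurable:
  assumes \<alpha>: "\<alpha> > 0"
  shows "spiral \<alpha> \<in> lmeasurable"
proof (rule measurable_Jordan)
  have sub: "spiral \<alpha> \<subseteq> cball 0 1"
    using norm_spiral_less_1[OF \<alpha>] by fastforce
  then show "bounded (spiral \<alpha>)" using bounded_cball bounded_subset by blast
  \<comment> \<open>Any positive exponent allowed by the tube estimate with \<open>h = 0\<close> would do.\<close>
  define q where "q = 1 + 1 / \<alpha>"
  define s where "s = 1 / (2 * q)"
  have q: "q > 1" using \<alpha> by (simp add: q_def)
  have s: "0 < s" "s \<le> 1" "s < 1" using q by (simp_all add: s_def field_simps)
  have "s * q \<le> 2 - 0" using q by (simp add: s_def)
  then have sq: "s * (1 + 1 / \<alpha>) \<le> 2 - 0" by (simp only: q_def)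
  show "negligible (frontier (spiral \<alpha>))"
  proof (rule emeasure_tube_spiral_edges_square[OF \<alpha> s(1,2) s(3) order_refl sq])
    fix K :: real assume K: "K > 0"
    "\<And>l \<delta> P. 0 < \<delta> \<Longrightarrow> \<delta> \<le> 1 \<Longrightarrow> \<delta> \<le> l \<Longrightarrow> P \<in> sets lebesgue \<Longrightarrow>
       (\<And>x y. x \<in> P \<Longrightarrow> y \<in> P \<Longrightarrow> dist x y \<le> 2 * l) \<Longrightarrow> emeasure lebesgue P \<le> ennreal (l\<^sup>2) \<Longrightarrow>
       emeasure lebesgue (P \<inter> tube \<delta> (spiral_edges \<alpha>)) \<le> ennreal (K * \<delta> powr s * l powr 0)"
    have fr: "frontier (spiral \<alpha>) \<subseteq> cball 0 1"
      using closure_minimal[OF sub closed_cball] by (auto simp: frontier_def)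
    have bound: "emeasure lebesgue (frontier (spiral \<alpha>)) \<le> ennreal (K * \<delta> powr s)"
        if \<delta>: "0 < \<delta>" "\<delta> \<le> 1" for \<delta>
    proof -
      have "emeasure lebesgue (frontier (spiral \<alpha>)) \<le> emeasure lebesgue (ball 0 2 \<inter> tube \<delta>
          (spiral_edges \<alpha>))"
      proof (rule emeasure_mono)
        show "frontier (spiral \<alpha>) \<subseteq> ball 0 2 \<inter> tube \<delta> (spiral_edges \<alpha>)"
          using fr frontier_spiral_subset[OF \<alpha>] \<delta>(1) by (force simp: tube_def)
      qed auto
      also have "\<dots> \<le> ennreal (K * \<delta> powr s * 4 powr 0)"
      proof (rule K(2)[OF \<delta>])
        show "dist x y \<le> 2 * 4" if "x \<in> ball 0 2" "y \<in> ball 0 2" for x y :: "real ^ 2"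
          using that norm_triangle_ineq4[of x y] by (simp add: dist_norm)
        show "emeasure lebesgue (ball (0 :: real ^ 2) 2) \<le> ennreal (4\<^sup>2)"
          using emeasure_ball_plane_le[of 2 0] by simp
      qed (use \<delta> in auto)
      finally show ?thesis by simp
    qed
    have eps: "emeasure lebesgue (frontier (spiral \<alpha>)) \<le> ennreal e" if e: "e > 0" for e :: real
    proof -
      define \<delta> where "\<delta> = min 1 ((e / K) powr (1 / s))"
      have \<delta>: "0 < \<delta>" "\<delta> \<le> 1" using e K(1) by (auto simp: \<delta>_def)
      have "\<delta> powr s \<le> ((e / K) powr (1 / s)) powr s" using \<delta> s by (intro powr_mono2) (auto simp: \<delta>_def)
      also have "\<dots> = e / K" using s e K(1) by (simp add: powr_powr)
      finally have "K * \<delta> powr s \<le> e" using K(1) by (simp add: field_simps)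
      from order_trans[OF bound[OF \<delta>] ennreal_leI[OF this]] show ?thesis .
    qed
    have "emeasure lebesgue (frontier (spiral \<alpha>)) \<le> 0"
    proof (rule ennreal_le_epsilon)
      fix e :: real assume "0 < e"
      then show "emeasure lebesgue (frontier (spiral \<alpha>)) \<le> 0 + ennreal e"
        using eps[of e] by (simp only: add_0_left)
    qed
    then show "negligible (frontier (spiral \<alpha>))"
      by (simp add: negligible_iff_null_sets null_sets_def borel_closed)
  qed
qed

section \<open>Reduction to integrals over dyadic squares\<close>

lemma dyadic_cube_iff:
  fixes k :: "int ^ 'n"
  shows "x \<in> dyadic_cube m k \<longleftrightarrow>
    (\<forall>i. 2 powi (- m) * of_int (k $ i) \<le> x $ i \<and> x $ i < 2 powi (- m) * of_int (k $ i) + 2 powi (- m))"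
proof
  assume "x \<in> dyadic_cube m k"
  then obtain y :: "real ^ 'n" where y: "\<forall>i. 0 \<le> y $ i \<and> y $ i < 1"
    "x = (2 powi (- m)) *\<^sub>R (y + (\<chi> i. real_of_int (k $ i)))"
    by (auto simp: dyadic_cube_def)
  have "0 < (2::real) powi (- m)" by (rule zero_less_power_int) simp
  then show "\<forall>i. 2 powi (- m) * of_int (k $ i) \<le> x $ i \<and> x $ i < 2 powi (- m) * of_int (k $ i) + 2
      powi (- m)"
    using y by (simp add: distrib_left)
next
  assume x: "\<forall>i. 2 powi (- m) * of_int (k $ i) \<le> x $ i \<and> x $ i < 2 powi (- m) * of_int (k $ i) + 2
      powi (- m)"
  have l: "0 < (2::real) powi (- m)" by (rule zero_less_power_int) simp
  define y where "y = (1 / 2 powi (- m)) *\<^sub>R x - (\<chi> i. real_of_int (k $ i))"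
  have "x = (2 powi (- m)) *\<^sub>R (y + (\<chi> i. real_of_int (k $ i)))"
    using l by (simp add: y_def)
  moreover have "0 \<le> y $ i \<and> y $ i < 1" for i
    using x[rule_format, of i] l by (simp add: y_def pos_le_divide_eq pos_divide_less_eq algebra_simps)
  ultimately show "x \<in> dyadic_cube m k" by (auto simp: dyadic_cube_def)
qed

lemma dyadic_cube_lebesgue: "dyadic_cube m k \<in> sets lebesgue"
proof -
  have "dyadic_cube m k = (\<Inter>i\<in>UNIV. {x. 2 powi (- m) * of_int (k $ i)
      \<le> x $ i} \<inter> {x. x $ i < 2 powi (- m) * of_int (k $ i) + 2 powi (- m)})"
    by (auto simp: dyadic_cube_iff)
  moreover have "\<dots> \<in> sets borel"
    by (intro sets.finite_INT sets.Int borel_closed borel_open closed_Collect_le open_Collect_less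
        continuous_intros) auto
  ultimately show ?thesis by simp
qed

lemma measure_dyadic_cube:
  fixes k :: "int ^ 'n"
  shows "emeasure lebesgue (dyadic_cube m k) = ennreal ((2 powi (- m)) ^ CARD('n))"
    and "measure lebesgue (dyadic_cube m k) = (2 powi (- m)) ^ CARD('n)"
proof -
  let ?l = "(2::real) powi (- m)"
  let ?a = "\<chi> i. ?l * of_int (k $ i)" and ?b = "\<chi> i. ?l * of_int (k $ i) + ?l"
  have l: "0 < ?l" by (rule zero_less_power_int) simp
  have sub: "box ?a ?b \<subseteq> dyadic_cube m k" "dyadic_cube m k \<subseteq> cbox ?a ?b"
    by (auto simp: dyadic_cube_iff mem_box_cart less_imp_le)
  have "emeasure lebesgue (box ?a ?b) \<le> emeasure lebesgue (dyadic_cube m k)"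
    by (rule emeasure_mono[OF sub(1) dyadic_cube_lebesgue])
  moreover have "emeasure lebesgue (dyadic_cube m k) \<le> emeasure lebesgue (cbox ?a ?b)"
    by (rule emeasure_mono[OF sub(2)]) simp
  moreover have "emeasure lebesgue (box ?a ?b) = emeasure lebesgue (cbox ?a ?b)"
  proof -
    have "emeasure lborel (box ?a ?b) = emeasure lborel (cbox ?a ?b)"
      by (simp only: emeasure_lborel_box_eq emeasure_lborel_cbox_eq)
    then show ?thesis by simp
  qed
  moreover have "emeasure lebesgue (cbox ?a ?b) = ennreal (measure lborel (cbox ?a ?b))"
    using emeasure_eq_ennreal_measure[OF less_imp_neq[OF emeasure_lborel_cbox_finite[unfolded
        infinity_ennreal_def]]]
    by (simp del: emeasure_lborel_cbox measure_lborel_cbox_eq content_cbox_cart)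
  moreover have "measure lborel (cbox ?a ?b) = ?l ^ CARD('n)"
    using l by (subst content_cbox_cart) (auto simp: interval_ne_empty_cart)
  ultimately show em: "emeasure lebesgue (dyadic_cube m k) = ennreal (?l ^ CARD('n))" by simp
  then show "measure lebesgue (dyadic_cube m k) = ?l ^ CARD('n)"
    using l by (simp add: measure_def)
qed

lemma dist_dyadic_square:
  fixes k :: "int ^ 2"
  assumes "x \<in> dyadic_cube m k" "y \<in> dyadic_cube m k"
  shows "dist x y \<le> 2 * 2 powi (- m)"
proof -
  have "\<bar>(x - y) $ i\<bar> \<le> 2 powi (- m)" for i
    using assms[unfolded dyadic_cube_iff] by (smt (verit) vector_minus_component)
  then have "norm (x - y) \<le> (\<Sum>i\<in>(UNIV :: 2 set). 2 powi (- m))"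
    by (intro order_trans[OF norm_le_l1_cart] sum_mono)
  then show ?thesis by (simp add: dist_norm)
qed

lemma ennreal_powr_mono:
  assumes "x \<le> ennreal X" "0 \<le> X" "0 < a"
  shows "ennreal_powr x a \<le> ennreal (X powr a)"
proof -
  have "x \<noteq> \<infinity>" using assms(1) by (auto simp: top_unique)
  moreover have "enn2real x \<le> X" using assms by (simp add: enn2real_leI)
  ultimately show ?thesis
    using assms(3) by (auto simp: ennreal_powr_def intro!: ennreal_leI powr_mono2)
qed

text \<open>The weights of the norm, raised to the power \<open>p\<close> and moved to the other side:
  \<open>l powr (2 * \<tau> * p)\<close> for a square of area \<open>l\<^sup>2\<close> and \<open>2 powr (- i * s * p)\<close> for the frequency
  \<open>2 ^ i\<close>.\<close>

lemma besov_type_norm_finite: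
  fixes T :: "(real ^ 2 \<Rightarrow> complex) \<Rightarrow> complex"
  assumes p: "1 \<le> p" and K: "K > 0"
    and bound: "\<And>m (k :: int ^ 2) i. nat m \<le> i \<Longrightarrow>
      (\<integral>\<^sup>+x\<in>dyadic_cube m k. ennreal (norm (distr_convolution (lp_family \<phi>0 \<phi> i) T x) powr p) \<partial>lebesgue)
        \<le> ennreal (K * (2 powi (- m)) powr (2 * \<tau> * p) * (1 / 2 ^ i) powr (s * p))"
  shows "besov_type_norm \<phi>0 \<phi> s \<tau> (ennreal p) \<infinity> T < \<infinity>"
proof -
  have "besov_type_norm \<phi>0 \<phi> s \<tau> (ennreal p) \<infinity> T \<le> ennreal (K powr (1 / p))"
    unfolding besov_type_norm_def
  proof (rule SUP_least, clarify)
    fix m :: int and k :: "int ^ 2"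
    let ?l = "(2::real) powi (- m)"
    have l: "0 < ?l" by (rule zero_less_power_int) simp
    have "ennreal (2 powr (real i * s)) * Lp_norm_on (ennreal p) (dyadic_cube m k)
        (distr_convolution (lp_family \<phi>0 \<phi> i) T)
        \<le> ennreal (K powr (1 / p) * ?l powr (2 * \<tau>))" if i: "nat m \<le> i" for i
    proof -
      have pp: "enn2real (ennreal p) = p" "ennreal p \<noteq> \<infinity>" using p by auto
      have "Lp_norm_on (ennreal p) (dyadic_cube m k) (distr_convolution (lp_family \<phi>0 \<phi> i) T) \<le>
          ennreal ((K * ?l powr (2 * \<tau> * p) * (1 / 2 ^ i) powr (s * p)) powr (1 / p))"
        unfolding Lp_norm_on_def pp(1) if_not_P[OF pp(2)]
        using bound[OF i] K p by (intro ennreal_powr_mono) auto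
      also have "(K * ?l powr (2 * \<tau> * p) * (1 / 2 ^ i) powr (s * p)) powr (1 / p) =
          K powr (1 / p) * ?l powr (2 * \<tau>) * (1 / 2 ^ i) powr s"
        using p K by (simp add: powr_mult powr_powr)
      finally have "ennreal (2 powr (real i * s)) * Lp_norm_on (ennreal p) (dyadic_cube m k)
          (distr_convolution (lp_family \<phi>0 \<phi> i) T)
          \<le> ennreal (2 powr (real i * s)) * ennreal (K powr (1 / p) * ?l powr (2 * \<tau>) * (1 / 2 ^ i) powr s)"
        by (rule mult_left_mono) simp
      also have "\<dots> = ennreal (2 powr (real i * s) * (K powr (1 / p) * ?l powr (2 * \<tau>) * (1 / 2 ^ i)
          powr s))"
        by (rule ennreal_mult[symmetric]) auto
      also have "2 powr (real i * s) * (K powr (1 / p) * ?l powr (2 * \<tau>) * (1 / 2 ^ i) powr s) = K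
          powr (1 / p) * ?l powr (2 * \<tau>)"
      proof -
        have "(1 / 2 ^ i) powr s * 2 powr (real i * s) = 1"
          by (simp add: powr_divide powr_powr flip: powr_realpow)
        then show ?thesis by (simp add: mult_ac)
      qed
      finally show ?thesis .
    qed
    then have "lq_norm_from \<infinity> (nat m) (\<lambda>i. ennreal (2 powr (real i * s)) *
        Lp_norm_on (ennreal p) (dyadic_cube m k) (distr_convolution (lp_family \<phi>0 \<phi> i) T))
        \<le> ennreal (K powr (1 / p) * ?l powr (2 * \<tau>))"
      unfolding lq_norm_from_def by (auto intro!: SUP_least)
    then have "ennreal (1 / measure lebesgue (dyadic_cube m k) powr \<tau>) *
        lq_norm_from \<infinity> (nat m) (\<lambda>i. ennreal (2 powr (real i * s)) *
        Lp_norm_on (ennreal p) (dyadic_cube m k) (distr_convolution (lp_family \<phi>0 \<phi> i) T))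
        \<le> ennreal (1 / measure lebesgue (dyadic_cube m k) powr \<tau>) * ennreal (K powr (1 / p) * ?l
            powr (2 * \<tau>))"
      by (rule mult_left_mono) simp
    also have "\<dots> = ennreal (1 / measure lebesgue (dyadic_cube m k) powr \<tau> * (K powr (1 / p) * ?l
        powr (2 * \<tau>)))"
      by (rule ennreal_mult[symmetric]) auto
    also have "1 / measure lebesgue (dyadic_cube m k) powr \<tau> * (K powr (1 / p) * ?l powr (2 * \<tau>)) =
        K powr (1 / p)"
    proof -
      have "(?l ^ 2) powr \<tau> = ?l powr (2 * \<tau>)"
        using l powr_powr[of ?l 2 \<tau>] by simp
      then show ?thesis using l by (simp add: measure_dyadic_cube)
    qed
    finally show "ennreal (1 / measure lebesgue (dyadic_cube m k) powr \<tau>) *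
        lq_norm_from \<infinity> (nat m) (\<lambda>i. ennreal (2 powr (real i * s)) *
        Lp_norm_on (ennreal p) (dyadic_cube m k) (distr_convolution (lp_family \<phi>0 \<phi> i) T))
            \<le> ennreal (K powr (1 / p))" .
  qed
  then show ?thesis using le_less_trans ennreal_less_top by (metis infinity_ennreal_def)
qed

lemma besov_type_norm_ge:
  fixes T :: "(real ^ 2 \<Rightarrow> complex) \<Rightarrow> complex" and k :: "int ^ 2"
  assumes p: "1 \<le> p" and X: "0 \<le> X" and i: "nat m \<le> i"
    and bound: "ennreal X \<le> (\<integral>\<^sup>+x\<in>dyadic_cube m k. ennreal (norm (distr_convolution (lp_family \<phi>0 \<phi>
        i) T x) powr p) \<partial>lebesgue)"
  shows "ennreal ((2 powi (- m)) powr (- 2 * \<tau>) * 2 powr (real i * s) * X powr (1 / p)) \<le>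
    besov_type_norm \<phi>0 \<phi> s \<tau> (ennreal p) \<infinity> T"
proof -
  let ?l = "(2::real) powi (- m)"
  have l: "0 < ?l" by (rule zero_less_power_int) simp
  have pp: "enn2real (ennreal p) = p" "ennreal p \<noteq> \<infinity>" using p by auto
  let ?I = "\<integral>\<^sup>+x\<in>dyadic_cube m k. ennreal (norm (distr_convolution (lp_family \<phi>0 \<phi> i) T x) powr p)
      \<partial>lebesgue"
  have "ennreal (X powr (1 / p)) \<le> ennreal_powr ?I (1 / p)"
  proof (cases "?I = \<infinity>")
    case False
    then have "X \<le> enn2real ?I"
      using bound X by (metis enn2real_ennreal enn2real_mono infinity_ennreal_def top.not_eq_extremum)
    then show ?thesis using False X p by (auto simp: ennreal_powr_def intro!: ennreal_leI powr_mono2)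
  qed (simp add: ennreal_powr_def)
  then have Lp: "ennreal (X powr (1 / p)) \<le> Lp_norm_on (ennreal p) (dyadic_cube m k)
      (distr_convolution (lp_family \<phi>0 \<phi> i) T)"
    unfolding Lp_norm_on_def pp(1) if_not_P[OF pp(2)] .
  have "ennreal (2 powr (real i * s)) * ennreal (X powr (1 / p)) \<le>
     ennreal (2 powr (real i * s)) * Lp_norm_on (ennreal p) (dyadic_cube m k) (distr_convolution
         (lp_family \<phi>0 \<phi> i) T)"
    using Lp by (rule mult_left_mono) simp
  also have "\<dots> \<le> lq_norm_from \<infinity> (nat m) (\<lambda>i. ennreal (2 powr (real i * s)) *
        Lp_norm_on (ennreal p) (dyadic_cube m k) (distr_convolution (lp_family \<phi>0 \<phi> i) T))"
    unfolding lq_norm_from_def using i by (auto intro!: SUP_upper2[of i])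
  finally have 1: "ennreal (?l powr (- 2 * \<tau>)) * (ennreal (2 powr (real i * s)) * ennreal (X powr (1
      / p))) \<le>
      ennreal (?l powr (- 2 * \<tau>)) * lq_norm_from \<infinity> (nat m) (\<lambda>i. ennreal (2 powr (real i * s)) *
        Lp_norm_on (ennreal p) (dyadic_cube m k) (distr_convolution (lp_family \<phi>0 \<phi> i) T))"
    by (rule mult_left_mono) simp
  have w: "1 / measure lebesgue (dyadic_cube m k) powr \<tau> = ?l powr (- 2 * \<tau>)"
  proof -
    have "(?l ^ 2) powr \<tau> = ?l powr (2 * \<tau>)"
      using l powr_powr[of ?l 2 \<tau>] by simp
    then show ?thesis by (simp add: measure_dyadic_cube powr_minus_divide)
  qed
  have "ennreal (?l powr (- 2 * \<tau>)) * lq_norm_from \<infinity> (nat m) (\<lambda>i. ennreal (2 powr (real i * s)) *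
        Lp_norm_on (ennreal p) (dyadic_cube m k) (distr_convolution (lp_family \<phi>0 \<phi> i) T)) \<le>
      besov_type_norm \<phi>0 \<phi> s \<tau> (ennreal p) \<infinity> T"
    unfolding besov_type_norm_def by (rule SUP_upper2[of "(m, k)"]) (simp_all add: w)
  with 1 show ?thesis by (simp add: ennreal_mult mult.assoc)
qed

section \<open>The upper estimate\<close>

lemma spiral_edges_nonempty: "spiral_edges \<alpha> \<noteq> {}"
  by (auto simp: spiral_edges_def)

lemma tube_spiral_edges_subset_ball:
  assumes \<alpha>: "\<alpha> > 0" and D: "D \<ge> 1"
  shows "tube D (spiral_edges \<alpha>) \<subseteq> ball 0 (3 * D)"
proof
  fix x assume "x \<in> tube D (spiral_edges \<alpha>)"
  then obtain z where z: "z \<in> spiral_edges \<alpha>" "dist z x < D" by (auto simp: tube_def)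
  have "norm z \<le> 2"
  proof -
    have curve: "norm (spiral_curve \<alpha> \<sigma> t) \<le> 2" if "\<bar>\<sigma>\<bar> = 1" "2 * pi \<le> t" for \<sigma> t
    proof -
      have "norm (spiral_curve \<alpha> \<sigma> t) \<le> (2 * pi) powr (- \<alpha>)"
        unfolding norm_spiral_curve[OF that(1)] using that \<alpha> by (intro powr_mono2') auto
      then show ?thesis using norm_spiral_less_1(2)[OF \<alpha>] by linarith
    qed
    have "norm z \<le> 2" if "z \<in> unit_slit"
      using that norm_le_l1_cart[of z] by (auto simp: unit_slit_def UNIV_2)
    then show ?thesis using z(1) curve by (auto simp: spiral_edges_def)
  qed
  moreover have "norm x \<le> norm z + dist z x"
    using norm_triangle_sub[of x z] by (simp add: dist_norm norm_minus_commute)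
  ultimately show "x \<in> ball 0 (3 * D)" using z(2) D by simp
qed

text \<open>The estimate for tubes of width \<open>\<delta> = 2 powr (- i)\<close> is needed at all widths \<open>2 ^ n * \<delta>\<close>,
  because the kernels have tails. Wider tubes lose at most the factor \<open>2 ^ (3 * n)\<close>, also when
  the width exceeds the size of the square or of the spiral.\<close>

lemma emeasure_wide_tube_square:
  assumes \<alpha>: "\<alpha> > 0" and s: "0 < s" "s \<le> 1" and \<alpha>1: "\<alpha> = 1 \<Longrightarrow> s < 1"
    and h: "0 \<le> h" "s * (1 + 1 / \<alpha>) \<le> 2 - h"
  obtains K where "K > 0"
    "\<And>l \<delta> P n. 0 < \<delta> \<Longrightarrow> \<delta> \<le> 1 \<Longrightarrow> \<delta> \<le> l \<Longrightarrow> P \<in> sets lebesgue \<Longrightarrow>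
       (\<And>x y. x \<in> P \<Longrightarrow> y \<in> P \<Longrightarrow> dist x y \<le> 2 * l) \<Longrightarrow> emeasure lebesgue P \<le> ennreal (l\<^sup>2) \<Longrightarrow>
       emeasure lebesgue (P \<inter> tube (2 ^ n * \<delta>) (spiral_edges \<alpha>))
           \<le> ennreal (K * (2 ^ n) ^ 3 * (l powr h * \<delta> powr s))"
proof (rule emeasure_tube_spiral_edges_square[OF \<alpha> s \<alpha>1 h])
  fix K :: real assume K: "K > 0"
    "\<And>l \<delta> P. 0 < \<delta> \<Longrightarrow> \<delta> \<le> 1 \<Longrightarrow> \<delta> \<le> l \<Longrightarrow> P \<in> sets lebesgue \<Longrightarrow>
       (\<And>x y. x \<in> P \<Longrightarrow> y \<in> P \<Longrightarrow> dist x y \<le> 2 * l) \<Longrightarrow> emeasure lebesgue P \<le> ennreal (l\<^sup>2) \<Longrightarrow>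
       emeasure lebesgue (P \<inter> tube \<delta> (spiral_edges \<alpha>)) \<le> ennreal (K * \<delta> powr s * l powr h)"
  have sq: "s * 1 \<le> s * (1 + 1 / \<alpha>)" using s \<alpha> by (intro mult_left_mono) auto
  have h2: "s + h \<le> 2" using h sq by simp
  have main: "emeasure lebesgue (P \<inter> tube (2 ^ n * \<delta>) (spiral_edges \<alpha>)) \<le>
      ennreal ((K + 36) * (2 ^ n) ^ 3 * (l powr h * \<delta> powr s))"
    if \<delta>: "0 < \<delta>" "\<delta> \<le> 1" "\<delta> \<le> l" and P: "P \<in> sets lebesgue"
        and diam: "\<And>x y. x \<in> P \<Longrightarrow> y \<in> P \<Longrightarrow> dist x y \<le> 2 * l" and area: "emeasure lebesgue P \<le> ennreal (l\<^sup>2)"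
      for l \<delta> P n
  proof -
    define D where "D = 2 ^ n * \<delta>"
    have D: "D > 0" "D powr s \<le> 2 ^ n * \<delta> powr s"
    proof -
      show "D > 0" using \<delta> by (simp add: D_def)
      have "D powr s = (2 ^ n) powr s * \<delta> powr s" using \<delta> by (simp add: D_def powr_mult)
      moreover have "(2 ^ n) powr s \<le> (2 ^ n) powr (1::real)" using s by (intro powr_mono) auto
      ultimately show "D powr s \<le> 2 ^ n * \<delta> powr s" by (simp add: mult_right_mono)
    qed
    have n1: "(1::real) \<le> 2 ^ n" "(2::real) ^ n \<le> (2 ^ n) ^ 3" "((2::real) ^ n)\<^sup>2 \<le> (2 ^ n) ^ 3"
      using power_increasing[of 1 3 "(2::real) ^ n"] power_increasing[of 2 3 "(2::real) ^ n"] by auto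
    have l: "l > 0" using \<delta> by linarith
    have widen: "emeasure lebesgue (P \<inter> tube D (spiral_edges \<alpha>))
        \<le> ennreal ((K + 36) * (2 ^ n) ^ 3 * (l powr h * \<delta> powr s))"
      if "emeasure lebesgue (P \<inter> tube D (spiral_edges \<alpha>)) \<le> ennreal c" "c
          \<le> c' * (l powr h * \<delta> powr s)" "c' \<le> (K + 36) * (2 ^ n) ^ 3" for c c'
    proof -
      have "c \<le> (K + 36) * (2 ^ n) ^ 3 * (l powr h * \<delta> powr s)"
        using that(2) mult_right_mono[OF that(3), of "l powr h * \<delta> powr s"] by simp
      from order_trans[OF that(1) ennreal_leI[OF this]] show ?thesis .
    qed
    consider "D \<le> 1" "D \<le> l" | "l < D" "l \<le> 1" | "1 < D" "1 < l" by linarith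
    then have "emeasure lebesgue (P \<inter> tube D (spiral_edges \<alpha>))
        \<le> ennreal ((K + 36) * (2 ^ n) ^ 3 * (l powr h * \<delta> powr s))"
    proof cases
      case 1
      show ?thesis
      proof (rule widen[OF K(2)[OF D(1) 1 P diam area]])
        have "K * D powr s * l powr h \<le> K * (2 ^ n * \<delta> powr s) * l powr h"
          using D(2) K(1) by (intro mult_right_mono mult_left_mono) auto
        then show "K * D powr s * l powr h \<le> (K * 2 ^ n) * (l powr h * \<delta> powr s)" by (simp add: mult_ac)
        show "K * 2 ^ n \<le> (K + 36) * (2 ^ n) ^ 3" using K(1) n1 by (intro mult_mono) auto
      qed
    next
      case 2
      have "emeasure lebesgue (P \<inter> tube D (spiral_edges \<alpha>)) \<le> emeasure lebesgue P"
        using P by (intro emeasure_mono) auto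
      then show ?thesis
      proof (rule widen[OF order_trans[OF _ area]])
        have "l\<^sup>2 = l powr (2 - h) * l powr h" using l by (simp flip: powr_add)
        also have "\<dots> \<le> l powr s * l powr h" using l 2 h2 by (intro mult_right_mono powr_mono') auto
        also have "\<dots> \<le> D powr s * l powr h" using l 2 s by (intro mult_right_mono powr_mono2) auto
        also have "\<dots> \<le> 2 ^ n * \<delta> powr s * l powr h" using D by (intro mult_right_mono) auto
        finally show "l\<^sup>2 \<le> 2 ^ n * (l powr h * \<delta> powr s)" by (simp add: mult_ac)
        have "1 * 2 ^ n \<le> (K + 36) * (2 ^ n) ^ 3" using K(1) n1 by (intro mult_mono) auto
        then show "2 ^ n \<le> (K + 36) * (2 ^ n) ^ 3" by simp
      qed
    next
      case 3
      have "emeasure lebesgue (P \<inter> tube D (spiral_edges \<alpha>)) \<le> ennreal (4 * (3 * D)\<^sup>2)"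
        using tube_spiral_edges_subset_ball[OF \<alpha>, of D] 3 by (intro emeasure_subset_ball_le[of _ _ 0]) auto
      then show ?thesis
      proof (rule widen)
        have "\<delta>\<^sup>2 = \<delta> powr 2" using \<delta> by simp
        also have "\<dots> \<le> \<delta> powr s" using \<delta> s by (intro powr_mono') auto
        also have "\<dots> \<le> l powr h * \<delta> powr s"
        proof -
          have "1 \<le> l powr h" using 3 h by (intro ge_one_powr_ge_zero) auto
          then have "1 * \<delta> powr s \<le> l powr h * \<delta> powr s" by (intro mult_right_mono) auto
          then show ?thesis by simp
        qed
        finally have "36 * (2 ^ n)\<^sup>2 * \<delta>\<^sup>2 \<le> 36 * (2 ^ n)\<^sup>2 * (l powr h * \<delta> powr s)"
          by (intro mult_left_mono) auto
        then show "4 * (3 * D)\<^sup>2 \<le> (36 * (2 ^ n)\<^sup>2) * (l powr h * \<delta> powr s)"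
          by (simp add: D_def power_mult_distrib)
        show "36 * (2 ^ n)\<^sup>2 \<le> (K + 36) * (2 ^ n) ^ 3" using K(1) n1 by (intro mult_mono) auto
      qed
    qed
    then show ?thesis by (simp add: D_def)
  qed
  have "K + 36 > 0" using K(1) by simp
  then show thesis using main by (rule that)
qed

lemma admissible_pair_mean_zero:
  fixes \<phi> :: "real ^ 'n \<Rightarrow> complex"
  assumes "admissible_pair \<phi>0 \<phi>"
  shows "(LINT z|lebesgue. \<phi> z) = 0"
proof -
  have "closure {\<xi>. fourier_transform \<phi> \<xi> \<noteq> 0} \<subseteq> {\<xi>. 1/2 \<le> norm \<xi> \<and> norm \<xi> \<le> 2}"
    using assms by (simp add: admissible_pair_def)
  then have sub: "{\<xi>. fourier_transform \<phi> \<xi> \<noteq> 0} \<subseteq> {\<xi>. 1/2 \<le> norm \<xi> \<and> norm \<xi> \<le> 2}"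
    by (rule order_trans[OF closure_subset])
  have "0 \<notin> {\<xi>. fourier_transform \<phi> \<xi> \<noteq> 0}"
  proof
    assume "0 \<in> {\<xi>. fourier_transform \<phi> \<xi> \<noteq> 0}"
    with sub have "(0 :: real ^ 'n) \<in> {\<xi>. 1/2 \<le> norm \<xi> \<and> norm \<xi> \<le> 2}" by (rule subsetD)
    then show False by simp
  qed
  then have "fourier_transform \<phi> 0 = 0" by simp
  then show ?thesis by (simp add: fourier_transform_def)
qed

lemma powr_le_of_decay:
  fixes a C t p :: real
  assumes "0 \<le> a" "a \<le> C / (1 + t) ^ N" "0 \<le> t" "1 \<le> p" "0 < C"
  shows "a powr p \<le> C powr p * (1 / (1 + t) ^ N)"
proof -
  have q: "1 \<le> (1 + t) ^ N" using assms by simp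
  have "a powr p \<le> (C / (1 + t) ^ N) powr p" using assms by (intro powr_mono2) auto
  also have "\<dots> = C powr p * (1 / (1 + t) ^ N) powr p"
    using assms by (simp add: powr_divide)
  also have "\<dots> \<le> C powr p * (1 / (1 + t) ^ N) powr 1"
    using q assms by (intro mult_left_mono powr_mono') auto
  also have "\<dots> = C powr p * (1 / (1 + t) ^ N)" using q by simp
  finally show ?thesis .
qed

text \<open>The kernel is small at distances much larger than \<open>\<delta>\<close> from the edges, so the integral is a
  sum over the tubes of width \<open>2 ^ n * \<delta>\<close> with weights of order \<open>2 ^ (- 4 * n)\<close>, which beat
  the factor \<open>2 ^ (3 * n)\<close> lost for wide tubes.\<close>

lemma integral_dilated_conv_spiral_le:
  assumes \<phi>: "\<phi> \<in> schwartz_space" "(LINT z|lebesgue. \<phi> z) = 0" and \<alpha>: "\<alpha> > 0" and p: "1 \<le> p"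
    and s: "0 < s" "s \<le> 1" and \<alpha>1: "\<alpha> = 1 \<Longrightarrow> s < 1"
    and h: "0 \<le> h" "s * (1 + 1 / \<alpha>) \<le> 2 - h"
  obtains K where "K > 0"
    "\<And>l \<delta> P. 0 < \<delta> \<Longrightarrow> \<delta> \<le> 1 \<Longrightarrow> \<delta> \<le> l \<Longrightarrow> P \<in> sets lebesgue \<Longrightarrow>
       (\<And>x y. x \<in> P \<Longrightarrow> y \<in> P \<Longrightarrow> dist x y \<le> 2 * l) \<Longrightarrow> emeasure lebesgue P \<le> ennreal (l\<^sup>2) \<Longrightarrow>
       (\<integral>\<^sup>+x\<in>P. ennreal (norm (dilated_conv (spiral \<alpha>) \<phi> (1 / \<delta>) x) powr p) \<partial>lebesgue) \<le>
         ennreal (K * l powr h * \<delta> powr s)"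
proof (rule emeasure_wide_tube_square[OF \<alpha> s \<alpha>1 h])
  fix K :: real assume K: "K > 0"
    "\<And>l \<delta> P n. 0 < \<delta> \<Longrightarrow> \<delta> \<le> 1 \<Longrightarrow> \<delta> \<le> l \<Longrightarrow> P \<in> sets lebesgue \<Longrightarrow>
       (\<And>x y. x \<in> P \<Longrightarrow> y \<in> P \<Longrightarrow> dist x y \<le> 2 * l) \<Longrightarrow> emeasure lebesgue P \<le> ennreal (l\<^sup>2) \<Longrightarrow>
       emeasure lebesgue (P \<inter> tube (2 ^ n * \<delta>) (spiral_edges \<alpha>))
           \<le> ennreal (K * (2 ^ n) ^ 3 * (l powr h * \<delta> powr s))"
  have E: "spiral \<alpha> \<in> sets lebesgue" using spiral_lmeasurable[OF \<alpha>] by (rule fmeasurableD)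
  obtain C where C: "C > 0"
    "\<And>A x d. 0 < A \<Longrightarrow> 0 \<le> d \<Longrightarrow> ball x d \<inter> frontier (spiral \<alpha>) = {} \<Longrightarrow>
       norm (dilated_conv (spiral \<alpha>) \<phi> A x) \<le> C / (1 + A * d) ^ 4"
    using dilated_conv_away_from_frontier[OF \<phi> E, of 4] by blast
  define M where "M = C powr p * (32 * K)"
  have M: "M > 0" using C(1) K(1) by (simp add: M_def)
  have main: "(\<integral>\<^sup>+x\<in>P. ennreal (norm (dilated_conv (spiral \<alpha>) \<phi> (1 / \<delta>) x) powr p) \<partial>lebesgue) \<le>
         ennreal (M * l powr h * \<delta> powr s)"
    if \<delta>: "0 < \<delta>" "\<delta> \<le> 1" "\<delta> \<le> l" and P: "P \<in> sets lebesgue"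
        and diam: "\<And>x y. x \<in> P \<Longrightarrow> y \<in> P \<Longrightarrow> dist x y \<le> 2 * l" and area: "emeasure lebesgue P \<le> ennreal (l\<^sup>2)"
      for l \<delta> P
  proof -
    let ?Z = "spiral_edges \<alpha>" and ?f = "dilated_conv (spiral \<alpha>) \<phi> (1 / \<delta>)" and ?X = "l powr h * \<delta> powr s"
    have pointwise: "ennreal (norm (?f x) powr p) \<le>
        (\<Sum>n. ennreal (C powr p) * ennreal ((2 / 2 ^ n) ^ 4) * indicator (tube (2 ^ n * \<delta>) ?Z) x)" for x
    proof -
      define d where "d = infdist x ?Z"
      have d: "0 \<le> d" by (simp add: d_def infdist_nonneg)
      have "ball x d \<inter> ?Z = {}"
        using infdist_le[of _ ?Z x] by (fastforce simp: d_def)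
      then have "ball x d \<inter> frontier (spiral \<alpha>) = {}" using frontier_spiral_subset[OF \<alpha>] by blast
      then have "norm (?f x) \<le> C / (1 + d / \<delta>) ^ 4"
        using C(2)[of "1 / \<delta>" d x] \<delta> d by simp
      then have "norm (?f x) powr p \<le> C powr p * (1 / (1 + d / \<delta>) ^ 4)"
        using d \<delta> p C(1) by (intro powr_le_of_decay) auto
      then have "ennreal (norm (?f x) powr p) \<le> ennreal (C powr p * (1 / (1 + d / \<delta>) ^ 4))"
        by (rule ennreal_leI)
      also have "\<dots> = ennreal (C powr p) * ennreal (1 / (1 + d / \<delta>) ^ 4)"
        using d \<delta> by (intro ennreal_mult) auto
      also have "\<dots> \<le> ennreal (C powr p) * (\<Sum>n. ennreal ((2 / 2 ^ n) ^ 4) * indicator {..<2 ^ n} (d / \<delta>))"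
        using d \<delta> by (intro mult_left_mono inverse_power_le_layers) auto
      also have "\<dots> = (\<Sum>n. ennreal (C powr p) * (ennreal ((2 / 2 ^ n) ^ 4) * indicator {..<2 ^ n} (d / \<delta>)))"
        by (rule ennreal_suminf_cmult[symmetric])
      also have "\<dots> \<le> (\<Sum>n. ennreal (C powr p) * ennreal ((2 / 2 ^ n) ^ 4) * indicator (tube (2 ^ n *
          \<delta>) ?Z) x)"
      proof (rule suminf_le)
        fix n
        show "ennreal (C powr p) * (ennreal ((2 / 2 ^ n) ^ 4) * indicator {..<2 ^ n} (d / \<delta>)) \<le>
          ennreal (C powr p) * ennreal ((2 / 2 ^ n) ^ 4) * indicator (tube (2 ^ n * \<delta>) ?Z) x"
        proof (cases "d / \<delta> < 2 ^ n")
          case True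
          then have "infdist x ?Z < 2 ^ n * \<delta>" using \<delta> by (simp add: d_def field_simps)
          then have "\<exists>z\<in>?Z. dist x z < 2 ^ n * \<delta>"
            unfolding infdist_notempty[OF spiral_edges_nonempty]
            by (subst (asm) cINF_less_iff) (auto simp: spiral_edges_nonempty)
          then have "x \<in> tube (2 ^ n * \<delta>) ?Z" by (auto simp: tube_def dist_commute)
          then show ?thesis by (simp add: indicator_def mult.assoc)
        qed simp
      qed auto
      finally show ?thesis .
    qed
    have "(\<integral>\<^sup>+x\<in>P. ennreal (norm (?f x) powr p) \<partial>lebesgue) \<le>
      (\<integral>\<^sup>+x. (\<Sum>n. ennreal (C powr p) * ennreal ((2 / 2 ^ n) ^ 4) * indicator (P \<inter> tube (2 ^ n * \<delta>)
          ?Z) x) \<partial>lebesgue)"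
    proof (rule nn_integral_mono)
      fix x
      show "ennreal (norm (?f x) powr p) * indicator P x \<le>
        (\<Sum>n. ennreal (C powr p) * ennreal ((2 / 2 ^ n) ^ 4) * indicator (P \<inter> tube (2 ^ n * \<delta>) ?Z) x)"
        using pointwise[of x] by (cases "x \<in> P") (simp_all add: indicator_def)
    qed
    also have "\<dots> = (\<Sum>n. \<integral>\<^sup>+x. ennreal (C powr p) * ennreal ((2 / 2 ^ n) ^ 4) * indicator (P \<inter> tube
        (2 ^ n * \<delta>) ?Z) x \<partial>lebesgue)"
      using P by (intro nn_integral_suminf borel_measurable_times_ennreal borel_measurable_const
          borel_measurable_indicator sets.Int) auto
    also have "\<dots> = (\<Sum>n. ennreal (C powr p) * ennreal ((2 / 2 ^ n) ^ 4) * emeasure lebesgue (P \<inter> tube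
        (2 ^ n * \<delta>) ?Z))"
      by (intro suminf_cong nn_integral_cmult_indicator) (use P in auto)
    also have "\<dots> \<le> (\<Sum>n. ennreal (M / 2 * ?X * (1 / 2) ^ n))"
    proof (rule suminf_le)
      fix n
      have "ennreal (C powr p) * ennreal ((2 / 2 ^ n) ^ 4) * emeasure lebesgue (P \<inter> tube (2 ^ n * \<delta>) ?Z) \<le>
         ennreal (C powr p) * ennreal ((2 / 2 ^ n) ^ 4) * ennreal (K * (2 ^ n) ^ 3 * ?X)"
        by (intro mult_left_mono K(2) \<delta> P diam area) auto
      also have "\<dots> = ennreal (C powr p * (2 / 2 ^ n) ^ 4 * (K * (2 ^ n) ^ 3 * ?X))"
        using K(1) by (simp add: ennreal_mult)
      also have "C powr p * (2 / 2 ^ n) ^ 4 * (K * (2 ^ n) ^ 3 * ?X) = M / 2 * ?X * (1 / 2) ^ n"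
      proof -
        define u where "u = (2::real) ^ n"
        have "u > 0" by (simp add: u_def)
        then have "(2 / u) ^ 4 * u ^ 3 = 16 * (1 / u)" by (simp add: power_divide field_simps
            power4_eq_xxxx power3_eq_cube)
        then have "(2 / 2 ^ n) ^ 4 * (2 ^ n) ^ 3 = 16 * (1 / (2::real)) ^ n"
            by (simp add: u_def power_one_over)
        then have "C powr p * K * ?X * ((2 / 2 ^ n) ^ 4 * (2 ^ n) ^ 3) = C powr p * K * ?X * (16 *
            (1 / (2::real)) ^ n)"
          by simp
        then show ?thesis by (simp add: M_def mult_ac)
      qed
      finally show "ennreal (C powr p) * ennreal ((2 / 2 ^ n) ^ 4) * emeasure lebesgue (P \<inter> tube (2
          ^ n * \<delta>) ?Z) \<le>
         ennreal (M / 2 * ?X * (1 / 2) ^ n)" .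
    qed auto
    also have "\<dots> = ennreal (\<Sum>n. M / 2 * ?X * (1 / 2) ^ n)"
      using M by (intro suminf_ennreal2) (auto intro!: summable_mult summable_geometric)
    also have "(\<Sum>n. M / 2 * ?X * (1 / 2) ^ n) = M * l powr h * \<delta> powr s"
      by (subst suminf_mult) (auto intro!: summable_geometric simp: suminf_geometric)
    finally show ?thesis .
  qed
  show thesis using M main by (rule that)
qed

text \<open>The kernel \<open>\<phi>0\<close> has no mean zero property, but it occurs at a single scale, and there only
  on squares of side at least \<open>1\<close>; a bound uniform in the square suffices.\<close>

lemma integral_conv_spiral_coarse:
  assumes \<phi>0: "\<phi>0 \<in> schwartz_space" and \<alpha>: "\<alpha> > 0" and p: "1 \<le> p"
  obtains K where "K > 0"
    "\<And>P. (\<integral>\<^sup>+x\<in>P. ennreal (norm (dilated_conv (spiral \<alpha>) \<phi>0 1 x) powr p) \<partial>lebesgue) \<le> ennreal K"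
proof -
  have E: "spiral \<alpha> \<in> sets lebesgue" using spiral_lmeasurable[OF \<alpha>] by (rule fmeasurableD)
  obtain C where C: "C > 0"
    "\<And>x d. 0 \<le> d \<Longrightarrow> ball x d \<inter> spiral \<alpha> = {} \<Longrightarrow> norm (dilated_conv (spiral \<alpha>) \<phi>0 1 x) \<le> C / (1 + d) ^ 3"
    using dilated_conv_away_from_set[OF \<phi>0 E, of 3] by blast
  define I where "I = (LINT x::real^2|lebesgue. 1 / (1 + norm x) ^ 3)"
  have int: "integrable lebesgue (\<lambda>x::real^2. 1 / (1 + norm x) ^ 3)"
    using integrable_inverse_power_norm[where 'n = 2] by simp
  have I: "I \<ge> 0" unfolding I_def by (rule integral_nonneg_AE) auto
  define M where "M = C powr p * 8"
  have pw: "norm (dilated_conv (spiral \<alpha>) \<phi>0 1 x) powr p \<le> M * (1 / (1 + norm x) ^ 3)" for x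
  proof -
    define d where "d = max 0 (norm x - 1)"
    have "ball x d \<inter> spiral \<alpha> = {}"
    proof (rule ccontr)
      assume "ball x d \<inter> spiral \<alpha> \<noteq> {}"
      then obtain y where y: "dist x y < d" "y \<in> spiral \<alpha>" by auto
      have "norm y < 1" using y(2) norm_spiral_less_1[OF \<alpha>] by fastforce
      moreover have "norm x \<le> norm y + dist x y" using norm_triangle_sub[of x y] by (simp add: dist_norm)
      ultimately show False using y(1) zero_le_dist[of x y] by (auto simp: d_def max_def split: if_splits)
    qed
    then have "norm (dilated_conv (spiral \<alpha>) \<phi>0 1 x) \<le> C / (1 + d) ^ 3" by (intro C(2)) (auto simp: d_def)
    then have "norm (dilated_conv (spiral \<alpha>) \<phi>0 1 x) powr p \<le> C powr p * (1 / (1 + d) ^ 3)"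
      using p C(1) by (intro powr_le_of_decay) (auto simp: d_def)
    also have "\<dots> \<le> C powr p * (8 * (1 / (1 + norm x) ^ 3))"
    proof (intro mult_left_mono)
      have "1 + norm x \<le> 2 * (1 + d)" by (auto simp: d_def max_def)
      then have "(1 + norm x) ^ 3 \<le> (2 * (1 + d)) ^ 3" by (intro power_mono) auto
      moreover have "(2 * (1 + d)) ^ 3 = 8 * (1 + d) ^ 3" unfolding power_mult_distrib by simp
      ultimately have "(1 + norm x) ^ 3 \<le> 8 * (1 + d) ^ 3" by linarith
      moreover have "0 < 1 + d" "0 < 1 + norm x" by (auto simp: d_def add_pos_nonneg)
      ultimately show "1 / (1 + d) ^ 3 \<le> 8 * (1 / (1 + norm x) ^ 3)"
        by (simp add: divide_le_eq pos_le_divide_eq mult.commute)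
    qed simp
    finally show ?thesis by (simp add: M_def mult.assoc)
  qed
  have "(\<integral>\<^sup>+x\<in>P. ennreal (norm (dilated_conv (spiral \<alpha>) \<phi>0 1 x) powr p) \<partial>lebesgue)
      \<le> ennreal (M * I + 1)" for P
  proof -
    have "(\<integral>\<^sup>+x\<in>P. ennreal (norm (dilated_conv (spiral \<alpha>) \<phi>0 1 x) powr p) \<partial>lebesgue) \<le>
       (\<integral>\<^sup>+x. ennreal (M * (1 / (1 + norm (x :: real ^ 2)) ^ 3)) \<partial>lebesgue)"
      using pw by (intro nn_integral_mono) (auto simp: indicator_def intro!: ennreal_leI)
    also have "\<dots> = ennreal (LINT x::real^2|lebesgue. M * (1 / (1 + norm x) ^ 3))"
      using int by (intro nn_integral_eq_integral integrable_mult_right) (auto simp: M_def)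
    also have "(LINT x::real^2|lebesgue. M * (1 / (1 + norm x) ^ 3)) = M * I"
      unfolding I_def by (rule integral_mult_right_zero)
    also have "ennreal (M * I) \<le> ennreal (M * I + 1)" by (rule ennreal_leI) simp
    finally show ?thesis .
  qed
  moreover have "M * I + 1 > 0" using I by (simp add: M_def add_nonneg_pos)
  ultimately show ?thesis using that by blast
qed

lemma besov_type_norm_spiral_finite:
  fixes \<phi>0 \<phi> :: "real ^ 2 \<Rightarrow> complex"
  assumes adm: "admissible_pair \<phi>0 \<phi>" and \<alpha>: "\<alpha> > 0" and p: "1 \<le> p" and \<tau>: "0 \<le> \<tau>"
    and s: "0 < s" "s * p \<le> 1" and \<alpha>1: "\<alpha> = 1 \<Longrightarrow> s * p < 1"
    and st: "s * p * (1 + 1 / \<alpha>) \<le> 2 - 2 * \<tau> * p"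
  shows "besov_type_norm \<phi>0 \<phi> s \<tau> (ennreal p) \<infinity> (regular_distribution (indicator (spiral \<alpha>))) < \<infinity>"
proof -
  have \<phi>: "\<phi> \<in> schwartz_space" "\<phi>0 \<in> schwartz_space" using adm by (auto simp: admissible_pair_def)
  have mean: "(LINT z|lebesgue. \<phi> z) = 0" by (rule admissible_pair_mean_zero[OF adm])
  have E: "spiral \<alpha> \<in> sets lebesgue" using spiral_lmeasurable[OF \<alpha>] by (rule fmeasurableD)
  have sp: "0 < s * p" and h: "0 \<le> 2 * \<tau> * p" using s p \<tau> by auto
  obtain K0 where K0: "K0 > 0"
    "\<And>P. (\<integral>\<^sup>+x\<in>P. ennreal (norm (dilated_conv (spiral \<alpha>) \<phi>0 1 x) powr p) \<partial>lebesgue) \<le> ennreal K0"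
    using integral_conv_spiral_coarse[OF \<phi>(2) \<alpha> p] by blast
  show ?thesis
  proof (rule integral_dilated_conv_spiral_le[OF \<phi>(1) mean \<alpha> p sp s(2) \<alpha>1 h st])
    fix K :: real assume K: "K > 0"
    "\<And>l \<delta> P. 0 < \<delta> \<Longrightarrow> \<delta> \<le> 1 \<Longrightarrow> \<delta> \<le> l \<Longrightarrow> P \<in> sets lebesgue \<Longrightarrow>
       (\<And>x y. x \<in> P \<Longrightarrow> y \<in> P \<Longrightarrow> dist x y \<le> 2 * l) \<Longrightarrow> emeasure lebesgue P \<le> ennreal (l\<^sup>2) \<Longrightarrow>
       (\<integral>\<^sup>+x\<in>P. ennreal (norm (dilated_conv (spiral \<alpha>) \<phi> (1 / \<delta>) x) powr p) \<partial>lebesgue) \<le>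
         ennreal (K * l powr (2 * \<tau> * p) * \<delta> powr (s * p))"
    show ?thesis
    proof (rule besov_type_norm_finite[OF p])
      show "K + K0 > 0" using K(1) K0(1) by simp
      fix m :: int and k :: "int ^ 2" and i assume i: "nat m \<le> i"
      let ?l = "(2::real) powi (- m)"
      have l: "?l > 0" by (rule zero_less_power_int) simp
      show "(\<integral>\<^sup>+x\<in>dyadic_cube m k. ennreal (norm (distr_convolution (lp_family \<phi>0 \<phi> i)
          (regular_distribution (indicator (spiral \<alpha>))) x) powr p) \<partial>lebesgue)
        \<le> ennreal ((K + K0) * ?l powr (2 * \<tau> * p) * (1 / 2 ^ i) powr (s * p))"
      proof (cases "i = 0")
        case True
        then have "1 \<le> ?l" using i by (simp add: one_le_power_int)
        then have "1 \<le> ?l powr (2 * \<tau> * p)" using h by (intro ge_one_powr_ge_zero) auto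
        then have "K0 * 1 \<le> (K + K0) * ?l powr (2 * \<tau> * p)" using K(1) K0(1) by (intro mult_mono) auto
        from order_trans[OF K0(2) ennreal_leI[OF this[unfolded mult_1_right]]] show ?thesis
          using True by (simp add: distr_convolution_lp_family[OF E \<phi>])
      next
        case False
        have "1 / 2 ^ i \<le> ?l"
        proof -
          have "(2::real) powi (- int i) \<le> 2 powi (- m)" using i by (intro power_int_increasing) auto
          then show ?thesis by (simp add: power_int_minus divide_inverse)
        qed
        then have "(\<integral>\<^sup>+x\<in>dyadic_cube m k. ennreal (norm (dilated_conv (spiral \<alpha>) \<phi> (1 / (1 / 2 ^ i))
            x) powr p) \<partial>lebesgue) \<le>
           ennreal (K * ?l powr (2 * \<tau> * p) * (1 / 2 ^ i) powr (s * p))"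
          by (intro K(2)) (auto simp: dyadic_cube_lebesgue measure_dyadic_cube dist_dyadic_square)
        also have "\<dots> \<le> ennreal ((K + K0) * ?l powr (2 * \<tau> * p) * (1 / 2 ^ i) powr (s * p))"
          using K0(1) by (intro ennreal_leI mult_right_mono) auto
        finally show ?thesis using False by (simp add: distr_convolution_lp_family[OF E \<phi>])
      qed
    qed
  qed
qed

section \<open>Edges of the spiral at small scales\<close>

lemma powr_neg_diff_ge:
  fixes x y \<beta> :: real
  assumes "0 < x" "x \<le> y" "\<beta> > 0"
  shows "\<beta> * y powr (- \<beta> - 1) * (y - x) \<le> x powr (- \<beta>) - y powr (- \<beta>)"
proof (cases "x = y")
  case False
  then have xy: "x < y" using assms by simp
  have "\<exists>z>x. z < y \<and> y powr (- \<beta>) - x powr (- \<beta>) = (y - x) * (- \<beta> * z powr (- \<beta> - 1))"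
    using xy assms by (intro MVT2) (auto intro!: derivative_eq_intros simp: powr_diff)
  then obtain z where z: "x < z" "z < y"
    "y powr (- \<beta>) - x powr (- \<beta>) = (y - x) * (- \<beta> * z powr (- \<beta> - 1))" by blast
  have "y powr (- \<beta> - 1) \<le> z powr (- \<beta> - 1)" using z assms by (intro powr_mono2') auto
  then have "\<beta> * y powr (- \<beta> - 1) * (y - x) \<le> \<beta> * z powr (- \<beta> - 1) * (y - x)"
    using assms by (intro mult_right_mono mult_left_mono) auto
  then show ?thesis using z(3) by (simp add: algebra_simps)
qed simp

text \<open>To first order the radius changes by the component of \<open>Y / A\<close> in direction \<open>\<theta>\<close>, which is
  close to \<open>Re Y / A\<close> for small \<open>\<theta>\<close>; the second order term is small if \<open>A * r\<close> is large.\<close>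

lemma norm_perturbed_cis:
  fixes r A e B \<theta> \<eta> :: real
  assumes A: "A > 0" and r: "r > 0" and e: "0 < e" "e < B"
    and Q: "2 * B \<le> A * r" "2 * B\<^sup>2 \<le> e * (A * r)"
    and \<theta>: "0 \<le> \<theta>" "\<theta> \<le> 1 / 2" "B * \<theta> \<le> e / 4" and Y: "norm Y < B"
  shows "Re Y < - e \<Longrightarrow> norm (of_real r * cis \<theta> + of_real (1 / A) * Y) \<le> r - e / (4 * A)"
    and "e < Re Y \<Longrightarrow> r + e / (4 * A) \<le> norm (of_real r * cis \<theta> + of_real (1 / A) * Y)"
proof -
  define w where "w = of_real r * cis \<theta> + of_real (1 / A) * Y"
  define u where "u = Re Y * cos \<theta> + Im Y * sin \<theta>"
  have nw: "(norm w)\<^sup>2 = r\<^sup>2 + 2 * r * u / A + (norm Y)\<^sup>2 / A\<^sup>2"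
  proof -
    have "(norm w)\<^sup>2 = (r * cos \<theta> + Re Y / A)\<^sup>2 + (r * sin \<theta> + Im Y / A)\<^sup>2"
      by (simp add: w_def cmod_power2)
    also have "\<dots> = r\<^sup>2 * ((cos \<theta>)\<^sup>2 + (sin \<theta>)\<^sup>2) + 2 * r * u / A + ((Re Y)\<^sup>2 + (Im Y)\<^sup>2) / A\<^sup>2"
      by (simp add: u_def power2_sum power_mult_distrib power_divide algebra_simps add_divide_distrib
          del: sin_cos_squared_add sin_cos_squared_add2 sin_cos_squared_add3)
    finally show ?thesis by (simp only: sin_cos_squared_add2 cmod_power2 mult_1_right)
  qed
  have cos: "3 / 4 \<le> cos \<theta>"
  proof -
    have "\<theta>\<^sup>2 \<le> (1 / 2)\<^sup>2" using \<theta> by (intro power_mono) auto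
    moreover have "(sin (\<theta> / 2))\<^sup>2 \<le> (\<theta> / 2)\<^sup>2"
      unfolding abs_le_square_iff[symmetric] by (rule abs_sin_x_le_abs_x)
    ultimately show ?thesis
      using cos_double_sin[of "\<theta> / 2"] by (simp add: power2_eq_square)
  qed
  have "\<bar>Im Y * sin \<theta>\<bar> \<le> B * \<theta>"
  proof -
    have "\<bar>Im Y\<bar> \<le> B" using abs_Im_le_cmod[of Y] Y by linarith
    moreover have "\<bar>sin \<theta>\<bar> \<le> \<theta>" using abs_sin_x_le_abs_x[of \<theta>] \<theta> by simp
    ultimately show ?thesis unfolding abs_mult using \<theta> by (intro mult_mono) auto
  qed
  then have sin: "\<bar>Im Y * sin \<theta>\<bar> \<le> e / 4" using \<theta> by linarith
  have Y2: "0 \<le> (norm Y)\<^sup>2 / A\<^sup>2" "(norm Y)\<^sup>2 / A\<^sup>2 \<le> r * e / (2 * A)"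
  proof -
    show "0 \<le> (norm Y)\<^sup>2 / A\<^sup>2" by simp
    have "(norm Y)\<^sup>2 \<le> B\<^sup>2" using Y by (intro power_mono) auto
    then have "(norm Y)\<^sup>2 \<le> e * (A * r) / 2" using Q by simp
    then have "(norm Y)\<^sup>2 / A\<^sup>2 \<le> e * (A * r) / 2 / A\<^sup>2" by (intro divide_right_mono) auto
    then show "(norm Y)\<^sup>2 / A\<^sup>2 \<le> r * e / (2 * A)" using A by (simp add: power2_eq_square mult_ac)
  qed
  have re: "e / (4 * A) \<le> r / 8"
  proof -
    have "2 * e \<le> A * r" using Q e by linarith
    then show ?thesis using A by (simp add: field_simps)
  qed
  show "norm (of_real r * cis \<theta> + of_real (1 / A) * Y) \<le> r - e / (4 * A)" if "Re Y < - e"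
  proof -
    have "e * (3 / 4) \<le> (- Re Y) * cos \<theta>" using that cos e by (intro mult_mono) auto
    then have "u \<le> - e / 2" using sin unfolding u_def by linarith
    then have "2 * r * u / A \<le> 2 * r * (- e / 2) / A" using A r
        by (intro divide_right_mono mult_left_mono) auto
    then have "(norm w)\<^sup>2 \<le> r\<^sup>2 - r * e / (2 * A)" 
    proof -
      have "2 * r * (- e / 2) / A = - 2 * (r * e / (2 * A))" by simp
      then show ?thesis unfolding nw using \<open>2 * r * u / A \<le> _\<close> Y2 by linarith
    qed
    also have "\<dots> \<le> (r - e / (4 * A))\<^sup>2"
    proof -
      have "0 \<le> (e / (4 * A))\<^sup>2" by simp
      moreover have "(r - e / (4 * A))\<^sup>2 = r\<^sup>2 - r * e / (2 * A) + (e / (4 * A))\<^sup>2"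
        by (simp add: power2_diff)
      ultimately show ?thesis by linarith
    qed
    finally have "norm w \<le> r - e / (4 * A)" by (rule power2_le_imp_le) (use re r in linarith)
    then show ?thesis by (simp add: w_def)
  qed
  show "r + e / (4 * A) \<le> norm (of_real r * cis \<theta> + of_real (1 / A) * Y)" if "e < Re Y"
  proof -
    have "e * (3 / 4) \<le> Re Y * cos \<theta>" using that cos e by (intro mult_mono) auto
    then have "e / 2 \<le> u" using sin unfolding u_def by linarith
    then have "2 * r * (e / 2) / A \<le> 2 * r * u / A" using A r
        by (intro divide_right_mono mult_left_mono) auto
    moreover have "2 * r * (e / 2) / A = r * e / A" by simp
    ultimately have h: "r * e / A \<le> 2 * r * u / A" by (simp only:)
    have nwl: "r\<^sup>2 + r * e / A \<le> (norm w)\<^sup>2"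
      unfolding nw using add_mono[OF add_left_mono[OF h, of "r\<^sup>2"] Y2(1)] by (simp only: add_0_right)
    have "(r + e / (4 * A))\<^sup>2 = r\<^sup>2 + r * e / (2 * A) + e / (4 * A) * (e / (4 * A))"
      by (simp only: power2_sum[of r "e / (4 * A)"]) (simp add: power2_eq_square)
    also have "\<dots> \<le> r\<^sup>2 + r * e / (2 * A) + (r / 8) * (e / (4 * A))"
      using re A e by (intro add_left_mono mult_right_mono) auto
    also have "\<dots> \<le> r\<^sup>2 + r * e / A" using r e A by (simp add: field_simps)
    finally have "(r + e / (4 * A))\<^sup>2 \<le> (norm w)\<^sup>2" using nwl by linarith
    then have "r + e / (4 * A) \<le> norm w" by (rule power2_le_imp_le) simp
    then show ?thesis by (simp add: w_def)
  qed
qed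

text \<open>Moving by \<open>y / A\<close> from a boundary point of radius \<open>r\<close> and angle \<open>\<theta>\<close> near \<open>0\<close> changes the
  radius by about \<open>y $ 1 / A\<close> and the angle by at most a multiple of \<open>1 / (A * r)\<close>. The first
  change moves the phase by about \<open>t / (A * r)\<close>, which dominates on late turns (\<open>k \<ge> K\<close>). The
  condition with \<open>W\<close> keeps the total change below \<open>pi\<close>, so that no other turn of the spiral is
  met.\<close>

lemma spiral_flat_near_edge:
  fixes \<alpha> e B :: real
  assumes \<alpha>: "\<alpha> > 0" and e: "0 < e" "e < B"
  obtains \<eta> K W where "0 < \<eta>" "\<eta> \<le> 1 / 2" "1 \<le> K" "0 < W"
    "\<And>k A \<theta> y. K \<le> k \<Longrightarrow> A > 0 \<Longrightarrow> W \<le> A * real k powr (- \<alpha> - 1) \<Longrightarrow> \<eta> / 2 \<le> \<theta> \<Longrightarrow> \<theta> \<le> \<eta> \<Longrightarrow> norm y < B \<Longrightarrow>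
      (y $ 1 < - e \<longrightarrow> spiral_curve \<alpha> 1 (2 * pi * real k + \<theta>) + (1 / A) *\<^sub>R y \<in> spiral \<alpha>) \<and>
      (e < y $ 1 \<longrightarrow> spiral_curve \<alpha> 1 (2 * pi * real k + \<theta>) + (1 / A) *\<^sub>R y \<notin> spiral \<alpha>)"
proof -
  have B: "B > 0" using e by linarith
  define q where "q = 1 / \<alpha>"
  have q: "q > 0" using \<alpha> by (simp add: q_def)
  define \<eta> where "\<eta> = min (1 / 2) (e / (4 * B))"
  have \<eta>: "0 < \<eta>" "\<eta> \<le> 1 / 2" "B * \<eta> \<le> e / 4"
  proof -
    show "0 < \<eta>" "\<eta> \<le> 1 / 2" using e B by (auto simp: \<eta>_def)
    have "B * \<eta> \<le> B * (e / (4 * B))" using B by (intro mult_left_mono) (auto simp: \<eta>_def)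
    then show "B * \<eta> \<le> e / 4" using B by simp
  qed
  define K where "K = nat \<lceil>4 * \<alpha> * pi * B * 2 powr (q + 1) / e\<rceil> + 1"
  have K: "1 \<le> K" "4 * \<alpha> * pi * B * 2 powr (q + 1) / e < real K"
    unfolding K_def using real_nat_ceiling_ge[of "4 * \<alpha> * pi * B * 2 powr (q + 1) / e"] by auto
  \<comment> \<open>\<open>W\<close> guarantees that \<open>A * r \<ge> Q\<close>, where \<open>r\<close> is the radius of the edge point, and that
    the radius moves the phase by at most \<open>1\<close>.\<close>
  define Q where "Q = max (2 * B) (max (2 * B\<^sup>2 / e) (4 * pi * B / \<eta>))"
  define W where "W = max (8 powr \<alpha> * Q) (q * B * 2 powr (q + 1) * 8 powr (\<alpha> + 1))"
  have Qp: "Q > 0" using B by (simp add: Q_def less_max_iff_disj)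
  have W: "W > 0" using Qp by (simp add: W_def less_max_iff_disj)
  have main: "(y $ 1 < - e \<longrightarrow> spiral_curve \<alpha> 1 (2 * pi * real k + \<theta>) + (1 / A) *\<^sub>R y \<in> spiral \<alpha>) \<and>
      (e < y $ 1 \<longrightarrow> spiral_curve \<alpha> 1 (2 * pi * real k + \<theta>) + (1 / A) *\<^sub>R y \<notin> spiral \<alpha>)"
    if k: "K \<le> k" and A: "A > 0" and WA: "W \<le> A * real k powr (- \<alpha> - 1)"
      and \<theta>: "\<eta> / 2 \<le> \<theta>" "\<theta> \<le> \<eta>" and y: "norm y < B" for k A \<theta> y
  proof -
    define t where "t = 2 * pi * real k + \<theta>"
    define r where "r = t powr (- \<alpha>)"
    have k1: "1 \<le> real k" using k K(1) by simp
    have th0: "0 \<le> \<theta>" "\<theta> \<le> 1 / 2" using \<theta> \<eta> by linarith+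
    have tk: "real k \<le> t" "t \<le> 8 * real k"
    proof -
      have "1 * real k \<le> 2 * pi * real k" using pi_gt3 by (intro mult_right_mono) auto
      then show "real k \<le> t" using th0 by (simp add: t_def)
      have "2 * pi * real k \<le> 7 * real k" using pi_approx by (intro mult_right_mono) auto
      then show "t \<le> 8 * real k" using th0 k1 unfolding t_def by linarith
    qed
    have t: "t > 0" using tk k1 by linarith
    have r: "r > 0" using t by (simp add: r_def)
    have rt: "r powr (- q) = t" using t \<alpha> by (simp add: r_def q_def powr_powr)
    have Atk: "W / 8 powr (\<alpha> + 1) \<le> A * t powr (- \<alpha> - 1)"
    proof -
      have "(8 * real k) powr (- \<alpha> - 1) \<le> t powr (- \<alpha> - 1)" using tk t \<alpha> by (intro powr_mono2') auto
      moreover have "(8 * real k) powr (- \<alpha> - 1) = real k powr (- \<alpha> - 1) / 8 powr (\<alpha> + 1)"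
        using k1 powr_minus_divide[of 8 "\<alpha> + 1"] by (simp add: powr_mult)
      ultimately have "A * (real k powr (- \<alpha> - 1) / 8 powr (\<alpha> + 1)) \<le> A * t powr (- \<alpha> - 1)"
        using A by (intro mult_left_mono) auto
      moreover have "W / 8 powr (\<alpha> + 1) \<le> A * real k powr (- \<alpha> - 1) / 8 powr (\<alpha> + 1)"
        using WA by (intro divide_right_mono) auto
      ultimately show ?thesis by simp
    qed
    have Ar: "Q \<le> A * r"
    proof -
      have "8 powr \<alpha> * Q \<le> A * real k powr (- \<alpha> - 1)" using WA by (simp add: W_def)
      also have "\<dots> \<le> A * real k powr (- \<alpha>)" using A k1 by (intro mult_left_mono powr_mono) auto
      also have "real k powr (- \<alpha>) = 8 powr \<alpha> * (8 * real k) powr (- \<alpha>)"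
        using k1 by (simp add: powr_mult flip: powr_add)
      finally have "8 powr \<alpha> * Q \<le> 8 powr \<alpha> * (A * (8 * real k) powr (- \<alpha>))" by (simp add: mult_ac)
      then have "Q \<le> A * (8 * real k) powr (- \<alpha>)" by (simp add: mult_le_cancel_left)
      also have "\<dots> \<le> A * r" unfolding r_def using A tk t \<alpha> by (intro mult_left_mono powr_mono2') auto
      finally show ?thesis .
    qed
    have Q1: "2 * B \<le> A * r" "2 * B\<^sup>2 \<le> e * (A * r)" "4 * pi * B \<le> \<eta> * (A * r)"
    proof -
      have "2 * B \<le> Q" "2 * B\<^sup>2 / e \<le> Q" "4 * pi * B / \<eta> \<le> Q" by (auto simp: Q_def)
      then have "2 * B \<le> A * r" "2 * B\<^sup>2 / e \<le> A * r" "4 * pi * B / \<eta> \<le> A * r" using Ar by linarith+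
      then show "2 * B \<le> A * r" "2 * B\<^sup>2 \<le> e * (A * r)" "4 * pi * B \<le> \<eta> * (A * r)"
        using e \<eta> by (simp_all add: pos_divide_le_eq mult.commute)
    qed
    define x where "x = spiral_curve \<alpha> 1 t + (1 / A) *\<^sub>R y"
    define Y where "Y = complex_of_vec y"
    have Y: "norm Y < B" "Re Y = y $ 1" using y by (simp_all add: Y_def) (simp add: complex_of_vec_def)
    have cist: "cis t = cis \<theta>"
      using cis_mult[of \<theta> "2 * pi * real k"] cis_multiple_2pi[of "real k"] by (simp add: t_def add.commute)
    have xc: "complex_of_vec x = of_real r * cis \<theta> + of_real (1 / A) * Y"
      unfolding cist[symmetric]
      by (simp add: x_def spiral_curve_def Y_def r_def complex_of_vec_def vec_of_complex_def complex_eq_iff)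
    define \<rho> where "\<rho> = norm x"
    have \<rho>c: "\<rho> = norm (of_real r * cis \<theta> + of_real (1 / A) * Y)"
      unfolding \<rho>_def xc[symmetric] by simp
    have BA: "B / A \<le> r / 2" using Q1(1) A by (simp add: field_simps)
    have YA: "norm (of_real (1 / A) * Y) < B / A" using Y(1) A
        by (simp add: norm_mult norm_divide field_simps)
    have rad: "\<bar>\<rho> - r\<bar> < B / A"
    proof -
      have "\<bar>norm (of_real r * cis \<theta> + of_real (1 / A) * Y) - norm (of_real r * cis \<theta>)\<bar>
          \<le> norm (of_real (1 / A) * Y)"
        using norm_triangle_ineq3[of "of_real r * cis \<theta> + of_real (1 / A) * Y" "of_real r * cis \<theta>"] by simp
      then show ?thesis using YA r unfolding \<rho>c by (simp add: norm_mult)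
    qed
    have \<rho>: "r / 2 \<le> \<rho>" "\<rho> \<le> 2 * r" "\<rho> > 0" using rad BA r by linarith+
    then have x0: "x \<noteq> 0" by (auto simp: \<rho>_def)
    define \<beta> where "\<beta> = Arg2pi (complex_of_vec x)"
    have \<beta>: "0 \<le> \<beta>" "\<beta> < 2 * pi" by (simp_all add: \<beta>_def Arg2pi_ge_0 Arg2pi_lt_2pi)
    have xb: "complex_of_vec x = of_real \<rho> * cis \<beta>"
      using Arg2pi_eq[of "complex_of_vec x"] by (simp add: \<beta>_def \<rho>_def cis_conv_exp)
    have "of_real \<rho> * cis \<beta> - of_real r * cis \<theta> = of_real (1 / A) * Y"
      unfolding xb[symmetric] xc by simp
    then have "norm (of_real \<rho> * cis \<beta> - of_real r * cis \<theta>) \<le> B / A" using YA by simp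
    then obtain m :: int where m: "\<bar>\<beta> - \<theta> - 2 * pi * of_int m\<bar> \<le> pi * (B / A) / r"
      using cis_close_imp_angle_close[OF r less_imp_le[OF \<rho>(3)]] by metis
    define \<epsilon> where "\<epsilon> = pi * B / (A * r)"
    have \<epsilon>: "0 \<le> \<epsilon>" "\<epsilon> \<le> \<eta> / 4" "\<bar>\<beta> - \<theta> - 2 * pi * of_int m\<bar> \<le> \<epsilon>"
    proof -
      show "0 \<le> \<epsilon>" using A r B by (simp add: \<epsilon>_def)
      show "\<epsilon> \<le> \<eta> / 4" using Q1(3) A r by (simp add: \<epsilon>_def field_simps)
      show "\<bar>\<beta> - \<theta> - 2 * pi * of_int m\<bar> \<le> \<epsilon>" using m by (simp add: \<epsilon>_def mult_ac)
    qed
    have "m = 0"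
    proof (rule ccontr)
      assume "m \<noteq> 0"
      then consider "1 \<le> m" | "m \<le> - 1" by linarith
      then show False
      proof cases
        case 1
        then have "2 * pi * 1 \<le> 2 * pi * of_int m" by (intro mult_left_mono) auto
        then show False using \<epsilon> \<theta> \<beta> \<eta> by linarith
      next
        case 2
        then have "2 * pi * of_int m \<le> 2 * pi * (- 1)" by (intro mult_left_mono) auto
        then show False using \<epsilon> \<theta> \<beta> \<eta> pi_gt3 by linarith
      qed
    qed
    then have ang: "\<bar>\<beta> - \<theta>\<bar> \<le> \<epsilon>" using \<epsilon>(3) by simp
    define \<tau> where "\<tau> = \<rho> powr (- q)"
    have phase: "spiral_phase \<alpha> x = 2 * pi * real k + ((\<tau> - t) + (\<theta> - \<beta>))"
      by (simp add: spiral_phase_def \<tau>_def q_def \<beta>_def \<rho>_def t_def)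
    have near: "\<bar>\<tau> - t\<bar> \<le> 1"
    proof -
      have "\<bar>\<rho> powr (- q) - r powr (- q)\<bar> \<le> q * (r / 2) powr (- q - 1) * \<bar>\<rho> - r\<bar>"
        using \<rho> r q by (intro powr_neg_lipschitz) auto
      also have "\<dots> \<le> q * (r / 2) powr (- q - 1) * (B / A)"
        using rad q by (intro mult_left_mono) auto
      also have "(r / 2) powr (- q - 1) = 2 powr (q + 1) * t powr (\<alpha> + 1)"
      proof -
        have "r powr (- q - 1) = t powr (\<alpha> + 1)"
          unfolding r_def powr_powr using \<alpha> by (simp add: q_def algebra_simps)
        then show ?thesis using r powr_minus_divide[of 2 "q + 1"] by (simp add: powr_divide)
      qed
      also have "q * (2 powr (q + 1) * t powr (\<alpha> + 1)) * (B / A) = q * B * 2 powr (q + 1) / (A * t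
          powr (- \<alpha> - 1))"
      proof -
        have "t powr (- \<alpha> - 1) = 1 / t powr (\<alpha> + 1)" using powr_minus_divide[of t "\<alpha> + 1"] by simp
        then show ?thesis using A t by simp
      qed
      also have "\<dots> \<le> 1"
      proof -
        have "q * B * 2 powr (q + 1) * 8 powr (\<alpha> + 1) \<le> W" by (simp add: W_def)
        then have "q * B * 2 powr (q + 1) \<le> W / 8 powr (\<alpha> + 1)" by (simp add: pos_le_divide_eq)
        then have "q * B * 2 powr (q + 1) \<le> A * t powr (- \<alpha> - 1)" using Atk by linarith
        then show ?thesis using A t by (simp add: divide_le_eq)
      qed
      finally show ?thesis by (simp add: \<tau>_def rt)
    qed
    have dev: "\<bar>(\<tau> - t) + (\<theta> - \<beta>)\<bar> \<le> 2" using near ang \<epsilon> \<eta> by linarith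
    have gain: "\<epsilon> < q * (2 * r) powr (- q - 1) * (e / (4 * A))"
    proof -
      have "(2 * r) powr (- q - 1) = t / r / 2 powr (q + 1)"
      proof -
        have "r powr (- q - 1) = t / r" using r rt by (simp add: powr_diff)
        moreover have "2 powr (- q - 1) = 1 / 2 powr (q + 1)" using powr_minus_divide[of 2 "q + 1"] by simp
        ultimately show ?thesis using r by (simp add: powr_mult)
      qed
      moreover have "4 * \<alpha> * pi * B * 2 powr (q + 1) / e < t" using K(2) k tk by simp
      then have "4 * \<alpha> * pi * B * 2 powr (q + 1) < t * e" using e by (simp add: pos_divide_less_eq)
      then have "4 * \<alpha> * pi * B * 2 powr (q + 1) / (4 * \<alpha> * 2 powr (q + 1) * (A * r)) < t * e / (4 *
          \<alpha> * 2 powr (q + 1) * (A * r))"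
        using A r \<alpha> by (intro divide_strict_right_mono) auto
      moreover have "4 * \<alpha> * pi * B * 2 powr (q + 1) / (4 * \<alpha> * 2 powr (q + 1) * (A * r)) = \<epsilon>"
        using \<alpha> by (simp add: \<epsilon>_def)
      ultimately show ?thesis using A r \<alpha> by (simp add: q_def mult_ac)
    qed
    have "B * \<theta> \<le> B * \<eta>" using B \<theta> by (intro mult_left_mono) auto
    then have Bth: "B * \<theta> \<le> e / 4" using \<eta>(3) by linarith
    have "x \<in> spiral \<alpha>" if "y $ 1 < - e"
    proof -
      have "\<rho> \<le> r - e / (4 * A)" unfolding \<rho>c
        using that Y(2) by (intro norm_perturbed_cis(1)[OF A r e Q1(1,2) th0 Bth Y(1)]) simp
      then have g: "e / (4 * A) \<le> r - \<rho>" by simp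
      have "0 \<le> e / (4 * A)" using e A by simp
      then have r\<rho>: "\<rho> \<le> r" using g by linarith
      have "q * (2 * r) powr (- q - 1) * (e / (4 * A)) \<le> q * r powr (- q - 1) * (r - \<rho>)"
        using g q r e A by (intro mult_mono mult_left_mono powr_mono2') auto
      also have "\<dots> \<le> \<rho> powr (- q) - r powr (- q)"
        using \<rho> q r\<rho> by (intro powr_neg_diff_ge) auto
      finally have "\<epsilon> < \<tau> - t" using gain by (simp add: \<tau>_def rt)
      then have "0 < (\<tau> - t) + (\<theta> - \<beta>)" using ang by linarith
      then show ?thesis
        unfolding spiral_iff_phase[OF x0 \<alpha>] phase using dev pi_gt3 k K(1) by (intro exI[of _ k]) auto
    qed
    moreover have "x \<notin> spiral \<alpha>" if "e < y $ 1"
    proof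
      assume xs: "x \<in> spiral \<alpha>"
      have "r + e / (4 * A) \<le> \<rho>" unfolding \<rho>c
        using that Y(2) by (intro norm_perturbed_cis(2)[OF A r e Q1(1,2) th0 Bth Y(1)]) simp
      then have g: "e / (4 * A) \<le> \<rho> - r" by simp
      have "0 \<le> e / (4 * A)" using e A by simp
      then have r\<rho>: "r \<le> \<rho>" using g by linarith
      have "q * (2 * r) powr (- q - 1) * (e / (4 * A)) \<le> q * \<rho> powr (- q - 1) * (\<rho> - r)"
        using g q r e A \<rho> by (intro mult_mono mult_left_mono powr_mono2') auto
      also have "\<dots> \<le> r powr (- q) - \<rho> powr (- q)"
        using r q r\<rho> by (intro powr_neg_diff_ge) auto
      finally have "\<epsilon> < t - \<tau>" using gain by (simp add: \<tau>_def rt)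
      then have neg: "(\<tau> - t) + (\<theta> - \<beta>) < 0" using ang by linarith
      obtain k' :: nat where k': "2 * pi * real k' < spiral_phase \<alpha> x" "spiral_phase \<alpha> x
          \<le> 2 * pi * real k' + pi"
        using xs unfolding spiral_iff_phase[OF x0 \<alpha>] by blast
      have "2 * pi * real k' < 2 * pi * real k" using k'(1) neg unfolding phase by linarith
      then have "real k' < real k" by simp
      then have "real k' \<le> real k - 1" by simp
      then have "2 * pi * real k' \<le> 2 * pi * (real k - 1)" by (intro mult_left_mono) auto
      then have "2 * pi * real k' + pi \<le> 2 * pi * real k - pi" by (simp add: algebra_simps)
      then show False using k'(2) dev pi_gt3 unfolding phase by linarith
    qed
    ultimately show ?thesis by (simp add: x_def t_def)
  qed
  show thesis using that[OF \<eta>(1,2) K(1) W main] by blast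
qed

section \<open>Lower bounds for integrals over squares at the origin\<close>

lemma emeasure_ball_plane_ge:
  fixes a :: "real ^ 2"
  assumes "r \<ge> 0"
  shows "ennreal (r\<^sup>2) \<le> emeasure lebesgue (ball a r)"
proof -
  have "emeasure lebesgue (ball a r) = ennreal (pi * r\<^sup>2)"
    using assms emeasure_ball[of r a] by (simp add: unit_ball_vol_2)
  moreover have "1 * r\<^sup>2 \<le> pi * r\<^sup>2" using pi_gt3 by (intro mult_right_mono) auto
  ultimately show ?thesis by (simp add: ennreal_leI)
qed

text \<open>The distance is at least that of the first point to the ray through the second one.\<close>

lemma dist_spiral_curve_same_turn:
  assumes t: "0 < s" "s \<le> t" "t - s \<le> 1" and \<alpha>: "\<alpha> > 0"
  shows "s powr (- \<alpha>) * ((t - s) / 2) \<le> dist (spiral_curve \<alpha> 1 s) (spiral_curve \<alpha> 1 t)"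
proof -
  define u where "u = t - s"
  have u: "0 \<le> u" "u \<le> 1" using t by (auto simp: u_def)
  let ?z = "(of_real (s powr (- \<alpha>)) * cis s - of_real (t powr (- \<alpha>)) * cis t) * cis (- t)"
  have "?z = of_real (s powr (- \<alpha>)) * cis (- u) - of_real (t powr (- \<alpha>))"
    by (simp add: left_diff_distrib mult.assoc cis_mult u_def)
  then have "Im ?z = - (s powr (- \<alpha>) * sin u)" by simp
  then have "s powr (- \<alpha>) * sin u \<le> norm ?z"
    using abs_Im_le_cmod[of ?z] by linarith
  also have "norm ?z = dist (spiral_curve \<alpha> 1 s) (spiral_curve \<alpha> 1 t)"
    by (simp add: norm_mult dist_norm spiral_curve_def flip: vec_of_complex_diff)
  finally have 1: "s powr (- \<alpha>) * sin u \<le> dist (spiral_curve \<alpha> 1 s) (spiral_curve \<alpha> 1 t)" .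
  have "u / 2 \<le> 2 * u / pi"
  proof -
    have "u * pi \<le> u * 4" using u pi_less_4 by (intro mult_left_mono) auto
    then show ?thesis by (simp add: field_simps)
  qed
  also have "\<dots> \<le> sin u" using u pi_gt3 by (intro sin_ge_two_over_pi) auto
  finally have "s powr (- \<alpha>) * (u / 2) \<le> s powr (- \<alpha>) * sin u" by (intro mult_left_mono) auto
  with 1 show ?thesis by (simp add: u_def)
qed

lemma dist_spiral_curve_different_turn:
  assumes t: "0 < s" "s + 4 \<le> t" and \<alpha>: "\<alpha> > 0"
  shows "4 * \<alpha> * (s + 4) powr (- \<alpha> - 1) \<le> dist (spiral_curve \<alpha> 1 s) (spiral_curve \<alpha> 1 t)"
proof -
  have "\<alpha> * (s + 4) powr (- \<alpha> - 1) * ((s + 4) - s) \<le> s powr (- \<alpha>) - (s + 4) powr (- \<alpha>)"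
    using t \<alpha> by (intro powr_neg_diff_ge) auto
  moreover have "t powr (- \<alpha>) \<le> (s + 4) powr (- \<alpha>)" using t \<alpha> by (intro powr_mono2') auto
  moreover have "s powr (- \<alpha>) - t powr (- \<alpha>) \<le> dist (spiral_curve \<alpha> 1 s) (spiral_curve \<alpha> 1 t)"
    using norm_triangle_ineq2[of "spiral_curve \<alpha> 1 s" "spiral_curve \<alpha> 1 t"]
    by (simp add: norm_spiral_curve dist_norm)
  ultimately show ?thesis by (simp add: mult_ac)
qed

lemma nn_integral_ge_disjoint_balls:
  fixes f :: "real ^ 2 \<Rightarrow> ennreal" and z :: "'i \<Rightarrow> real ^ 2"
  assumes I: "finite I" and r: "r > 0" and c: "c \<ge> 0"
    and sep: "\<And>i j. i \<in> I \<Longrightarrow> j \<in> I \<Longrightarrow> i \<noteq> j \<Longrightarrow> 2 * r \<le> dist (z i) (z j)"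
    and low: "\<And>i x. i \<in> I \<Longrightarrow> x \<in> ball (z i) r \<Longrightarrow> x \<in> P \<and> ennreal c \<le> f x"
  shows "ennreal (real (card I) * (c * r\<^sup>2)) \<le> (\<integral>\<^sup>+x\<in>P. f x \<partial>lebesgue)"
proof -
  have disj: "ball (z i) r \<inter> ball (z j) r = {}" if "i \<in> I" "j \<in> I" "i \<noteq> j" for i j
  proof (rule ccontr)
    assume "\<not> ?thesis"
    then obtain x where "dist (z i) x < r" "dist (z j) x < r" by auto
    then have "dist (z i) (z j) < 2 * r" using dist_triangle[of "z i" "z j" x] by (simp add: dist_commute)
    then show False using sep[OF that] by linarith
  qed
  have "ennreal (real (card I) * (c * r\<^sup>2)) = (\<Sum>i\<in>I. ennreal c * ennreal (r\<^sup>2))"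
    using c by (simp add: ennreal_mult ennreal_of_nat_eq_real_of_nat)
  also have "\<dots> \<le> (\<Sum>i\<in>I. ennreal c * emeasure lebesgue (ball (z i) r))"
    using r by (intro sum_mono mult_left_mono emeasure_ball_plane_ge) auto
  also have "\<dots> = (\<Sum>i\<in>I. \<integral>\<^sup>+x. ennreal c * indicator (ball (z i) r) x \<partial>lebesgue)"
    by (intro sum.cong refl nn_integral_cmult_indicator[symmetric]) auto
  also have "\<dots> = (\<integral>\<^sup>+x. (\<Sum>i\<in>I. ennreal c * indicator (ball (z i) r) x) \<partial>lebesgue)"
    by (intro nn_integral_sum[symmetric] borel_measurable_times_ennreal borel_measurable_const
        borel_measurable_indicator) auto
  also have "\<dots> \<le> (\<integral>\<^sup>+x\<in>P. f x \<partial>lebesgue)"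
  proof (rule nn_integral_mono)
    fix x
    show "(\<Sum>i\<in>I. ennreal c * indicator (ball (z i) r) x) \<le> f x * indicator P x"
    proof (cases "\<exists>i\<in>I. x \<in> ball (z i) r")
      case False
      then have "(\<Sum>i\<in>I. ennreal c * indicator (ball (z i) r) x) = 0"
        by (intro sum.neutral) (auto simp del: mem_ball)
      then show ?thesis by simp
    next
      case True
      then obtain i where i: "i \<in> I" "x \<in> ball (z i) r" by blast
      have "indicator (ball (z j) r) x = (0 :: ennreal)" if "j \<in> I - {i}" for j
        using disj[of i j] i that by (auto simp: indicator_def simp del: mem_ball)
      then have "(\<Sum>j\<in>I - {i}. ennreal c * indicator (ball (z j) r) x) = 0"
        by (intro sum.neutral) simp
      then have "(\<Sum>j\<in>I. ennreal c * indicator (ball (z j) r) x) = ennreal c * indicator (ball (z i) r) x"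
        using sum.remove[OF I i(1), of "\<lambda>j. ennreal c * indicator (ball (z j) r) x"] by simp
      then show ?thesis using low[OF i] i(2) by (simp add: indicator_def)
    qed
  qed
  finally show ?thesis .
qed

text \<open>The estimate behind all three lower bounds. Every turn \<open>k\<close> on which the gap between turns is
  large compared to \<open>1 / A\<close> contributes a strip of width about \<open>1 / A\<close> along an arc of length
  about \<open>k powr (- \<alpha>)\<close>. Only arcs in the direction of the first axis are used, so that a
  single half space serves as model; the strips are replaced by packed disjoint balls of
  radius comparable to \<open>1 / A\<close>.\<close>

lemma integral_dilated_conv_spiral_ge:
  assumes \<phi>: "\<phi> \<in> schwartz_space" and ft: "fourier_transform \<phi> (axis 1 1) \<noteq> 0" and \<alpha>: "\<alpha> > 0"
    and p: "1 \<le> p"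
  obtains c K W where "c > 0" "1 \<le> K" "1 \<le> W"
    "\<And>A l I P. A > 0 \<Longrightarrow> finite I \<Longrightarrow> (\<And>k. k \<in> I \<Longrightarrow> K \<le> k) \<Longrightarrow>
      (\<And>k. k \<in> I \<Longrightarrow> W \<le> A * real k powr (- \<alpha> - 1)) \<Longrightarrow> (\<And>k. k \<in> I \<Longrightarrow> 2 * real k powr (- \<alpha>) \<le> l) \<Longrightarrow>
      {x :: real ^ 2. \<forall>i. 0 \<le> x $ i \<and> x $ i < l} \<subseteq> P \<Longrightarrow>
      ennreal (c / A * (\<Sum>k\<in>I. real k powr (- \<alpha>))) \<le>
        (\<integral>\<^sup>+x\<in>P. ennreal (norm (dilated_conv (spiral \<alpha>) \<phi> A x) powr p) \<partial>lebesgue)"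
proof -
  have E: "spiral \<alpha> \<in> sets lebesgue" using spiral_lmeasurable[OF \<alpha>] by (rule fmeasurableD)
  show thesis
  proof (rule dilated_conv_near_flat_boundary[OF \<phi> ft])
    fix v c R B e :: real assume flat: "c > 0" "R > 0" "B > 0" "e > 0" "e < B"
      "\<And>E A b x. E \<in> sets lebesgue \<Longrightarrow> A > 0 \<Longrightarrow>
         (\<And>y. norm y < B \<Longrightarrow> y $ 1 < - e \<Longrightarrow> b + (1 / A) *\<^sub>R y \<in> E) \<Longrightarrow>
         (\<And>y. norm y < B \<Longrightarrow> y $ 1 > e \<Longrightarrow> b + (1 / A) *\<^sub>R y \<notin> E) \<Longrightarrow>
         x \<in> ball (b + (v / A) *\<^sub>R axis 1 1) (R / A) \<Longrightarrow> c \<le> norm (dilated_conv E \<phi> A x)"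
    show thesis
    proof (rule spiral_flat_near_edge[OF \<alpha> flat(4,5)])
      fix \<eta> W0 :: real and K :: nat assume sp: "0 < \<eta>" "\<eta> \<le> 1 / 2" "1 \<le> K" "0 < W0"
        "\<And>k A \<theta> y. K \<le> k \<Longrightarrow> A > 0 \<Longrightarrow> W0 \<le> A * real k powr (- \<alpha> - 1) \<Longrightarrow> \<eta> / 2 \<le> \<theta> \<Longrightarrow> \<theta> \<le> \<eta> \<Longrightarrow> norm y < B \<Longrightarrow>
          (y $ 1 < - e \<longrightarrow> spiral_curve \<alpha> 1 (2 * pi * real k + \<theta>) + (1 / A) *\<^sub>R y \<in> spiral \<alpha>) \<and>
          (e < y $ 1 \<longrightarrow> spiral_curve \<alpha> 1 (2 * pi * real k + \<theta>) + (1 / A) *\<^sub>R y \<notin> spiral \<alpha>)"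
      define M where "M = 8 powr \<alpha>"
      have M: "M > 0" by (simp add: M_def)
      define V where "V = \<bar>v\<bar> + R"
      have V: "V > 0" using flat(2) by (simp add: V_def)
      \<comment> \<open>The summands ensure, in this order: flatness of the edges, separation of the balls
        on different turns, at least one ball on each turn, and that the balls stay in the
        first quadrant.\<close>
      define W where "W = 1 + W0 + R * 16 powr (\<alpha> + 1) / (2 * \<alpha>) + 8 * M * R / \<eta> + 4 * M * V / \<eta>"
      have Ws: "1 \<le> W" "W0 \<le> W" "R * 16 powr (\<alpha> + 1) / (2 * \<alpha>) \<le> W" "8 * M * R / \<eta> \<le> W" "4 * M * V / \<eta> \<le> W"
        using sp \<alpha> M V flat(2) by (simp_all add: W_def)
      define c' where "c' = c powr p * R * \<eta> / (16 * M)"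
      have c': "c' > 0" using flat sp M by (simp add: c'_def)
      have main: "ennreal (c' / A * (\<Sum>k\<in>I. real k powr (- \<alpha>))) \<le>
            (\<integral>\<^sup>+x\<in>P. ennreal (norm (dilated_conv (spiral \<alpha>) \<phi> A x) powr p) \<partial>lebesgue)"
        if A: "A > 0" and I: "finite I" "\<And>k. k \<in> I \<Longrightarrow> K \<le> k"
          "\<And>k. k \<in> I \<Longrightarrow> W \<le> A * real k powr (- \<alpha> - 1)" "\<And>k. k \<in> I \<Longrightarrow> 2 * real k powr (- \<alpha>) \<le> l"
          and P: "{x :: real ^ 2. \<forall>i. 0 \<le> x $ i \<and> x $ i < l} \<subseteq> P" for A l I P
      proof -
        \<comment> \<open>On turn \<open>k\<close> the centres \<open>z (k, i)\<close> have angles \<open>\<theta> k i\<close> between \<open>\<eta> / 2\<close> and \<open>\<eta>\<close>;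
          the spacing \<open>h k\<close> makes them \<open>2 * R / A\<close> apart, and \<open>n k\<close> of them fit. Angles
          are kept positive so that the balls lie in the first quadrant.\<close>
        define h where "h = (\<lambda>k. 4 * R * M / (A * real k powr (- \<alpha>)))"
        define n where "n = (\<lambda>k. nat \<lfloor>\<eta> / 2 / h k\<rfloor>)"
        define \<theta> where "\<theta> = (\<lambda>k i. \<eta> / 2 + real i * h k)"
        define z where "z = (\<lambda>(k, i). spiral_curve \<alpha> 1 (2 * pi * real k + \<theta> k i) + (v / A) *\<^sub>R axis 1 1)"
        define J where "J = (SIGMA k : I. {..<n k})"
        have k1: "1 \<le> real k" if "k \<in> I" for k using I(2)[OF that] sp(3) by simp
        have Ak: "W \<le> A * real k powr (- \<alpha>)" if "k \<in> I" for k
        proof -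
          have "A * real k powr (- \<alpha> - 1) \<le> A * real k powr (- \<alpha>)"
            using A k1[OF that] by (intro mult_left_mono powr_mono) auto
          then show ?thesis using I(3)[OF that] by linarith
        qed
        have h: "h k > 0" "1 \<le> \<eta> / 2 / h k" if "k \<in> I" for k
        proof -
          have kp: "0 < A * real k powr (- \<alpha>)" using Ak[OF that] Ws(1) by linarith
          show h0: "h k > 0" using kp flat(2) M by (simp add: h_def)
          have "8 * M * R / \<eta> \<le> A * real k powr (- \<alpha>)" using Ws(4) Ak[OF that] by linarith
          then have "8 * M * R \<le> \<eta> * (A * real k powr (- \<alpha>))" using sp(1)
              by (simp add: pos_divide_le_eq mult.commute)
          then have "h k \<le> \<eta> / 2" using kp by (simp add: h_def pos_divide_le_eq mult_ac)
          then show "1 \<le> \<eta> / 2 / h k" using h0 by (simp add: pos_le_divide_eq)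
        qed
        have n: "real (n k) \<le> \<eta> / 2 / h k" "\<eta> / 4 / h k \<le> real (n k)" if "k \<in> I" for k
        proof -
          define g where "g = \<eta> / 2 / h k"
          have g1: "1 \<le> g" using h(2)[OF that] by (simp add: g_def)
          then have g2: "1 \<le> \<lfloor>g\<rfloor>" by simp
          then have ng: "real (n k) = of_int \<lfloor>g\<rfloor>" by (simp add: n_def g_def)
          have "\<eta> / 4 / h k = g / 2" by (simp add: g_def)
          also have "\<dots> \<le> real (n k)" unfolding ng using floor_correct[of g] g2 by linarith
          finally show "\<eta> / 4 / h k \<le> real (n k)" .
          show "real (n k) \<le> \<eta> / 2 / h k" unfolding ng g_def[symmetric] by simp
        qed
        have \<theta>: "\<eta> / 2 \<le> \<theta> k i" "\<theta> k i \<le> \<eta>" if "k \<in> I" "i < n k" for k i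
        proof -
          show "\<eta> / 2 \<le> \<theta> k i" using h(1)[OF that(1)] by (simp add: \<theta>_def)
          have "real i * h k \<le> \<eta> / 2 / h k * h k"
            using n(1)[OF that(1)] that(2) h(1)[OF that(1)] by (intro mult_right_mono) auto
          then show "\<theta> k i \<le> \<eta>" using h(1)[OF that(1)] by (simp add: \<theta>_def)
        qed
        have turn: "real k \<le> 2 * pi * real k + \<theta> k i" "2 * pi * real k + \<theta> k i \<le> 8 * real k"
            if "k \<in> I" "i < n k" for k i
        proof -
          have "1 * real k \<le> 2 * pi * real k" using pi_gt3 by (intro mult_right_mono) auto
          then show "real k \<le> 2 * pi * real k + \<theta> k i" using \<theta>[OF that] sp(1) by linarith
          have "2 * pi * real k \<le> 7 * real k" using pi_approx by (intro mult_right_mono) auto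
          then show "2 * pi * real k + \<theta> k i \<le> 8 * real k" using \<theta>[OF that] sp k1[OF that(1)] by linarith
        qed
        have rad: "real k powr (- \<alpha>) / M \<le> (2 * pi * real k + \<theta> k i) powr (- \<alpha>)"
          "(2 * pi * real k + \<theta> k i) powr (- \<alpha>) \<le> real k powr (- \<alpha>)" if "k \<in> I" "i < n k" for k i
        proof -
          have "(8 * real k) powr (- \<alpha>) \<le> (2 * pi * real k + \<theta> k i) powr (- \<alpha>)"
            using turn[OF that] k1[OF that(1)] \<alpha> by (intro powr_mono2') auto
          then show "real k powr (- \<alpha>) / M \<le> (2 * pi * real k + \<theta> k i) powr (- \<alpha>)"
            by (simp add: powr_mult M_def powr_minus_divide mult.commute)
          show "(2 * pi * real k + \<theta> k i) powr (- \<alpha>) \<le> real k powr (- \<alpha>)"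
            using turn[OF that] k1[OF that(1)] \<alpha> by (intro powr_mono2') auto
        qed
        have same: "2 * (R / A) \<le> dist (z (k, i)) (z (k, j))" if k: "k \<in> I"
            and ij: "i < j" "j < n k" for k i j
        proof -
          let ?s = "2 * pi * real k + \<theta> k i" and ?t = "2 * pi * real k + \<theta> k j"
          have i: "i < n k" using ij by simp
          have "1 * h k \<le> (real j - real i) * h k" using ij h(1)[OF k] by (intro mult_right_mono) auto
          then have st: "h k \<le> ?t - ?s" by (simp add: \<theta>_def algebra_simps)
          have "2 * (R / A) = real k powr (- \<alpha>) / M * (h k / 2)"
            using A M k1[OF k] by (simp add: h_def)
          also have "\<dots> \<le> ?s powr (- \<alpha>) * ((?t - ?s) / 2)"
            using rad(1)[OF k i] st h(1)[OF k] by (intro mult_mono) auto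
          also have "\<dots> \<le> dist (spiral_curve \<alpha> 1 ?s) (spiral_curve \<alpha> 1 ?t)"
            using turn(1)[OF k i] k1[OF k] st h(1)[OF k] \<theta>[OF k i] \<theta>[OF k ij(2)] sp(1,2) \<alpha>
            by (intro dist_spiral_curve_same_turn) auto
          finally show ?thesis by (simp add: z_def dist_norm)
        qed
        have diff: "2 * (R / A) \<le> dist (z (k, i)) (z (k', j))"
            if k: "k \<in> I" "k' \<in> I" "k < k'" and ij: "i < n k" "j < n k'" for k k' i j
        proof -
          let ?s = "2 * pi * real k + \<theta> k i" and ?t = "2 * pi * real k' + \<theta> k' j"
          have "2 * pi * (real k + 1) \<le> 2 * pi * real k'" using k(3) by (intro mult_left_mono) auto
          then have "2 * pi * real k + 2 * pi \<le> 2 * pi * real k'" by (simp add: distrib_left)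
          then have st: "?s + 4 \<le> ?t" using \<theta>[OF k(1) ij(1)] \<theta>[OF k(2) ij(2)] sp(1,2) pi_gt3 by linarith
          have s4: "?s + 4 \<le> 16 * real k" using turn[OF k(1) ij(1)] k1[OF k(1)] by linarith
          have "2 * (R / A) \<le> 4 * \<alpha> * (16 * real k) powr (- \<alpha> - 1)"
          proof -
            have "R * 16 powr (\<alpha> + 1) / (2 * \<alpha>) \<le> A * real k powr (- \<alpha> - 1)"
              using Ws(3) I(3)[OF k(1)] by linarith
            then have "R * 16 powr (\<alpha> + 1) \<le> 2 * \<alpha> * (A * real k powr (- \<alpha> - 1))"
              using \<alpha> by (simp add: pos_divide_le_eq mult_ac)
            then have "R \<le> 2 * \<alpha> * (A * real k powr (- \<alpha> - 1)) / 16 powr (\<alpha> + 1)"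
              by (simp add: pos_le_divide_eq)
            also have "\<dots> = 2 * \<alpha> * (16 * real k) powr (- \<alpha> - 1) * A"
              using powr_minus_divide[of 16 "\<alpha> + 1"] by (simp add: powr_mult)
            finally have "R / A \<le> 2 * \<alpha> * (16 * real k) powr (- \<alpha> - 1)" using A
                by (simp add: pos_divide_le_eq)
            then show ?thesis by simp
          qed
          also have "\<dots> \<le> 4 * \<alpha> * (?s + 4) powr (- \<alpha> - 1)"
            using s4 turn(1)[OF k(1) ij(1)] k1[OF k(1)] \<alpha> by (intro mult_left_mono powr_mono2') auto
          also have "\<dots> \<le> dist (spiral_curve \<alpha> 1 ?s) (spiral_curve \<alpha> 1 ?t)"
            using turn(1)[OF k(1) ij(1)] k1[OF k(1)] st \<alpha> by (intro dist_spiral_curve_different_turn) auto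
          finally show ?thesis by (simp add: z_def dist_norm)
        qed
        have sep: "2 * (R / A) \<le> dist (z a) (z b)" if ab: "a \<in> J" "b \<in> J" "a \<noteq> b" for a b
        proof -
          obtain k i where a: "a = (k, i)" "k \<in> I" "i < n k" using ab(1) by (auto simp: J_def)
          obtain k' j where b: "b = (k', j)" "k' \<in> I" "j < n k'" using ab(2) by (auto simp: J_def)
          consider "k < k'" | "k' < k" | "k = k'" "i < j" | "k = k'" "j < i" using ab(3) a b by fastforce
          then show ?thesis
            using a b diff[of k k' i j] diff[of k' k j i] same[of k i j] same[of k j i]
                by cases (auto simp: dist_commute)
        qed
        have low: "x \<in> P \<and> ennreal (c powr p) \<le> ennreal (norm (dilated_conv (spiral \<alpha>) \<phi> A x) powr p)"
          if a: "a \<in> J" and x: "x \<in> ball (z a) (R / A)" for a x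
        proof -
          obtain k i where ki: "a = (k, i)" "k \<in> I" "i < n k" using a by (auto simp: J_def)
          let ?t = "2 * pi * real k + \<theta> k i"
          define b where "b = spiral_curve \<alpha> 1 ?t"
          define r where "r = ?t powr (- \<alpha>)"
          have za: "z a = b + (v / A) *\<^sub>R axis 1 1" by (simp add: z_def ki(1) b_def)
          have W0: "W0 \<le> A * real k powr (- \<alpha> - 1)" using Ws(2) I(3)[OF ki(2)] by linarith
          have "c \<le> norm (dilated_conv (spiral \<alpha>) \<phi> A x)"
          proof (rule flat(6)[OF E A])
            show "b + (1 / A) *\<^sub>R y \<in> spiral \<alpha>" if "norm y < B" "y $ 1 < - e" for y
              using sp(5)[OF I(2)[OF ki(2)] A W0 \<theta>[OF ki(2,3)] that(1)] that(2) by (simp add: b_def)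
            show "b + (1 / A) *\<^sub>R y \<notin> spiral \<alpha>" if "norm y < B" "e < y $ 1" for y
              using sp(5)[OF I(2)[OF ki(2)] A W0 \<theta>[OF ki(2,3)] that(1)] that(2) by (simp add: b_def)
            show "x \<in> ball (b + (v / A) *\<^sub>R axis 1 1) (R / A)" using x za by simp
          qed
          then have "c powr p \<le> norm (dilated_conv (spiral \<alpha>) \<phi> A x) powr p"
            using flat(1) p by (intro powr_mono2) auto
          moreover have "0 \<le> x $ d \<and> x $ d < l" for d
          proof -
            have th: "\<eta> / 2 \<le> \<theta> k i" "\<theta> k i \<le> \<eta>" using \<theta>[OF ki(2,3)] by auto
            have "cis ?t = cis (\<theta> k i)"
              using cis_mult[of "\<theta> k i" "2 * pi * real k"] cis_multiple_2pi[of "real k"]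
                  by (simp add: add.commute)
            then have b12: "b $ 1 = r * cos (\<theta> k i)" "b $ 2 = r * sin (\<theta> k i)"
              by (simp_all add: b_def r_def spiral_curve_def vec_of_complex_def)
            have "x \<in> ball b (V / A)"
            proof -
              have "dist b x \<le> dist b (z a) + dist (z a) x" by (rule dist_triangle)
              also have "dist b (z a) = \<bar>v\<bar> / A" using A by (simp add: za dist_norm norm_axis_1)
              also have "\<bar>v\<bar> / A + dist (z a) x < \<bar>v\<bar> / A + R / A" using x by simp
              finally show ?thesis by (simp add: V_def add_divide_distrib)
            qed
            then have near: "\<bar>x $ d - b $ d\<bar> < V / A" for d
              using component_le_norm_cart[of "x - b" d] by (simp add: dist_norm norm_minus_commute)
            have r: "r > 0" "r \<le> real k powr (- \<alpha>)" "V / A \<le> r * \<eta> / 4"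
            proof -
              have "0 < real k powr (- \<alpha>) / M" using k1[OF ki(2)] M by simp
              then show "r > 0" using rad(1)[OF ki(2,3)] unfolding r_def by linarith
              show "r \<le> real k powr (- \<alpha>)" using rad(2)[OF ki(2,3)] by (simp add: r_def)
              have "4 * M * V / \<eta> \<le> A * real k powr (- \<alpha>)" using Ws(5) Ak[OF ki(2)] by linarith
              then have "V \<le> A * (real k powr (- \<alpha>) / M) * (\<eta> / 4)" using sp(1) M by (simp add: field_simps)
              also have "\<dots> \<le> A * r * (\<eta> / 4)" using rad(1)[OF ki(2,3)] A sp(1)
                  by (intro mult_right_mono mult_left_mono) (auto simp: r_def)
              finally show "V / A \<le> r * \<eta> / 4" using A by (simp add: field_simps)
            qed
            have \<eta>4: "\<eta> / 4 \<le> cos (\<theta> k i)" "\<eta> / 4 \<le> sin (\<theta> k i)"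
            proof -
              have "2 * \<theta> k i / pi \<le> sin (\<theta> k i)" using th sp(1,2) pi_gt3 by (intro sin_ge_two_over_pi) auto
              moreover have "\<theta> k i / 2 \<le> 2 * \<theta> k i / pi"
              proof -
                have "\<theta> k i * pi \<le> \<theta> k i * 4" using th sp(1) pi_less_4 by (intro mult_left_mono) auto
                then show ?thesis by (simp add: field_simps)
              qed
              ultimately show "\<eta> / 4 \<le> sin (\<theta> k i)" using th by linarith
              have "cos (pi / 3) \<le> cos (\<theta> k i)" using th sp(1,2) pi_gt3 by (intro cos_monotone_0_pi_le) auto
              then show "\<eta> / 4 \<le> cos (\<theta> k i)" using sp(1,2) by (simp add: cos_60)
            qed
            have bd: "r * \<eta> / 4 \<le> b $ d" "b $ d \<le> r"
            proof -
              have "r * (\<eta> / 4) \<le> r * cos (\<theta> k i)" "r * (\<eta> / 4) \<le> r * sin (\<theta> k i)"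
                using r(1) \<eta>4 by (intro mult_left_mono; simp)+
              moreover have "r * cos (\<theta> k i) \<le> r" "r * sin (\<theta> k i) \<le> r"
                using r(1) mult_left_mono[OF cos_le_one, of r "\<theta> k i"] mult_left_mono[OF sin_le_one,
                    of r "\<theta> k i"] by auto
              moreover have "d = 1 \<or> d = 2" by (rule exhaust_2)
              ultimately show "r * \<eta> / 4 \<le> b $ d" "b $ d \<le> r" using b12 by auto
            qed
            have "r * \<eta> / 4 \<le> r"
              using mult_left_mono[of "\<eta> / 4" 1 r] r(1) sp(2) by simp
            then show ?thesis using near[of d] bd r I(4)[OF ki(2)] by linarith
          qed
          ultimately show ?thesis using P by (auto intro!: ennreal_leI)
        qed
        have card: "real (card J) = (\<Sum>k\<in>I. real (n k))"
          unfolding J_def using I(1) by (subst card_SigmaI) auto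
        have "c' / A * (\<Sum>k\<in>I. real k powr (- \<alpha>)) = (\<Sum>k\<in>I. \<eta> / 4 / h k) * (c powr p * (R / A)\<^sup>2)"
          unfolding sum_distrib_left sum_distrib_right
        proof (rule sum.cong)
          fix k assume "k \<in> I"
          then show "c' / A * real k powr (- \<alpha>) = \<eta> / 4 / h k * (c powr p * (R / A)\<^sup>2)"
            using A M flat(2) k1 by (simp add: c'_def h_def power2_eq_square field_simps)
        qed simp
        also have "\<dots> \<le> real (card J) * (c powr p * (R / A)\<^sup>2)"
          unfolding card using n(2) by (intro mult_right_mono sum_mono) auto
        finally have "ennreal (c' / A * (\<Sum>k\<in>I. real k powr (- \<alpha>)))
            \<le> ennreal (real (card J) * (c powr p * (R / A)\<^sup>2))"
          by (rule ennreal_leI)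
        also have "\<dots> \<le> (\<integral>\<^sup>+x\<in>P. ennreal (norm (dilated_conv (spiral \<alpha>) \<phi> A x) powr p) \<partial>lebesgue)"
        proof (rule nn_integral_ge_disjoint_balls[of J "R / A" "c powr p" z])
          show "finite J" unfolding J_def using I(1) by auto
        qed (use flat(1,2) A sep low in auto)
        finally show ?thesis .
      qed
      show thesis using c' sp(3) Ws(1) main by (rule that)
    qed
  qed
qed

section \<open>Necessary conditions\<close>

lemma power_of_two_between:
  fixes x :: real
  assumes "x > 0"
  obtains n :: int where "x \<le> 2 powi n" "2 powi n \<le> 2 * x"
proof -
  define n where "n = \<lceil>log 2 x\<rceil>"
  have e: "2 powi n = 2 powr real_of_int n" by (simp add: powr_real_of_int')
  have "x = 2 powr log 2 x" using assms by simp
  also have "\<dots> \<le> 2 powr real_of_int n" by (intro powr_mono) (auto simp: n_def)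
  finally have 1: "x \<le> 2 powi n" using e by simp
  have "2 powr real_of_int n \<le> 2 powr (log 2 x + 1)"
    using ceiling_correct[of "log 2 x"] by (intro powr_mono) (auto simp: n_def)
  also have "\<dots> = 2 * x" using assms by (simp add: powr_add)
  finally have "2 powi n \<le> 2 * x" using e by simp
  with 1 show ?thesis by (rule that)
qed

lemma power_of_two_nat_between:
  fixes x :: real
  assumes "x > 1"
  obtains j :: nat where "x \<le> 2 ^ j" "2 ^ j \<le> 2 * x" "1 \<le> j"
proof -
  obtain n :: int where n: "x \<le> 2 powi n" "2 powi n \<le> 2 * x"
    using power_of_two_between[of x] assms by auto
  have "n > 0"
  proof (rule ccontr)
    assume "\<not> n > 0"
    then have "(2::real) powi n \<le> 2 powi 0" by (intro power_int_increasing) auto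
    then show False using n(1) assms by simp
  qed
  then have "2 powi n = (2::real) ^ nat n" "1 \<le> nat n" by (auto simp: power_int_def)
  then show ?thesis using n that by metis
qed

lemma besov_type_norm_spiral_ge:
  fixes \<phi>0 \<phi> :: "real ^ 2 \<Rightarrow> complex"
  assumes adm: "admissible_pair \<phi>0 \<phi>" and \<alpha>: "\<alpha> > 0" and p: "1 \<le> p"
  obtains c K W where "c > 0" "1 \<le> K" "1 \<le> W"
    "\<And>m j I s \<tau>. nat m \<le> j \<Longrightarrow> 1 \<le> j \<Longrightarrow> finite I \<Longrightarrow> (\<And>k. k \<in> I \<Longrightarrow> K \<le> k) \<Longrightarrow>
      (\<And>k. k \<in> I \<Longrightarrow> W \<le> 2 ^ j * real k powr (- \<alpha> - 1)) \<Longrightarrow>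
      (\<And>k. k \<in> I \<Longrightarrow> 2 * real k powr (- \<alpha>) \<le> 2 powi (- m)) \<Longrightarrow>
      ennreal ((2 powi (- m)) powr (- 2 * \<tau>) * 2 powr (real j * s) * (c / 2 ^ j * (\<Sum>k\<in>I. real k powr
          (- \<alpha>))) powr (1 / p))
        \<le> besov_type_norm \<phi>0 \<phi> s \<tau> (ennreal p) \<infinity> (regular_distribution (indicator (spiral \<alpha>)))"
proof -
  have \<phi>: "\<phi> \<in> schwartz_space" "\<phi>0 \<in> schwartz_space" using adm by (auto simp: admissible_pair_def)
  have E: "spiral \<alpha> \<in> sets lebesgue" using spiral_lmeasurable[OF \<alpha>] by (rule fmeasurableD)
  obtain C where C: "C > 0" "\<forall>\<xi>. 3/5 \<le> norm \<xi> \<and> norm \<xi> \<le> 5/3 \<longrightarrow> C \<le> norm (fourier_transform \<phi> \<xi>)"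
    using adm by (auto simp: admissible_pair_def)
  have "norm (axis 1 1 :: real ^ 2) = 1" by (simp add: norm_axis_1)
  then have "C \<le> norm (fourier_transform \<phi> (axis 1 1))" using C(2) by simp
  then have ft: "fourier_transform \<phi> (axis 1 1) \<noteq> 0" using C(1) by auto
  show thesis
  proof (rule integral_dilated_conv_spiral_ge[OF \<phi>(1) ft \<alpha> p])
    fix c W :: real and K :: nat assume low: "c > 0" "1 \<le> K" "1 \<le> W"
    "\<And>A l I P. A > 0 \<Longrightarrow> finite I \<Longrightarrow> (\<And>k. k \<in> I \<Longrightarrow> K \<le> k) \<Longrightarrow>
      (\<And>k. k \<in> I \<Longrightarrow> W \<le> A * real k powr (- \<alpha> - 1)) \<Longrightarrow> (\<And>k. k \<in> I \<Longrightarrow> 2 * real k powr (- \<alpha>) \<le> l) \<Longrightarrow>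
      {x :: real ^ 2. \<forall>i. 0 \<le> x $ i \<and> x $ i < l} \<subseteq> P \<Longrightarrow>
      ennreal (c / A * (\<Sum>k\<in>I. real k powr (- \<alpha>))) \<le>
        (\<integral>\<^sup>+x\<in>P. ennreal (norm (dilated_conv (spiral \<alpha>) \<phi> A x) powr p) \<partial>lebesgue)"
    have "ennreal ((2 powi (- m)) powr (- 2 * \<tau>) * 2 powr (real j * s) * (c / 2 ^ j * (\<Sum>k\<in>I. real k
        powr (- \<alpha>))) powr (1 / p))
        \<le> besov_type_norm \<phi>0 \<phi> s \<tau> (ennreal p) \<infinity> (regular_distribution (indicator (spiral \<alpha>)))"
      if j: "nat m \<le> j" "1 \<le> j" and I: "finite I" "\<And>k. k \<in> I \<Longrightarrow> K \<le> k"
        "\<And>k. k \<in> I \<Longrightarrow> W \<le> 2 ^ j * real k powr (- \<alpha> - 1)" "\<And>k. k \<in> I \<Longrightarrow> 2 * real k powr (- \<alpha>) \<le> 2 powi (- m)"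
      for m j I s \<tau>
    proof (rule besov_type_norm_ge[OF p _ j(1)])
      show "0 \<le> c / 2 ^ j * (\<Sum>k\<in>I. real k powr (- \<alpha>))"
        using low(1) by (intro mult_nonneg_nonneg sum_nonneg) auto
      have "ennreal (c / 2 ^ j * (\<Sum>k\<in>I. real k powr (- \<alpha>))) \<le>
        (\<integral>\<^sup>+x\<in>dyadic_cube m 0. ennreal (norm (dilated_conv (spiral \<alpha>) \<phi> (2 ^ j) x) powr p) \<partial>lebesgue)"
        by (rule low(4)[OF _ I]) (auto simp: dyadic_cube_iff)
      then show "ennreal (c / 2 ^ j * (\<Sum>k\<in>I. real k powr (- \<alpha>))) \<le>
        (\<integral>\<^sup>+x\<in>dyadic_cube m 0. ennreal (norm (distr_convolution (lp_family \<phi>0 \<phi> j)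
            (regular_distribution (indicator (spiral \<alpha>))) x) powr p) \<partial>lebesgue)"
        using j(2) by (simp add: distr_convolution_lp_family[OF E \<phi>])
    qed
    with low(1-3) show thesis by (rule that)
  qed
qed

lemma ennreal_le_finite_imp_le:
  assumes "ennreal x \<le> N" "N < \<infinity>"
  shows "x \<le> enn2real N"
  using enn2real_mono[of "ennreal x" N] assms by (cases "x \<ge> 0") (auto intro: order_trans[OF _
      enn2real_nonneg])

text \<open>A neighbourhood of width \<open>2 powr (- j)\<close> of a single edge, on the turn \<open>K\<close>, has measure
  comparable to \<open>2 powr (- j)\<close>. So the norm dominates \<open>2 powr (j * (s - 1 / p))\<close>.\<close>

lemma besov_type_norm_spiral_finite_imp_le_inverse:
  fixes \<phi>0 \<phi> :: "real ^ 2 \<Rightarrow> complex"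
  assumes adm: "admissible_pair \<phi>0 \<phi>" and \<alpha>: "\<alpha> > 0" and p: "1 \<le> p"
    and fin: "besov_type_norm \<phi>0 \<phi> s \<tau> (ennreal p) \<infinity> (regular_distribution (indicator (spiral \<alpha>))) <
        \<infinity>" (is "?N < \<infinity>")
  shows "s \<le> 1 / p"
proof (rule ccontr)
  assume "\<not> s \<le> 1 / p"
  then have d: "s - 1 / p > 0" by simp
  show False
  proof (rule besov_type_norm_spiral_ge[OF adm \<alpha> p])
    fix c W :: real and K :: nat assume low: "c > 0" "1 \<le> K" "1 \<le> W"
    "\<And>m j I s \<tau>. nat m \<le> j \<Longrightarrow> 1 \<le> j \<Longrightarrow> finite I \<Longrightarrow> (\<And>k. k \<in> I \<Longrightarrow> K \<le> k) \<Longrightarrow>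
      (\<And>k. k \<in> I \<Longrightarrow> W \<le> 2 ^ j * real k powr (- \<alpha> - 1)) \<Longrightarrow>
      (\<And>k. k \<in> I \<Longrightarrow> 2 * real k powr (- \<alpha>) \<le> 2 powi (- m)) \<Longrightarrow>
      ennreal ((2 powi (- m)) powr (- 2 * \<tau>) * 2 powr (real j * s) * (c / 2 ^ j * (\<Sum>k\<in>I. real k powr
          (- \<alpha>))) powr (1 / p))
        \<le> besov_type_norm \<phi>0 \<phi> s \<tau> (ennreal p) \<infinity> (regular_distribution (indicator (spiral \<alpha>)))"
    have Kp: "0 < real K powr (- \<alpha> - 1)" "0 < real K powr (- \<alpha>)" using low(2) by auto
    define C where "C = 2 powr (- 2 * \<tau>) * (c * real K powr (- \<alpha>)) powr (1 / p)"
    have C: "C > 0" using low(1) Kp by (simp add: C_def)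
    obtain j1 where j1: "W / real K powr (- \<alpha> - 1) < 2 ^ j1" using real_arch_pow[of 2] by auto
    obtain j2 where j2: "enn2real ?N / C < (2 powr (s - 1 / p)) ^ j2"
      using real_arch_pow[of "2 powr (s - 1 / p)"] d by auto
    define j where "j = max 1 (max j1 j2)"
    have "(2::real) ^ j1 \<le> 2 ^ j" by (intro power_increasing) (auto simp: j_def)
    then have "W / real K powr (- \<alpha> - 1) \<le> 2 ^ j" using j1 by linarith
    then have WK: "W \<le> 2 ^ j * real K powr (- \<alpha> - 1)" using Kp by (simp add: pos_divide_le_eq)
    have "(2 powr (s - 1 / p)) ^ j2 \<le> (2 powr (s - 1 / p)) ^ j"
      using d by (intro power_increasing) (auto simp: j_def ge_one_powr_ge_zero)
    then have big: "enn2real ?N / C < (2 powr (s - 1 / p)) ^ j" using j2 by linarith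
    \<comment> \<open>The squares of side \<open>2 = 2 powi (- (- 1))\<close> are large enough for all turns.\<close>
    have K2: "2 * real K powr (- \<alpha>) \<le> 2 powi (- (- 1))"
      using powr_mono[of "- \<alpha>" 0 "real K"] low(2) \<alpha> by simp
    have "ennreal ((2 powi (- (- 1))) powr (- 2 * \<tau>) * 2 powr (real j * s) * (c / 2 ^ j * (\<Sum>k\<in>{K}. real k powr (- \<alpha>))) powr (1 / p)) \<le> ?N"
      by (rule low(4)) (use WK K2 in \<open>auto simp: j_def\<close>)
    moreover have "(2 powi (- (- 1))) powr (- 2 * \<tau>) * 2 powr (real j * s) * (c / 2 ^ j * (\<Sum>k\<in>{K}. real k powr (- \<alpha>))) powr (1 / p)
        = C * (2 powr (s - 1 / p)) ^ j"
    proof -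
      have e1: "(c / 2 ^ j * real K powr (- \<alpha>)) powr (1 / p) = (c * real K powr (- \<alpha>)) powr (1 / p)
          / (2 ^ j) powr (1 / p)"
        using low(1) by (simp add: powr_divide)
      have e2: "2 powr (real j * s) / (2 ^ j) powr (1 / p) = (2 powr (s - 1 / p)) ^ j"
      proof -
        have "(2 powr (s - 1 / p)) ^ j = 2 powr ((s - 1 / p) * real j)"
          by (simp add: powr_powr flip: powr_realpow)
        moreover have "((2::real) ^ j) powr (1 / p) = 2 powr (real j * (1 / p))"
          by (simp add: powr_powr flip: powr_realpow)
        ultimately show ?thesis by (simp add: algebra_simps flip: powr_diff)
      qed
      have "C * (2 powr (s - 1 / p)) ^ j = 2 powr (- 2 * \<tau>) * (c * real K powr (- \<alpha>)) powr (1 / p) *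
          (2 powr (real j * s) / (2 ^ j) powr (1 / p))"
        by (simp only: C_def e2)
      moreover have "(\<Sum>k\<in>{K}. real k powr (- \<alpha>)) = real K powr (- \<alpha>)" by simp
      ultimately show ?thesis by (simp only: e1 minus_minus power_int_1_right) simp
    qed
    ultimately have "C * (2 powr (s - 1 / p)) ^ j \<le> enn2real ?N"
      using ennreal_le_finite_imp_le[OF _ fin] by simp
    then show False using big C by (simp add: pos_divide_less_eq mult.commute)
  qed
qed

text \<open>On the turns from \<open>n\<close> to \<open>2 * n\<close> the distance between turns is comparable to \<open>2 powr (- j)\<close>
  if \<open>2 ^ j\<close> is comparable to \<open>n powr (\<alpha> + 1)\<close>. There the convolution is bounded below on a
  fixed proportion of a square at the origin of side about \<open>n powr (- \<alpha>)\<close>, and the norm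
  dominates a multiple of \<open>n powr d\<close>.\<close>

lemma besov_type_norm_spiral_finite_imp_le:
  fixes \<phi>0 \<phi> :: "real ^ 2 \<Rightarrow> complex"
  assumes adm: "admissible_pair \<phi>0 \<phi>" and \<alpha>: "\<alpha> > 0" and p: "1 \<le> p" and \<tau>: "0 \<le> \<tau>" and s: "0 < s"
    and fin: "besov_type_norm \<phi>0 \<phi> s \<tau> (ennreal p) \<infinity> (regular_distribution (indicator (spiral \<alpha>))) <
        \<infinity>" (is "?N < \<infinity>")
  shows "(\<alpha> + 1) * s \<le> 2 * \<alpha> * (1 / p - \<tau>)"
proof (rule ccontr)
  define d where "d = 2 * \<alpha> * \<tau> + (\<alpha> + 1) * s - 2 * \<alpha> / p"
  assume "\<not> ?thesis"
  then have d: "d > 0" by (simp add: d_def algebra_simps)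
  show False
  proof (rule besov_type_norm_spiral_ge[OF adm \<alpha> p])
    fix c W :: real and K :: nat assume low: "c > 0" "1 \<le> K" "1 \<le> W"
    "\<And>m j I s \<tau>. nat m \<le> j \<Longrightarrow> 1 \<le> j \<Longrightarrow> finite I \<Longrightarrow> (\<And>k. k \<in> I \<Longrightarrow> K \<le> k) \<Longrightarrow>
      (\<And>k. k \<in> I \<Longrightarrow> W \<le> 2 ^ j * real k powr (- \<alpha> - 1)) \<Longrightarrow>
      (\<And>k. k \<in> I \<Longrightarrow> 2 * real k powr (- \<alpha>) \<le> 2 powi (- m)) \<Longrightarrow>
      ennreal ((2 powi (- m)) powr (- 2 * \<tau>) * 2 powr (real j * s) * (c / 2 ^ j * (\<Sum>k\<in>I. real k powr
          (- \<alpha>))) powr (1 / p))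
        \<le> besov_type_norm \<phi>0 \<phi> s \<tau> (ennreal p) \<infinity> (regular_distribution (indicator (spiral \<alpha>)))"
    define c4 where "c4 = c * 2 powr (- \<alpha>) / (2 * W * 2 powr (\<alpha> + 1))"
    have c4: "c4 > 0" using low by (simp add: c4_def)
    define C where "C = 4 powr (- 2 * \<tau>) * c4 powr (1 / p)"
    have C: "C > 0" using c4 by (simp add: C_def)
    define y where "y = (enn2real ?N + 1) / C"
    have y: "y > 0" using C by (simp add: y_def add_nonneg_pos)
    obtain n0 where n0: "y powr (1 / d) < real n0" using reals_Archimedean2 by blast
    define n where "n = max K n0"
    have n: "K \<le> n" "1 \<le> real n" "y powr (1 / d) < real n" using n0 low(2) by (auto simp: n_def)
    have "y = (y powr (1 / d)) powr d" using y d by (simp add: powr_powr)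
    also have "\<dots> < real n powr d" using n d y by (intro powr_less_mono2) auto
    finally have yn: "enn2real ?N + 1 < C * real n powr d" using C
        by (simp add: y_def pos_divide_less_eq mult.commute)
    define x where "x = W * (2 * real n) powr (\<alpha> + 1)"
    have x1: "real n powr (\<alpha> + 1) < x" "x > 1"
    proof -
      have "1 \<le> real n powr (\<alpha> + 1)" using n \<alpha> by (intro ge_one_powr_ge_zero) auto
      moreover have "real n powr (\<alpha> + 1) < (2 * real n) powr (\<alpha> + 1)" using n \<alpha>
          by (intro powr_less_mono2) auto
      moreover have "1 * (2 * real n) powr (\<alpha> + 1) \<le> x" unfolding x_def using low(3)
          by (intro mult_right_mono) auto
      ultimately show "real n powr (\<alpha> + 1) < x" "x > 1" by linarith+
    qed
    obtain j where j: "x \<le> 2 ^ j" "2 ^ j \<le> 2 * x" "1 \<le> j" using power_of_two_nat_between[OF x1(2)] by blast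
    have np: "real n powr (- \<alpha>) > 0" using n by simp
    obtain m' :: int where m': "2 * real n powr (- \<alpha>) \<le> 2 powi m'" "2 powi m' \<le> 2 * (2 * real n powr (- \<alpha>))"
      using power_of_two_between[of "2 * real n powr (- \<alpha>)"] np by auto
    define m where "m = - m'"
    let ?l = "(2::real) powi (- m)"
    have l: "2 * real n powr (- \<alpha>) \<le> ?l" "?l \<le> 4 * real n powr (- \<alpha>)" "?l > 0"
      using m' np unfolding m_def minus_minus by linarith+
    have mj: "nat m \<le> j"
    proof (rule ccontr)
      assume "\<not> nat m \<le> j"
      then have "- m < - int j" by linarith
      then have "?l < 2 powi (- int j)" by (intro power_int_strict_increasing) auto
      also have "\<dots> = 1 / 2 ^ j" by (simp add: power_int_minus divide_inverse)
      also have "\<dots> \<le> 1 / real n powr (\<alpha> + 1)" using x1 j n by (intro divide_left_mono) auto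
      also have "\<dots> \<le> 1 / real n powr \<alpha>" using n by (intro divide_left_mono powr_mono) auto
      also have "\<dots> = real n powr (- \<alpha>)" by (simp add: powr_minus_divide)
      finally show False using l(1) np by linarith
    qed
    have fit: "W \<le> 2 ^ j * real k powr (- \<alpha> - 1)" if "k \<in> {n..2 * n}" for k
    proof -
      have "W = x * (2 * real n) powr (- \<alpha> - 1)"
        using n by (simp add: x_def mult.assoc flip: powr_add)
      also have "\<dots> \<le> 2 ^ j * real k powr (- \<alpha> - 1)"
        using j(1) x1 that n \<alpha> by (intro mult_mono powr_mono2') auto
      finally show ?thesis .
    qed
    have fit2: "2 * real k powr (- \<alpha>) \<le> ?l" if "k \<in> {n..2 * n}" for k
    proof -
      have "real k powr (- \<alpha>) \<le> real n powr (- \<alpha>)" using that n \<alpha> by (intro powr_mono2') auto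
      then show ?thesis using l(1) by linarith
    qed
    have "ennreal (?l powr (- 2 * \<tau>) * 2 powr (real j * s) * (c / 2 ^ j * (\<Sum>k\<in>{n..2 * n}. real k
        powr (- \<alpha>))) powr (1 / p)) \<le> ?N"
      by (rule low(4)[OF mj j(3)]) (use n fit fit2 in auto)
    then have up: "?l powr (- 2 * \<tau>) * 2 powr (real j * s) * (c / 2 ^ j * (\<Sum>k\<in>{n..2 * n}. real k
        powr (- \<alpha>))) powr (1 / p) \<le> enn2real ?N"
      by (rule ennreal_le_finite_imp_le[OF _ fin])
    have f1: "4 powr (- 2 * \<tau>) * real n powr (2 * \<alpha> * \<tau>) \<le> ?l powr (- 2 * \<tau>)"
    proof -
      have "4 powr (- 2 * \<tau>) * real n powr (2 * \<alpha> * \<tau>) = (4 * real n powr (- \<alpha>)) powr (- 2 * \<tau>)"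
        using n by (simp add: powr_mult powr_powr mult_ac)
      also have "\<dots> \<le> ?l powr (- 2 * \<tau>)" using l \<tau> by (intro powr_mono2') auto
      finally show ?thesis .
    qed
    have f2: "real n powr ((\<alpha> + 1) * s) \<le> 2 powr (real j * s)"
    proof -
      have "real n powr ((\<alpha> + 1) * s) = (real n powr (\<alpha> + 1)) powr s" by (simp add: powr_powr)
      also have "\<dots> \<le> (2 ^ j) powr s" using x1 j s by (intro powr_mono2) auto
      also have "\<dots> = 2 powr (real j * s)" by (simp add: powr_powr flip: powr_realpow)
      finally show ?thesis .
    qed
    have f3: "c4 powr (1 / p) * real n powr (- 2 * \<alpha> / p) \<le> (c / 2 ^ j * (\<Sum>k\<in>{n..2 * n}. real k powr
        (- \<alpha>))) powr (1 / p)"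
    proof -
      have "real n * (2 * real n) powr (- \<alpha>) \<le> real (card {n..2 * n}) * (2 * real n) powr (- \<alpha>)"
        by (intro mult_right_mono) auto
      also have "\<dots> = (\<Sum>k\<in>{n..2 * n}. (2 * real n) powr (- \<alpha>))" by simp
      also have "\<dots> \<le> (\<Sum>k\<in>{n..2 * n}. real k powr (- \<alpha>))"
        using n \<alpha> by (intro sum_mono powr_mono2') auto
      finally have S: "real n * (2 * real n) powr (- \<alpha>) \<le> (\<Sum>k\<in>{n..2 * n}. real k powr (- \<alpha>))" .
      have "c4 * real n powr (- 2 * \<alpha>) = c / (2 * x) * (real n * (2 * real n) powr (- \<alpha>))"
      proof -
        have "real n powr (- 2 * \<alpha>) = real n powr (1 + (- \<alpha>) - (\<alpha> + 1))" by (simp add: algebra_simps)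
        also have "\<dots> = real n * real n powr (- \<alpha>) / real n powr (\<alpha> + 1)"
          using n by (simp only: powr_diff powr_add powr_one)
        finally have "real n powr (- 2 * \<alpha>) = real n * real n powr (- \<alpha>) / real n powr (\<alpha> + 1)" .
        then show ?thesis by (simp add: c4_def x_def powr_mult mult_ac)
      qed
      also have "\<dots> \<le> c / 2 ^ j * (\<Sum>k\<in>{n..2 * n}. real k powr (- \<alpha>))"
        using S j low(1) x1 by (intro mult_mono divide_left_mono) auto
      finally have "(c4 * real n powr (- 2 * \<alpha>)) powr (1 / p)
          \<le> (c / 2 ^ j * (\<Sum>k\<in>{n..2 * n}. real k powr (- \<alpha>))) powr (1 / p)"
        using c4 p by (intro powr_mono2) auto
      moreover have "(c4 * real n powr (- 2 * \<alpha>)) powr (1 / p) = c4 powr (1 / p) * real n powr (- 2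
          * \<alpha> / p)"
        using c4 by (simp add: powr_mult powr_powr)
      ultimately show ?thesis by simp
    qed
    have "C * real n powr d = (4 powr (- 2 * \<tau>) * real n powr (2 * \<alpha> * \<tau>)) * real n powr ((\<alpha> + 1) *
        s) * (c4 powr (1 / p) * real n powr (- 2 * \<alpha> / p))"
    proof -
      have "d = 2 * \<alpha> * \<tau> + (\<alpha> + 1) * s + (- 2 * \<alpha> / p)" by (simp add: d_def)
      then have "real n powr d = real n powr (2 * \<alpha> * \<tau>) * real n powr ((\<alpha> + 1) * s) * real n powr
          (- 2 * \<alpha> / p)"
        by (simp only: powr_add)
      then show ?thesis by (simp add: C_def mult_ac)
    qed
    also have "\<dots> \<le> ?l powr (- 2 * \<tau>) * 2 powr (real j * s) * (c / 2 ^ j * (\<Sum>k\<in>{n..2 * n}. real k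
        powr (- \<alpha>))) powr (1 / p)"
      by (intro mult_mono f1 f2 f3) auto
    finally show False using up yn by linarith
  qed
qed

text \<open>For \<open>\<alpha> = 1\<close> the turn \<open>k\<close> has length comparable to \<open>1 / k\<close>. All turns up to \<open>K + n\<close> are seen
  at scale \<open>2 powr (- j)\<close> if \<open>2 ^ j\<close> exceeds a multiple of \<open>(K + n)\<^sup>2\<close>, and the weight
  \<open>2 powr (j / p)\<close> cancels their width, so a bounded norm would bound the harmonic series.\<close>

lemma besov_type_norm_spiral_one_infinite:
  fixes \<phi>0 \<phi> :: "real ^ 2 \<Rightarrow> complex"
  assumes adm: "admissible_pair \<phi>0 \<phi>" and p: "1 \<le> p"
    and fin: "besov_type_norm \<phi>0 \<phi> (1 / p) 0 (ennreal p) \<infinity> (regular_distribution (indicator (spiral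
        1))) < \<infinity>" (is "?N < \<infinity>")
  shows False
proof (rule besov_type_norm_spiral_ge[OF adm zero_less_one p])
  fix c W :: real and K :: nat assume low: "c > 0" "1 \<le> K" "1 \<le> W"
    "\<And>m j I s \<tau>. nat m \<le> j \<Longrightarrow> 1 \<le> j \<Longrightarrow> finite I \<Longrightarrow> (\<And>k. k \<in> I \<Longrightarrow> K \<le> k) \<Longrightarrow>
      (\<And>k. k \<in> I \<Longrightarrow> W \<le> 2 ^ j * real k powr (- 1 - 1)) \<Longrightarrow>
      (\<And>k. k \<in> I \<Longrightarrow> 2 * real k powr (- 1) \<le> 2 powi (- m)) \<Longrightarrow>
      ennreal ((2 powi (- m)) powr (- 2 * \<tau>) * 2 powr (real j * s) * (c / 2 ^ j * (\<Sum>k\<in>I. real k powr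
          (- 1))) powr (1 / p))
        \<le> besov_type_norm \<phi>0 \<phi> s \<tau> (ennreal p) \<infinity> (regular_distribution (indicator (spiral 1)))"
  have bound: "(\<Sum>k\<in>{K..<K + n}. inverse (real k)) \<le> enn2real ?N powr p / c" for n
  proof -
    define b where "b = 2 * W * real (K + n) powr 2"
    have Kn: "1 \<le> real (K + n)" using low(2) by simp
    have "1 * 1 \<le> W * real (K + n) powr 2" using low(3) Kn by (intro mult_mono ge_one_powr_ge_zero) auto
    then have b1: "b > 1" by (simp add: b_def)
    obtain j where j: "b \<le> 2 ^ j" "1 \<le> j" using power_of_two_nat_between[OF b1] by blast
    have fit: "W \<le> 2 ^ j * real k powr (- 1 - 1)" if "k \<in> {K..<K + n}" for k
    proof -
      have k: "1 \<le> real k" "real k \<le> real (K + n)" using that low(2) by auto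
      have "real (K + n) powr 2 * real (K + n) powr (- 2) = 1"
        using Kn by (simp only: powr_add[symmetric]) simp
      then have "b * real (K + n) powr (- 2) = 2 * W" unfolding b_def by (simp only: mult.assoc)
      then have "W * 1 \<le> b * real (K + n) powr (- 2)" using low(3) by simp
      also have "\<dots> \<le> 2 ^ j * real k powr (- 2)"
        using j(1) b1 k by (intro mult_mono powr_mono2') auto
      finally show ?thesis by simp
    qed
    have fit2: "2 * real k powr (- 1) \<le> 2 powi (- (- 1))" if "k \<in> {K..<K + n}" for k
    proof -
      have "real k powr (- 1) \<le> real k powr 0" using that low(2) by (intro powr_mono) auto
      also have "\<dots> = 1" using that low(2) by simp
      finally show ?thesis unfolding minus_minus power_int_1_right by linarith
    qed
    have "ennreal ((2 powi (- (- 1))) powr (- 2 * 0) * 2 powr (real j * (1 / p)) * (c / 2 ^ j *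
        (\<Sum>k\<in>{K..<K + n}. real k powr (- 1))) powr (1 / p)) \<le> ?N"
      by (rule low(4)) (use j fit fit2 in auto)
    then have "2 powr (real j * (1 / p)) * (c / 2 ^ j * (\<Sum>k\<in>{K..<K + n}. real k powr (- 1))) powr (1
        / p) \<le> enn2real ?N"
      using ennreal_le_finite_imp_le[OF _ fin] by simp
    moreover have "2 powr (real j * (1 / p)) * (c / 2 ^ j * (\<Sum>k\<in>{K..<K + n}. real k powr (- 1)))
        powr (1 / p)
        = (c * (\<Sum>k\<in>{K..<K + n}. real k powr (- 1))) powr (1 / p)"
    proof -
      have "2 powr (real j * (1 / p)) = (2 ^ j) powr (1 / p)" by (simp add: powr_powr flip: powr_realpow)
      then have "2 powr (real j * (1 / p)) * (c / 2 ^ j * (\<Sum>k\<in>{K..<K + n}. real k powr (- 1))) powr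
          (1 / p) =
          (2 ^ j * (c / 2 ^ j * (\<Sum>k\<in>{K..<K + n}. real k powr (- 1)))) powr (1 / p)"
        by (simp only: powr_mult)
      also have "2 ^ j * (c / 2 ^ j * (\<Sum>k\<in>{K..<K + n}. real k powr (- 1))) = c * (\<Sum>k\<in>{K..<K + n}.
          real k powr (- 1))"
        by simp
      finally show ?thesis .
    qed
    ultimately have "(c * (\<Sum>k\<in>{K..<K + n}. real k powr (- 1))) powr (1 / p) \<le> enn2real ?N" by simp
    then have "((c * (\<Sum>k\<in>{K..<K + n}. real k powr (- 1))) powr (1 / p)) powr p \<le> enn2real ?N powr p"
      using p by (intro powr_mono2) auto
    moreover have "((c * (\<Sum>k\<in>{K..<K + n}. real k powr (- 1))) powr (1 / p)) powr p = c * (\<Sum>k\<in>{K..<K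
        + n}. real k powr (- 1))"
    proof -
      have "0 \<le> c * (\<Sum>k\<in>{K..<K + n}. real k powr (- 1))" using low(1)
          by (intro mult_nonneg_nonneg sum_nonneg) auto
      then show ?thesis using p by (simp add: powr_powr)
    qed
    moreover have "(\<Sum>k\<in>{K..<K + n}. real k powr (- 1)) = (\<Sum>k\<in>{K..<K + n}. inverse (real k))"
      using low(2) by (intro sum.cong) (auto simp: powr_minus)
    ultimately have "c * (\<Sum>k\<in>{K..<K + n}. inverse (real k)) \<le> enn2real ?N powr p" by simp
    then show ?thesis using low(1) by (simp add: pos_le_divide_eq mult.commute)
  qed
  have "summable (\<lambda>i. inverse (real (i + K)))"
  proof (rule summableI_nonneg_bounded)
    show "(\<Sum>i<n. inverse (real (i + K))) \<le> enn2real ?N powr p / c" for n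
    proof -
      have "(\<Sum>i<n. inverse (real (i + K))) = (\<Sum>k\<in>{K..<K + n}. inverse (real k))"
        by (rule sum.reindex_bij_witness[of _ "\<lambda>k. k - K" "\<lambda>i. i + K"]) auto
      then show ?thesis using bound[of n] by simp
    qed
  qed simp
  then have "summable (\<lambda>i. inverse (real i))" by (rule summable_iff_shift[THEN iffD1])
  then show False using not_summable_harmonic[where 'a = real] by simp
qed

text \<open>The critical smoothness in the forms in which the sufficient and the necessary estimates use
  it.\<close>

lemma smoothness_bound_iff:
  fixes \<alpha> p s \<tau> :: real
  assumes "\<alpha> > 0" "1 \<le> p"
  shows "s \<le> 2 * \<alpha> / (\<alpha> + 1) * (1 / p - \<tau>) \<longleftrightarrow> s * p * (1 + 1 / \<alpha>) \<le> 2 - 2 * \<tau> * p"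
    and "s \<le> 2 * \<alpha> / (\<alpha> + 1) * (1 / p - \<tau>) \<longleftrightarrow> (\<alpha> + 1) * s \<le> 2 * \<alpha> * (1 / p - \<tau>)"
proof -
  have a: "s \<le> 2 * \<alpha> / (\<alpha> + 1) * (1 / p - \<tau>) \<longleftrightarrow> (\<alpha> + 1) * s \<le> 2 * \<alpha> * (1 / p - \<tau>)"
    using assms by (simp add: pos_le_divide_eq mult.commute)
  have "(\<alpha> + 1) * s \<le> 2 * \<alpha> * (1 / p - \<tau>) \<longleftrightarrow> (p / \<alpha>) * ((\<alpha> + 1) * s) \<le> (p / \<alpha>) * (2 * \<alpha> * (1 / p - \<tau>))"
    using assms by (subst mult_le_cancel_left_pos) auto
  also have "(p / \<alpha>) * ((\<alpha> + 1) * s) = s * p * (1 + 1 / \<alpha>)" using assms by (simp add: field_simps)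
  also have "(p / \<alpha>) * (2 * \<alpha> * (1 / p - \<tau>)) = 2 - 2 * \<tau> * p" using assms by (simp add: field_simps)
  finally show "s \<le> 2 * \<alpha> / (\<alpha> + 1) * (1 / p - \<tau>) \<longleftrightarrow> s * p * (1 + 1 / \<alpha>) \<le> 2 - 2 * \<tau> * p"
    using a by simp
  show "s \<le> 2 * \<alpha> / (\<alpha> + 1) * (1 / p - \<tau>) \<longleftrightarrow> (\<alpha> + 1) * s \<le> 2 * \<alpha> * (1 / p - \<tau>)" by (rule a)
qed

theorem theorem5p23:
  fixes \<phi>0 \<phi> :: "real ^ 2 \<Rightarrow> complex" and \<alpha> p \<tau> s :: real
  assumes "admissible_pair \<phi>0 \<phi>"
    and "0 < \<alpha>"
    and "1 \<le> p"
    and "0 \<le> \<tau>" and "\<tau> \<le> 1 / p"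
    and "0 < s" and "s \<le> 1"
  shows
    "(\<alpha> < 1 \<longrightarrow>
        (regular_distribution (indicator (spiral \<alpha>)) \<in> besov_type_space \<phi>0 \<phi> s \<tau> (ennreal p) \<infinity>
         \<longleftrightarrow> s \<le> 2 * \<alpha> / (\<alpha> + 1) * (1 / p - \<tau>))) \<and>
     (\<alpha> = 1 \<longrightarrow>
        (regular_distribution (indicator (spiral \<alpha>)) \<in> besov_type_space \<phi>0 \<phi> s \<tau> (ennreal p) \<infinity>
         \<longleftrightarrow> s \<le> 1 / p - \<tau> \<and> s < 1 / p)) \<and>
     (1 < \<alpha> \<longrightarrow>
        (regular_distribution (indicator (spiral \<alpha>)) \<in> besov_type_space \<phi>0 \<phi> s \<tau> (ennreal p) \<infinity>
         \<longleftrightarrow> s \<le> 2 * \<alpha> / (\<alpha> + 1) * (1 / p - \<tau>) \<and> s \<le> 1 / p))"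
proof -
  let ?E = "regular_distribution (indicator (spiral \<alpha>)) :: (real ^ 2 \<Rightarrow> complex) \<Rightarrow> complex"
  let ?in = "?E \<in> besov_type_space \<phi>0 \<phi> s \<tau> (ennreal p) \<infinity>"
  let ?b = "s \<le> 2 * \<alpha> / (\<alpha> + 1) * (1 / p - \<tau>)"
  note adm = assms(1) and \<alpha> = assms(2) and p = assms(3) and \<tau> = assms(4,5) and s = assms(6,7)
  have in_iff: "?in \<longleftrightarrow> besov_type_norm \<phi>0 \<phi> s \<tau> (ennreal p) \<infinity> ?E < \<infinity>"
    using regular_distribution_tempered[OF spiral_lmeasurable[OF \<alpha>]] by (simp add: besov_type_space_def)
  have sp: "s \<le> 1 / p \<longleftrightarrow> s * p \<le> 1" "s < 1 / p \<longleftrightarrow> s * p < 1"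
    using p by (simp_all add: pos_le_divide_eq pos_less_divide_eq)
  have suff: ?in if "?b" "s \<le> 1 / p" "\<alpha> = 1 \<Longrightarrow> s < 1 / p"
  proof -
    have 1: "s * p * (1 + 1 / \<alpha>) \<le> 2 - 2 * \<tau> * p" using that(1) smoothness_bound_iff(1)[OF \<alpha> p] by blast
    have 2: "s * p \<le> 1" using that(2) sp(1) by blast
    have 3: "\<alpha> = 1 \<Longrightarrow> s * p < 1" using that(3) sp(2) by blast
    show ?thesis
      unfolding in_iff by (rule besov_type_norm_spiral_finite[OF adm \<alpha> p \<tau>(1) s(1) 2 3 1])
  qed
  have nec: "?b" "s \<le> 1 / p" if "?in"
    using besov_type_norm_spiral_finite_imp_le[OF adm \<alpha> p \<tau>(1) s(1)]
      besov_type_norm_spiral_finite_imp_le_inverse[OF adm \<alpha> p] that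
    unfolding in_iff smoothness_bound_iff(2)[OF \<alpha> p] by blast+
  have "?in \<longleftrightarrow> ?b" if "\<alpha> < 1"
  proof -
    have "2 * \<alpha> / (\<alpha> + 1) * (1 / p - \<tau>) \<le> 1 * (1 / p)"
      using that \<alpha> \<tau> by (intro mult_mono) (auto simp: divide_le_eq)
    then have "?b \<Longrightarrow> s \<le> 1 / p" by simp
    then show ?thesis using suff nec that by auto
  qed
  moreover have "?in \<longleftrightarrow> s \<le> 1 / p - \<tau> \<and> s < 1 / p" if \<alpha>1: "\<alpha> = 1"
  proof
    assume i: ?in
    then have b: "s \<le> 1 / p - \<tau>" using nec(1) \<alpha>1 by simp
    have "s \<noteq> 1 / p"
    proof
      assume e: "s = 1 / p"
      then have "\<tau> = 0" using b \<tau> by simp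
      then show False
        using besov_type_norm_spiral_one_infinite[OF adm p] i e \<alpha>1 unfolding in_iff by simp
    qed
    then show "s \<le> 1 / p - \<tau> \<and> s < 1 / p" using b \<tau> by auto
  next
    assume "s \<le> 1 / p - \<tau> \<and> s < 1 / p"
    then show ?in using suff \<alpha>1 by simp
  qed
  moreover have "?in \<longleftrightarrow> ?b \<and> s \<le> 1 / p" if "1 < \<alpha>"
    using suff nec that by auto
  ultimately show ?thesis by blast
qed

end
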